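(* Let $q\ge 2$ be an even integer. The expected value of the number of carries equal to $1$ when adding two independent random symmetric signed digit expansions (SSDEs) of length $\ell$ by standard addition is $$\frac{q^2+2q+4}{8(q+1)^2}\,\ell+O(1)$$ and the variance is $$\frac{7q^6+48q^5+159q^4+128q^3-48q^2-12q-8}{64(q+1)^5(q-1)}\,\ell+O(1).$$ The same result holds for carries equal to $-1$. The covariance between the number of carries $1$ and the number of carries $-1$ is $$-\frac{q^6+24q^5+33q^4+80q^3+120q^2-12q-8}{64(q+1)^5(q-1)}\,\ell+O(1).$$ The numbers of carries $1$ and $-1$ are asymptotically jointly normally distributed.
   Context: For even $q\ge 2$, an SSDE of length $\ell$ is a word $x_{\ell-1}\ldots x_0$ with digits $x_j\in\{-\frac q2,\ldots,\frac q2\}$ (leading zeros allowed) satisfying, for $0\le j<\ell-1$, the syntactical rule $$|x_j|=\tfrac q2\ \Longrightarrow\ 0\le \operatorname{sgn}(x_j)x_{j+1}\le \tfrac q2-1 .$$ The probabilistic model is: the two summands $x$ and $y$ are independent, each uniformly distributed on all SSDEs of length $\ell$. Standard addition: put $s_j=x_j+y_j$ for $0\le j<\ell$, $s_j=0$ for $j\ge \ell$, and $c_0=0$. For $j=0,\ldots,\ell-1$ let $a=s_j+c_j$ and define the carry $c_{j+1}$ by: - $c_{j+1}=1$ if $a>\frac q2$, or if $a=\frac q2$ and ($-\frac q2\le s_{j+1}<0$ or $\frac q2\le s_{j+1}<q$); - $c_{j+1}=-1$ if $a<-\frac q2$, or if $a=-\frac q2$ and ($-q<s_{j+1}\le-\frac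 q2$ or $0<s_{j+1}\le\frac q2$); - $c_{j+1}=0$ otherwise. The output digit is $z_j=a-qc_{j+1}$. The number of carries equal to $1$ (respectively $-1$) is the number of $j\in\{1,\ldots,\ell\}$ with $c_j=1$ (respectively $c_j=-1$). Here $q$ is fixed and asymptotics are for $\ell\to\infty$. Asymptotically jointly normally distributed means that the vector of the two numbers of carries, after centering by its mean and dividing by $\sqrt{\ell}$, converges in distribution to a nondegenerate bivariate normal law. *)

theory Defs
  imports "HOL-Probability.Probability" "HOL-Library.Landau_Symbols"
begin

text \<open>
  Words are lists with the least significant digit first: \<open>xs ! j\<close> is the digit \<open>x\<^sub>j\<close>.
\<close>

definition SSDE :: "int \<Rightarrow> nat \<Rightarrow> int list set" where
  "SSDE q l = {xs. length xs = l \<and> set xs \<subseteq> {- (q div 2)..q div 2} \<and>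
     (\<forall>j. Suc j < l \<longrightarrow> \<bar>xs ! j\<bar> = q div 2 \<longrightarrow>
        sgn (xs ! j) * xs ! Suc j \<in> {0..q div 2 - 1})}"

definition digit_sum :: "int list \<Rightarrow> int list \<Rightarrow> nat \<Rightarrow> int" where
  "digit_sum xs ys j = (if j < length xs then xs ! j + ys ! j else 0)"

definition next_carry :: "int \<Rightarrow> int \<Rightarrow> int \<Rightarrow> int" where
  "next_carry q a t =
     (if a > q div 2 \<or>
         a = q div 2 \<and> (- (q div 2) \<le> t \<and> t < 0 \<or> q div 2 \<le> t \<and> t < q) then 1
      else if a < - (q div 2) \<or>
         a = - (q div 2) \<and> (- q < t \<and> t \<le> - (q div 2) \<or> 0 < t \<and> t \<le> q div 2) then - 1
      else 0)"

primrec carry :: "int \<Rightarrow> int list \<Rightarrow> int list \<Rightarrow> nat \<Rightarrow> int" where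
  "carry q xs ys 0 = 0"
| "carry q xs ys (Suc j) =
     next_carry q (digit_sum xs ys j + carry q xs ys j) (digit_sum xs ys (Suc j))"

definition num_carries :: "int \<Rightarrow> int \<Rightarrow> int list \<times> int list \<Rightarrow> real" where
  "num_carries q d = (\<lambda>(xs, ys). real (card {j \<in> {1..length xs}. carry q xs ys j = d}))"

definition random_summands :: "int \<Rightarrow> nat \<Rightarrow> (int list \<times> int list) pmf" where
  "random_summands q l = pair_pmf (pmf_of_set (SSDE q l)) (pmf_of_set (SSDE q l))"

text \<open>
  \<open>pmf_of_set\<close> is only meaningful for finite nonempty sets.
\<close>

lemma finite_SSDE: "finite (SSDE q l)"
proof (rule finite_subset)
  show "SSDE q l \<subseteq> {xs. set xs \<subseteq> {- (q div 2)..q div 2} \<and> length xs = l}"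
    by (auto simp: SSDE_def)
qed (rule finite_lists_length_eq, simp)

lemma SSDE_nonempty:
  assumes "q \<ge> 2"
  shows "SSDE q l \<noteq> {}"
proof -
  have "q div 2 \<ge> 1"
    using assms by linarith
  then have "replicate l 0 \<in> SSDE q l"
    by (auto simp: SSDE_def)
  then show ?thesis
    by blast
qed

definition covariance :: "'a measure \<Rightarrow> ('a \<Rightarrow> real) \<Rightarrow> ('a \<Rightarrow> real) \<Rightarrow> real" where
  "covariance M X Y = (\<integral>\<omega>. (X \<omega> - (\<integral>\<omega>'. X \<omega>' \<partial>M)) * (Y \<omega> - (\<integral>\<omega>'. Y \<omega>' \<partial>M)) \<partial>M)"

text \<open>
  The centered normal law on the plane with covariance matrix \<open>((a, b), (b, c))\<close>, which is
  nondegenerate iff this matrix is positive definite, i.e. \<open>0 < a\<close> and \<open>b\<^sup>2 < a * c\<close>.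
\<close>

definition bivariate_normal :: "real \<Rightarrow> real \<Rightarrow> real \<Rightarrow> (real \<times> real) measure" where
  "bivariate_normal a b c = density lborel (\<lambda>(u, v). ennreal (
     exp (- (c * u\<^sup>2 - 2 * b * u * v + a * v\<^sup>2) / (2 * (a * c - b\<^sup>2))) /
     (2 * pi * sqrt (a * c - b\<^sup>2))))"

definition converges_in_distribution ::
  "(nat \<Rightarrow> 'a measure) \<Rightarrow> (nat \<Rightarrow> 'a \<Rightarrow> 'b) \<Rightarrow> 'b :: topological_space measure \<Rightarrow> bool" where
  "converges_in_distribution M X N \<longleftrightarrow>
     (\<forall>f :: 'b \<Rightarrow> real. continuous_on UNIV f \<longrightarrow> bounded (range f) \<longrightarrow>
        (\<lambda>n. \<integral>\<omega>. f (X n \<omega>) \<partial>M n) \<longlonglongrightarrow> (\<integral>z. f z \<partial>N))"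

definition asymptotically_jointly_normal ::
  "(nat \<Rightarrow> 'a measure) \<Rightarrow> (nat \<Rightarrow> 'a \<Rightarrow> real) \<Rightarrow> (nat \<Rightarrow> 'a \<Rightarrow> real) \<Rightarrow> bool" where
  "asymptotically_jointly_normal M X Y \<longleftrightarrow>
     (\<exists>a b c. 0 < a \<and> b\<^sup>2 < a * c \<and>
        converges_in_distribution M
          (\<lambda>n \<omega>. ((X n \<omega> - (\<integral>\<omega>'. X n \<omega>' \<partial>M n)) / sqrt (real n),
                   (Y n \<omega> - (\<integral>\<omega>'. Y n \<omega>' \<partial>M n)) / sqrt (real n)))
          (bivariate_normal a b c))"

end

theory Submission
  imports Defs
begin

text \<open>
  Weighting the digits by the Perron eigenvector of the syntactical rule turns a uniformly random
  SSDE into a Markov chain, up to a bounded factor that depends only on the last digit. The pair of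
  current digits together with the sum \<open>a = x\<^sub>j + y\<^sub>j + c\<^sub>j\<close> is then a finite Markov chain that two
  zero digits reset, so it mixes geometrically, and the carries are an additive functional \<open>f\<close> of it.
  If \<open>g\<close> and \<open>h\<close> solve the Poisson equations \<open>K f = g - K g\<close> and
  \<open>K (f\<^sup>2 + 2 f g) = \<sigma>\<^sup>2 + h - K h\<close> (\<open>K\<close> the transition operator, \<open>f\<close> centered), then the variance
  is \<open>\<sigma>\<^sup>2 l + O(1)\<close>, and \<open>1 + \<i> \<epsilon> g - \<epsilon>\<^sup>2 h / 2\<close> is an eigenfunction of the operator twisted by
  \<open>exp (\<i> \<epsilon> f)\<close> up to \<open>O(\<epsilon>\<^sup>3)\<close>, which gives the limit of the characteristic function.

  The functions \<open>g\<close> and \<open>h\<close> are explicit rational functions of \<open>q\<close>. They are given for the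
  number \<open>U\<close> of nonzero carries and the sum \<open>V\<close> of all carries, which are even and odd under
  negation of the summands and hence asymptotically uncorrelated.
\<close>

section \<open>Bivariate normal laws and convergence in distribution\<close>

text \<open>The rule for a carry looks one digit ahead, so \<open>c_{j+1}\<close> is not a function
  of the digits up to position \<open>j\<close>. Keeping \<open>a\<close> in the state and deciding
  the carry when the next digit pair arrives removes the look-ahead; the state then runs one
  position behind the carries.

  The obstacle is that \<open>q\<close> is a parameter: the chain has on the order of
  \<open>q^2\<close> states, so there is no fixed matrix to invert. However, the transition
  probabilities depend on a state only through the types of its two digits (\<open>q/2\<close>,
  \<open>-q/2\<close> or neither) and one of five classes of \<open>a\<close>. They count lattice
  points in rectangles and hence are polynomials in \<open>q\<close> divided by
  \<open>4 * q^2\<close>. The Poisson equations thus become finitely many polynomial identities, and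
  checking a given solution replaces spectral theory.

  Moments and limit law are obtained for \<open>s * X + t * Y\<close> with arbitrary real
  \<open>s\<close> and \<open>t\<close>, where \<open>X\<close> and \<open>Y\<close> count the
  carries 1 and -1. Values 0 and 1 of \<open>s\<close> and \<open>t\<close> give the variances and,
  by polarization, the covariance; all values together give the characteristic function of the
  pair.\<close>

abbreviation (input) std_normal2 :: "(real \<times> real) measure" where
  "std_normal2 \<equiv> std_normal_distribution \<Otimes>\<^sub>M std_normal_distribution"

lemma prob_space_std_normal: "prob_space std_normal_distribution"
  using real_dist_normal_dist by (simp add: real_distribution_def)

lemma prob_space_std_normal2: "prob_space std_normal2"
  by (intro prob_space_pair prob_space_std_normal)

lemma sets_std_normal2: "sets std_normal2 = sets borel"
proof -
  have "sets std_normal2 = sets (borel \<Otimes>\<^sub>M borel)" by (intro sets_pair_measure_cong) auto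
  then show ?thesis by (simp only: borel_prod)
qed

lemma space_std_normal2 [simp]: "space std_normal2 = UNIV"
  by (simp add: space_pair_measure)

lemma measurable_pair_borel_borel [measurable]: 
  "f \<in> borel_measurable M \<Longrightarrow> g \<in> borel_measurable M \<Longrightarrow> (\<lambda>x. (f x, g x) :: real \<times> real) \<in> borel_measurable M"
  unfolding borel_prod[symmetric] by measurable

lemma borel_measurable_fst_snd_real [measurable]:
  "(fst :: real \<times> real \<Rightarrow> real) \<in> borel_measurable borel" "(snd :: real \<times> real \<Rightarrow> real) \<in> borel_measurable borel"
  by (auto intro!: borel_measurable_continuous_onI continuous_intros)

lemma borel_measurable_cis [measurable]: "cis \<in> borel_measurable borel"
  by (auto intro!: borel_measurable_continuous_onI continuous_intros)

section \<open>Characteristic functions and densities of normal laws in the plane\<close>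

lemma char_std_normal2:
  "(\<integral>z. cis (x * fst z + y * snd z) \<partial>std_normal2) = of_real (exp (- (x^2 + y^2) / 2))"
proof -
  interpret G: prob_space std_normal_distribution by (rule prob_space_std_normal)
  interpret GG: pair_prob_space std_normal_distribution std_normal_distribution ..
  have c: "(\<integral>p. cis (t * p) \<partial>std_normal_distribution) = of_real (exp (- (t^2) / 2))" for t
    using fun_cong[OF char_std_normal_distribution, of t] by (simp add: char_def cis_conv_exp)
  have int: "integrable std_normal2 (\<lambda>(p, q). cis (x * p + y * q))"
    using prob_space_std_normal2
    unfolding case_prod_beta
    by (intro finite_measure.integrable_const_bound[where B=1] prob_space.finite_measure) auto
  have "(\<integral>z. cis (x * fst z + y * snd z) \<partial>std_normal2) =
      (\<integral>p. \<integral>q. cis (x * p + y * q) \<partial>std_normal_distribution \<partial>std_normal_distribution)"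
    using GG.integral_fst'[OF int] by (simp add: case_prod_beta')
  also have "\<dots> = (\<integral>p. cis (x * p) * of_real (exp (- (y^2) / 2)) \<partial>std_normal_distribution)"
    by (simp add: cis_mult[symmetric] c)
  also have "\<dots> = of_real (exp (- (x^2) / 2) * exp (- (y^2) / 2))" by (simp add: c)
  also have "exp (- (x^2) / 2) * exp (- (y^2) / 2) = exp (- (x^2 + y^2) / 2)"
    by (simp add: exp_add[symmetric] add_divide_distrib[symmetric])
  finally show ?thesis .
qed

text \<open>The inverse of the triangular map
  \<open>(p, q) \<mapsto> (\<alpha> * p, \<beta> * p + \<gamma> * q)\<close> is substituted into the
  product density, and \<open>\<alpha> * \<gamma>\<close> is the Jacobian determinant.\<close>

definition affine_normal_density :: "real \<Rightarrow> real \<Rightarrow> real \<Rightarrow> real \<times> real \<Rightarrow> real" where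
  "affine_normal_density \<alpha> \<beta> \<gamma> z =
     std_normal_density (fst z / \<alpha>) * std_normal_density ((snd z - \<beta> * fst z / \<alpha>) / \<gamma>) / (\<alpha> * \<gamma>)"

lemma borel_measurable_affine_normal_density [measurable]:
  "affine_normal_density \<alpha> \<beta> \<gamma> \<in> borel_measurable borel"
  unfolding affine_normal_density_def[abs_def] borel_prod[symmetric] by measurable

text \<open>Because the map is triangular, two one-dimensional affine substitutions suffice, the
  inner one for a fixed first coordinate. The result serves twice: to realise a general covariance
  matrix and, with \<open>\<beta> = 0\<close> and \<open>\<alpha> = \<gamma>\<close>, to write
  smoothing as a convolution.\<close>

lemma distr_affine_std_normal2:
  fixes \<alpha> \<beta> \<gamma> m n :: real
  assumes "0 < \<alpha>" "0 < \<gamma>"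
  shows "distr std_normal2 borel (\<lambda>z. (m + \<alpha> * fst z, n + \<beta> * fst z + \<gamma> * snd z)) =
    density lborel (\<lambda>z. ennreal (affine_normal_density \<alpha> \<beta> \<gamma> (z - (m, n))))"
    (is "distr _ _ ?T = density _ ?d")
proof (rule measure_eqI)
  interpret G: prob_space std_normal_distribution by (rule prob_space_std_normal)
  fix A :: "(real \<times> real) set" assume "A \<in> sets (distr std_normal2 borel ?T)"
  then have A': "A \<in> sets borel" by simp
  then have A[measurable]: "A \<in> sets (borel \<Otimes>\<^sub>M borel)" unfolding borel_prod by simp
  have [measurable]: "?T \<in> measurable std_normal2 borel" by (intro measurable_pair_borel_borel) measurable
  let ?\<phi> = "\<lambda>x. ennreal (std_normal_density x)"
  have D[measurable]: "affine_normal_density \<alpha> \<beta> \<gamma> \<in> borel_measurable (borel \<Otimes>\<^sub>M borel)"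
    by (simp add: borel_prod)
  have "emeasure (distr std_normal2 borel ?T) A = (\<integral>\<^sup>+z. indicator A (?T z) \<partial>std_normal2)"
    using A unfolding borel_prod
    by (subst nn_integral_indicator[symmetric], simp, subst nn_integral_distr) auto
  also have "\<dots> = (\<integral>\<^sup>+p. \<integral>\<^sup>+q. indicator A (m + \<alpha> * p, n + \<beta> * p + \<gamma> * q) \<partial>std_normal_distribution \<partial>std_normal_distribution)"
    by (subst G.nn_integral_fst[symmetric]) auto
  also have "\<dots> = (\<integral>\<^sup>+p. ?\<phi> p * (\<integral>\<^sup>+q. ?\<phi> q * indicator A (m + \<alpha> * p, n + \<beta> * p + \<gamma> * q) \<partial>lborel) \<partial>lborel)"
    by (simp add: nn_integral_density)
  also have "\<dots> = (\<integral>\<^sup>+p. \<integral>\<^sup>+q. ?\<phi> p * ?\<phi> q * indicator A (m + \<alpha> * p, n + \<beta> * p + \<gamma> * q) \<partial>lborel \<partial>lborel)"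
    by (simp add: nn_integral_cmult[symmetric] mult.assoc)
  finally have L: "emeasure (distr std_normal2 borel ?T) A = \<dots>" .
  define F where "F u v = ennreal (affine_normal_density \<alpha> \<beta> \<gamma> (u - m, v - n)) * indicator A (u, v)" for u v
  have F[measurable]: "(\<lambda>z. F (fst z) (snd z)) \<in> borel_measurable (borel \<Otimes>\<^sub>M borel)"
    unfolding F_def by measurable
  have F2[measurable]: "F u \<in> borel_measurable borel" for u unfolding F_def by measurable
  have F3: "(\<lambda>u. \<integral>\<^sup>+v. F u v \<partial>lborel) \<in> borel_measurable borel"
  proof -
    have "sets (borel \<Otimes>\<^sub>M lborel) = sets (borel \<Otimes>\<^sub>M borel :: (real \<times> real) measure)"
      by (rule sets_pair_measure_cong) auto
    then have "(\<lambda>z. F (fst z) (snd z)) \<in> borel_measurable (borel \<Otimes>\<^sub>M lborel)"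
      using F by (subst measurable_cong_sets[OF _ refl]) auto
    from lborel.borel_measurable_nn_integral_fst[OF this] show ?thesis by simp
  qed
  have F4[measurable]: "(\<lambda>z. F (m + \<alpha> * fst z) (n + \<beta> * fst z + \<gamma> * snd z)) \<in> borel_measurable (borel \<Otimes>\<^sub>M borel)"
    unfolding F_def by measurable
  have "emeasure (density lborel ?d) A = (\<integral>\<^sup>+z. F (fst z) (snd z) \<partial>lborel)"
    using A' by (subst emeasure_density) (auto simp: F_def borel_prod minus_prod_def)
  also have "\<dots> = (\<integral>\<^sup>+z. F (fst z) (snd z) \<partial>(lborel \<Otimes>\<^sub>M lborel))" by (simp add: lborel_prod)
  also have "\<dots> = (\<integral>\<^sup>+u. \<integral>\<^sup>+v. F u v \<partial>lborel \<partial>lborel)"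
    by (subst lborel.nn_integral_fst[symmetric]) auto
  also have "\<dots> = ennreal \<alpha> * (\<integral>\<^sup>+p. \<integral>\<^sup>+v. F (m + \<alpha> * p) v \<partial>lborel \<partial>lborel)"
    using assms nn_integral_real_affine[OF F3, of \<alpha> m] by simp
  also have "\<dots> = ennreal \<alpha> * (\<integral>\<^sup>+p. ennreal \<gamma> * (\<integral>\<^sup>+q. F (m + \<alpha> * p) ((n + \<beta> * p) + \<gamma> * q) \<partial>lborel) \<partial>lborel)"
  proof -
    have "(\<integral>\<^sup>+v. F (m + \<alpha> * p) v \<partial>lborel) = ennreal \<gamma> * (\<integral>\<^sup>+q. F (m + \<alpha> * p) ((n + \<beta> * p) + \<gamma> * q) \<partial>lborel)" for p
      using assms nn_integral_real_affine[OF F2, of \<gamma> "m + \<alpha> * p" "n + \<beta> * p"] by simp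
    then show ?thesis by simp
  qed
  also have "\<dots> = (\<integral>\<^sup>+p. \<integral>\<^sup>+q. ennreal \<alpha> * (ennreal \<gamma> * F (m + \<alpha> * p) ((n + \<beta> * p) + \<gamma> * q)) \<partial>lborel \<partial>lborel)"
    by (simp add: nn_integral_cmult[symmetric])
  also have "\<dots> = (\<integral>\<^sup>+p. \<integral>\<^sup>+q. ?\<phi> p * ?\<phi> q * indicator A (m + \<alpha> * p, n + \<beta> * p + \<gamma> * q) \<partial>lborel \<partial>lborel)"
  proof (intro nn_integral_cong)
    fix p q
    have "affine_normal_density \<alpha> \<beta> \<gamma> (m + \<alpha> * p - m, n + \<beta> * p + \<gamma> * q - n) = std_normal_density p * std_normal_density q / (\<alpha> * \<gamma>)"
      using assms by (simp add: affine_normal_density_def)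
    then show "ennreal \<alpha> * (ennreal \<gamma> * F (m + \<alpha> * p) ((n + \<beta> * p) + \<gamma> * q)) = ?\<phi> p * ?\<phi> q * indicator A (m + \<alpha> * p, n + \<beta> * p + \<gamma> * q)"
      using assms unfolding F_def mult.assoc[symmetric] by (simp add: ennreal_mult[symmetric])
  qed
  finally show "emeasure (distr std_normal2 borel ?T) A = emeasure (density lborel ?d) A" using L by simp
qed simp

text \<open>The coefficients are the entries of the Cholesky factor of the covariance matrix;
  \<open>b^2 < a * c\<close> makes the lower diagonal entry positive.\<close>

lemma bivariate_normal_eq_distr:
  assumes "0 < a" "b^2 < a * c"
  shows "bivariate_normal a b c =
    distr std_normal2 borel (\<lambda>z. (sqrt a * fst z, b / sqrt a * fst z + sqrt (c - b^2 / a) * snd z))"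
proof -
  define \<alpha> \<beta> \<gamma> where "\<alpha> = sqrt a" and "\<beta> = b / sqrt a" and "\<gamma> = sqrt (c - b^2 / a)"
  have g: "0 < c - b^2 / a" using assms by (simp add: field_simps)
  have pos: "0 < \<alpha>" "0 < \<gamma>" using assms g by (auto simp: \<alpha>_def \<gamma>_def)
  have sq: "\<alpha>^2 = a" "\<gamma>^2 = c - b^2 / a" "\<alpha> * \<beta> = b" using assms g by (auto simp: \<alpha>_def \<beta>_def \<gamma>_def)
  have ag: "\<alpha> * \<gamma> = sqrt (a * c - b^2)"
    using assms by (simp add: \<alpha>_def \<gamma>_def real_sqrt_mult[symmetric] right_diff_distrib)
  have "affine_normal_density \<alpha> \<beta> \<gamma> (u, v) =
      exp (- (c * u\<^sup>2 - 2 * b * u * v + a * v\<^sup>2) / (2 * (a * c - b\<^sup>2))) / (2 * pi * sqrt (a * c - b\<^sup>2))" for u v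
  proof -
    have bu: "\<beta> * u / \<alpha> = b * u / a" using assms by (simp add: \<beta>_def \<alpha>_def)
    \<comment> \<open>Completing the square in \<open>v\<close> turns the exponent of the product
      density into the given quadratic form.\<close>
    have "(u / \<alpha>)^2 + ((v - \<beta> * u / \<alpha>) / \<gamma>)^2 = u^2 / a + (v - b * u / a)^2 / (c - b^2 / a)"
      unfolding bu by (simp add: power_divide sq)
    also have "\<dots> = (c * u\<^sup>2 - 2 * b * u * v + a * v\<^sup>2) / (a * c - b\<^sup>2)"
    proof -
      have "c - b^2 / a = (a * c - b^2) / a" using assms by (simp add: field_simps)
      moreover have "a * c - b^2 \<noteq> 0" "a \<noteq> 0" using assms by auto
      moreover define e where "e = a * c - b^2"
      ultimately show ?thesis
        by (simp add: divide_simps) (simp add: e_def[symmetric] algebra_simps power2_eq_square)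
    qed
    finally have e: "(u / \<alpha>)^2 + ((v - \<beta> * u / \<alpha>) / \<gamma>)^2 = \<dots>" .
    have "affine_normal_density \<alpha> \<beta> \<gamma> (u, v) =
        (1 / sqrt (2 * pi) * (1 / sqrt (2 * pi))) * exp (- ((u / \<alpha>)^2 + ((v - \<beta> * u / \<alpha>) / \<gamma>)^2) / 2) / (\<alpha> * \<gamma>)"
      by (simp add: affine_normal_density_def std_normal_density_def exp_add[symmetric] add_divide_distrib[symmetric])
    also have "1 / sqrt (2 * pi) * (1 / sqrt (2 * pi)) = 1 / (2 * pi)" by simp
    also have "- ((u / \<alpha>)^2 + ((v - \<beta> * u / \<alpha>) / \<gamma>)^2) / 2 =
        - (c * u\<^sup>2 - 2 * b * u * v + a * v\<^sup>2) / (2 * (a * c - b\<^sup>2))"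
    proof -
      have "- (x / k) / 2 = - x / (2 * k)" for x k :: real by simp
      then show ?thesis unfolding e .
    qed
    finally show ?thesis unfolding ag by simp
  qed
  then have "bivariate_normal a b c = density lborel (\<lambda>z. ennreal (affine_normal_density \<alpha> \<beta> \<gamma> (z - (0, 0))))"
    unfolding bivariate_normal_def by (intro arg_cong[where f="density lborel"]) (auto simp: fun_eq_iff minus_prod_def)
  also have "\<dots> = distr std_normal2 borel (\<lambda>z. (0 + \<alpha> * fst z, 0 + \<beta> * fst z + \<gamma> * snd z))"
    using pos by (subst distr_affine_std_normal2) auto
  finally show ?thesis by (simp add: \<alpha>_def \<beta>_def \<gamma>_def)
qed

lemma prob_space_bivariate_normal:
  assumes "0 < a" "b^2 < a * c"
  shows "prob_space (bivariate_normal a b c)"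
  unfolding bivariate_normal_eq_distr[OF assms]
  by (intro prob_space.prob_space_distr prob_space_std_normal2 measurable_pair_borel_borel) measurable

lemma sets_bivariate_normal [simp]: "sets (bivariate_normal a b c) = sets borel"
  by (simp add: bivariate_normal_def)

lemma char_bivariate_normal:
  assumes "0 < a" "b^2 < a * c"
  shows "(\<integral>z. cis (s * fst z + t * snd z) \<partial>bivariate_normal a b c) =
    of_real (exp (- (a * s^2 + 2 * b * s * t + c * t^2) / 2))"
proof -
  define \<alpha> \<beta> \<gamma> where "\<alpha> = sqrt a" and "\<beta> = b / sqrt a" and "\<gamma> = sqrt (c - b^2 / a)"
  have g: "0 < c - b^2 / a" using assms by (simp add: field_simps)
  have sq: "\<alpha>^2 = a" "\<gamma>^2 = c - b^2 / a" "\<alpha> * \<beta> = b" "\<beta>^2 = b^2 / a"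
    using assms g by (auto simp: \<alpha>_def \<beta>_def \<gamma>_def power_divide)
  have "(\<integral>z. cis (s * fst z + t * snd z) \<partial>bivariate_normal a b c) =
     (\<integral>z. cis ((s * \<alpha> + t * \<beta>) * fst z + (t * \<gamma>) * snd z) \<partial>std_normal2)"
  proof -
    have T: "(\<lambda>z. (\<alpha> * fst z, \<beta> * fst z + \<gamma> * snd z)) \<in> measurable std_normal2 borel"
      by (intro measurable_pair_borel_borel) measurable
    have C: "(\<lambda>z::real \<times> real. cis (s * fst z + t * snd z)) \<in> borel_measurable borel"
      by (intro borel_measurable_continuous_onI continuous_intros)
    show ?thesis
      unfolding bivariate_normal_eq_distr[OF assms] \<beta>_def[symmetric] \<gamma>_def[symmetric]
      unfolding \<alpha>_def[symmetric] integral_distr[OF T C]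
      by (simp add: algebra_simps)
  qed
  also have "\<dots> = of_real (exp (- ((s * \<alpha> + t * \<beta>)^2 + (t * \<gamma>)^2) / 2))" by (rule char_std_normal2)
  also have "(s * \<alpha> + t * \<beta>)^2 + (t * \<gamma>)^2 = s^2 * \<alpha>^2 + 2 * s * t * (\<alpha> * \<beta>) + t^2 * (\<beta>^2 + \<gamma>^2)"
    by (simp add: algebra_simps power2_eq_square)
  also have "\<dots> = a * s^2 + 2 * b * s * t + c * t^2" unfolding sq by (simp add: algebra_simps)
  finally show ?thesis .
qed

text \<open>
  A Gaussian bump is a mixture of characters, so its expectation is an average of values of the
  characteristic function. Continuous functions of compact support are uniform limits of mixtures of
  bumps, so convergence of characteristic functions suffices, without tightness or uniqueness.
\<close>

definition bump :: "real \<Rightarrow> real \<times> real \<Rightarrow> real" where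
  "bump \<sigma> v = exp (- ((fst v)^2 + (snd v)^2) / (2 * \<sigma>^2))"

lemma bump_nonneg: "0 \<le> bump \<sigma> v" and bump_le_1: "bump \<sigma> v \<le> 1"
  by (auto simp: bump_def intro!: divide_nonpos_nonneg)

lemma continuous_on_bump: "continuous_on A (bump \<sigma>)"
  unfolding bump_def[abs_def] by (cases "\<sigma> = 0") (auto intro!: continuous_intros)

lemma borel_measurable_bump [measurable]: "bump \<sigma> \<in> borel_measurable borel"
  by (intro borel_measurable_continuous_onI continuous_on_bump)

text \<open>The bump at \<open>w - W \<omega>\<close> is the characteristic function of
  \<open>std_normal2\<close> at \<open>(W \<omega> - w) / \<sigma>\<close>. Fubini then leaves, for
  each Gaussian point \<open>z\<close>, the characteristic function of \<open>W\<close> at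
  \<open>z / \<sigma>\<close> times a phase that does not involve \<open>\<omega>\<close>.\<close>

lemma bump_expectation:
  assumes P: "prob_space P" and W: "W \<in> borel_measurable P" and "0 < \<sigma>"
  shows "of_real (\<integral>\<omega>. bump \<sigma> (w - W \<omega>) \<partial>P) =
    (\<integral>z. cis (- (fst w / \<sigma> * fst z + snd w / \<sigma> * snd z)) *
      (\<integral>\<omega>. cis (fst z / \<sigma> * fst (W \<omega>) + snd z / \<sigma> * snd (W \<omega>)) \<partial>P) \<partial>std_normal2)"
proof -
  interpret P: prob_space P by fact
  interpret G: prob_space std_normal2 by (rule prob_space_std_normal2)
  interpret PG: pair_prob_space P std_normal2 ..
  have [measurable]: "(\<lambda>\<omega>. fst (W \<omega>)) \<in> borel_measurable P" "(\<lambda>\<omega>. snd (W \<omega>)) \<in> borel_measurable P"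
    using measurable_compose[OF W borel_measurable_fst_snd_real(1)]
      measurable_compose[OF W borel_measurable_fst_snd_real(2)] by simp_all
  define x y where "x = (\<lambda>\<omega>. (fst (W \<omega>) - fst w) / \<sigma>)" and "y = (\<lambda>\<omega>. (snd (W \<omega>) - snd w) / \<sigma>)"
  have [measurable]: "x \<in> borel_measurable P" "y \<in> borel_measurable P" unfolding x_def y_def by measurable
  have "bump \<sigma> (w - W \<omega>) = exp (- ((x \<omega>)^2 + (y \<omega>)^2) / 2)" for \<omega>
  proof -
    have "(x \<omega>)^2 + (y \<omega>)^2 = ((fst (w - W \<omega>))^2 + (snd (w - W \<omega>))^2) / \<sigma>^2"
      by (simp add: x_def y_def power_divide add_divide_distrib[symmetric] power2_commute[of "fst w"] power2_commute[of "snd w"])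
    moreover have "- (r / k) / 2 = - r / (2 * k)" for r k :: real by simp
    ultimately show ?thesis by (simp only: bump_def)
  qed
  then have "of_real (\<integral>\<omega>. bump \<sigma> (w - W \<omega>) \<partial>P) = (\<integral>\<omega>. (\<integral>z. cis (x \<omega> * fst z + y \<omega> * snd z) \<partial>std_normal2) \<partial>P)"
    by (simp add: char_std_normal2)
  also have "\<dots> = (\<integral>z. (\<integral>\<omega>. cis (x \<omega> * fst z + y \<omega> * snd z) \<partial>P) \<partial>std_normal2)"
  proof (rule PG.Fubini_integral[symmetric])
    show "integrable (P \<Otimes>\<^sub>M std_normal2) (\<lambda>(\<omega>, z). cis (x \<omega> * fst z + y \<omega> * snd z))"
      unfolding case_prod_beta
      by (intro PG.P.integrable_const_bound[where B=1]) auto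
  qed
  also have "\<dots> = (\<integral>z. cis (- (fst w / \<sigma> * fst z + snd w / \<sigma> * snd z)) *
      (\<integral>\<omega>. cis (fst z / \<sigma> * fst (W \<omega>) + snd z / \<sigma> * snd (W \<omega>)) \<partial>P) \<partial>std_normal2)"
  proof (intro Bochner_Integration.integral_cong refl)
    fix z :: "real \<times> real"
    have "x \<omega> * fst z + y \<omega> * snd z = - (fst w / \<sigma> * fst z + snd w / \<sigma> * snd z) +
        (fst z / \<sigma> * fst (W \<omega>) + snd z / \<sigma> * snd (W \<omega>))" for \<omega>
      using assms(3) by (simp add: x_def y_def field_simps)
    then show "(\<integral>\<omega>. cis (x \<omega> * fst z + y \<omega> * snd z) \<partial>P) = cis (- (fst w / \<sigma> * fst z + snd w / \<sigma> * snd z)) *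
      (\<integral>\<omega>. cis (fst z / \<sigma> * fst (W \<omega>) + snd z / \<sigma> * snd (W \<omega>)) \<partial>P)"
      by (simp only: cis_mult[symmetric] integral_mult_right_zero)
  qed
  finally show ?thesis .
qed

text \<open>Dominated convergence under the fixed law \<open>std_normal2\<close>: by the mixture
  formula only characteristic functions occur, which are bounded by 1, and \<open>N\<close> is
  covered by the same formula with the identity as random vector.\<close>

lemma bump_expectation_converges:
  fixes W :: "nat \<Rightarrow> 'a \<Rightarrow> real \<times> real" and N :: "(real \<times> real) measure"
  assumes M: "\<And>n. prob_space (M n)" and W: "\<And>n. W n \<in> borel_measurable (M n)"
    and N: "prob_space N" "sets N = sets borel" and \<sigma>: "0 < \<sigma>"
    and char: "\<And>s t. (\<lambda>n. \<integral>\<omega>. cis (s * fst (W n \<omega>) + t * snd (W n \<omega>)) \<partial>M n)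
        \<longlonglongrightarrow> (\<integral>z. cis (s * fst z + t * snd z) \<partial>N)"
  shows "(\<lambda>n. \<integral>\<omega>. bump \<sigma> (w - W n \<omega>) \<partial>M n) \<longlonglongrightarrow> (\<integral>v. bump \<sigma> (w - v) \<partial>N)"
proof -
  interpret G: prob_space std_normal2 by (rule prob_space_std_normal2)
  have N': "(\<lambda>z. z) \<in> borel_measurable N" using N(2) by (simp add: measurable_ident_sets)
  have meas: "(\<lambda>z. \<integral>\<omega>. cis (fst z / \<sigma> * fst (V \<omega>) + snd z / \<sigma> * snd (V \<omega>)) \<partial>P) \<in> borel_measurable std_normal2"
    if P: "prob_space P" and V: "V \<in> borel_measurable P" for P :: "'c measure" and V :: "'c \<Rightarrow> real \<times> real"
  proof -
    interpret P: prob_space P by fact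
    have [measurable]: "(\<lambda>\<omega>. fst (V \<omega>)) \<in> borel_measurable P" "(\<lambda>\<omega>. snd (V \<omega>)) \<in> borel_measurable P"
      using measurable_compose[OF V borel_measurable_fst_snd_real(1)]
        measurable_compose[OF V borel_measurable_fst_snd_real(2)] by simp_all
    show ?thesis by (rule P.borel_measurable_lebesgue_integral) (simp add: case_prod_beta)
  qed
  have bound: "norm (\<integral>\<omega>. cis (X \<omega>) \<partial>P) \<le> 1" if "prob_space P" for P :: "'c measure" and X
  proof -
    interpret P: prob_space P by fact
    have "norm (\<integral>\<omega>. cis (X \<omega>) \<partial>P) \<le> (\<integral>\<omega>. norm (cis (X \<omega>)) \<partial>P)" by (rule integral_norm_bound)
    then show ?thesis by (simp add: P.prob_space)
  qed
  let ?c = "\<lambda>z. cis (- (fst w / \<sigma> * fst z + snd w / \<sigma> * snd z))"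
  have "(\<lambda>n. (of_real (\<integral>\<omega>. bump \<sigma> (w - W n \<omega>) \<partial>M n) :: complex)) \<longlonglongrightarrow> of_real (\<integral>v. bump \<sigma> (w - v) \<partial>N)"
    unfolding bump_expectation[OF M W \<sigma>] bump_expectation[OF N(1) N' \<sigma>]
  proof (rule integral_dominated_convergence[where w="\<lambda>_. 1"])
    show "AE z in std_normal2. (\<lambda>n. ?c z * (\<integral>\<omega>. cis (fst z / \<sigma> * fst (W n \<omega>) + snd z / \<sigma> * snd (W n \<omega>)) \<partial>M n))
      \<longlonglongrightarrow> ?c z * (\<integral>\<omega>. cis (fst z / \<sigma> * fst \<omega> + snd z / \<sigma> * snd \<omega>) \<partial>N)"
      by (intro AE_I2 tendsto_intros char)
    show "AE z in std_normal2. norm (?c z * (\<integral>\<omega>. cis (fst z / \<sigma> * fst (W n \<omega>) + snd z / \<sigma> * snd (W n \<omega>)) \<partial>M n)) \<le> 1" for n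
      using bound[OF M] by (intro AE_I2) (simp add: norm_mult)
    show "(\<lambda>z. ?c z * (\<integral>\<omega>. cis (fst z / \<sigma> * fst (W n \<omega>) + snd z / \<sigma> * snd (W n \<omega>)) \<partial>M n)) \<in> borel_measurable std_normal2" for n
      by (intro borel_measurable_times meas[OF M W]) measurable
    show "(\<lambda>z. ?c z * (\<integral>\<omega>. cis (fst z / \<sigma> * fst \<omega> + snd z / \<sigma> * snd \<omega>) \<partial>N)) \<in> borel_measurable std_normal2"
      by (intro borel_measurable_times meas[OF N(1) N']) measurable
  qed simp
  then show ?thesis by (simp only: tendsto_of_real_iff)
qed

section \<open>Gaussian smoothing\<close>

definition smoothing :: "real \<Rightarrow> (real \<times> real \<Rightarrow> real) \<Rightarrow> real \<times> real \<Rightarrow> real" where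
  "smoothing \<sigma> f v = (\<integral>z. f (v + \<sigma> *\<^sub>R z) \<partial>std_normal2)"

text \<open>The definition as a mean over Gaussian displacements is suited to comparing the
  smoothing with \<open>f\<close>; this form, in which \<open>v\<close> occurs only in the bump, is
  suited to taking expectations over \<open>v\<close>.\<close>

lemma smoothing_eq_convolution:
  assumes f: "f \<in> borel_measurable borel" and \<sigma>: "0 < \<sigma>"
  shows "smoothing \<sigma> f v = (\<integral>w. f w * bump \<sigma> (w - v) \<partial>lborel) / (2 * pi * \<sigma>^2)"
proof -
  let ?T = "\<lambda>z. (fst v + \<sigma> * fst z, snd v + 0 * fst z + \<sigma> * snd z)"
  have T: "?T \<in> borel_measurable std_normal2" by (intro measurable_pair_borel_borel) measurable
  have D: "affine_normal_density \<sigma> 0 \<sigma> (w - v) = bump \<sigma> (w - v) / (2 * pi * \<sigma>^2)" for w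
    using \<sigma> by (simp add: affine_normal_density_def bump_def std_normal_density_def exp_add[symmetric]
        power_divide add_divide_distrib[symmetric] power2_eq_square)
       (simp add: field_simps)
  have "smoothing \<sigma> f v = (\<integral>z. f (?T z) \<partial>std_normal2)"
    unfolding smoothing_def by (intro Bochner_Integration.integral_cong refl arg_cong[where f=f]) (simp add: prod_eq_iff)
  also have "\<dots> = (\<integral>w. f w \<partial>distr std_normal2 borel ?T)" using T f by (simp add: integral_distr)
  also have "\<dots> = (\<integral>w. f w \<partial>density lborel (\<lambda>w. ennreal (affine_normal_density \<sigma> 0 \<sigma> (w - v))))"
    using distr_affine_std_normal2[OF \<sigma> \<sigma>, of "fst v" "snd v" 0] by simp
  also have "\<dots> = (\<integral>w. affine_normal_density \<sigma> 0 \<sigma> (w - v) *\<^sub>R f w \<partial>lborel)"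
  proof (rule integral_density)
    show "(\<lambda>w. affine_normal_density \<sigma> 0 \<sigma> (w - v)) \<in> borel_measurable lborel"
      unfolding D by measurable
    show "AE w in lborel. 0 \<le> affine_normal_density \<sigma> 0 \<sigma> (w - v)"
      unfolding D by (simp add: bump_nonneg)
  qed (use f in simp)
  also have "\<dots> = (\<integral>w. f w * bump \<sigma> (w - v) / (2 * pi * \<sigma>^2) \<partial>lborel)"
    unfolding D by (simp add: mult_ac)
  finally show ?thesis by simp
qed

lemma smoothing_expectation:
  assumes f: "f \<in> borel_measurable borel" "integrable lborel f" and \<sigma>: "0 < \<sigma>"
    and P: "prob_space P" and W[measurable]: "W \<in> borel_measurable P"
  shows "(\<integral>\<omega>. smoothing \<sigma> f (W \<omega>) \<partial>P) =
    (\<integral>w. f w * (\<integral>\<omega>. bump \<sigma> (w - W \<omega>) \<partial>P) \<partial>lborel) / (2 * pi * \<sigma>^2)"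
proof -
  interpret P: prob_space P by fact
  interpret PL: pair_sigma_finite P "lborel :: (real \<times> real) measure" ..
  have fm[measurable]: "f \<in> borel_measurable borel" by fact
  have m: "(\<lambda>(\<omega>, w). f w * bump \<sigma> (w - W \<omega>)) \<in> borel_measurable (P \<Otimes>\<^sub>M lborel)"
    by measurable
  have "integrable (P \<Otimes>\<^sub>M lborel) (\<lambda>(\<omega>, w). f w * bump \<sigma> (w - W \<omega>))"
  proof (rule PL.Fubini_integrable[OF m])
    have b: "integrable lborel (\<lambda>w. f w * bump \<sigma> (w - v))" for v
      by (rule Bochner_Integration.integrable_bound[OF f(2)])
         (auto simp: abs_mult bump_nonneg bump_le_1 mult_left_le)
    then show "AE \<omega> in P. integrable lborel (\<lambda>w. case (\<omega>, w) of (\<omega>, w) \<Rightarrow> f w * bump \<sigma> (w - W \<omega>))" by simp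
    show "integrable P (\<lambda>\<omega>. \<integral>w. norm (case (\<omega>, w) of (\<omega>, w) \<Rightarrow> f w * bump \<sigma> (w - W \<omega>)) \<partial>lborel)"
    proof (rule P.integrable_const_bound[where B="\<integral>w. norm (f w) \<partial>lborel"])
      show "AE \<omega> in P. norm (\<integral>w. norm (case (\<omega>, w) of (\<omega>, w) \<Rightarrow> f w * bump \<sigma> (w - W \<omega>)) \<partial>lborel) \<le> (\<integral>w. norm (f w) \<partial>lborel)"
      proof (intro AE_I2)
        fix \<omega>
        have "(\<integral>w. norm (f w * bump \<sigma> (w - W \<omega>)) \<partial>lborel) \<le> (\<integral>w. norm (f w) \<partial>lborel)"
          using b f(2) by (intro integral_mono integrable_norm) (auto simp: abs_mult bump_nonneg bump_le_1 mult_left_le)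
        then show "norm (\<integral>w. norm (case (\<omega>, w) of (\<omega>, w) \<Rightarrow> f w * bump \<sigma> (w - W \<omega>)) \<partial>lborel) \<le> (\<integral>w. norm (f w) \<partial>lborel)"
          by (simp add: abs_of_nonneg)
      qed
    qed (rule lborel.borel_measurable_lebesgue_integral, measurable)
  qed
  from PL.Fubini_integral[OF this] show ?thesis
    unfolding smoothing_eq_convolution[OF fm \<sigma>] by simp
qed

text \<open>Both sides are integrals of \<open>f\<close> against bump expectations. These converge
  for each \<open>w\<close> and are at most 1, so the integrable function
  \<open>\<bar>f\<bar>\<close> dominates.\<close>

lemma smoothing_converges:
  fixes W :: "nat \<Rightarrow> 'a \<Rightarrow> real \<times> real" and N :: "(real \<times> real) measure"
  assumes M: "\<And>n. prob_space (M n)" and W: "\<And>n. W n \<in> borel_measurable (M n)"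
    and N: "prob_space N" "sets N = sets borel" and \<sigma>: "0 < \<sigma>"
    and char: "\<And>s t. (\<lambda>n. \<integral>\<omega>. cis (s * fst (W n \<omega>) + t * snd (W n \<omega>)) \<partial>M n)
        \<longlonglongrightarrow> (\<integral>z. cis (s * fst z + t * snd z) \<partial>N)"
    and f: "f \<in> borel_measurable borel" "integrable lborel f"
  shows "(\<lambda>n. \<integral>\<omega>. smoothing \<sigma> f (W n \<omega>) \<partial>M n) \<longlonglongrightarrow> (\<integral>v. smoothing \<sigma> f v \<partial>N)"
proof -
  have N': "(\<lambda>z. z) \<in> borel_measurable N" using N(2) by (simp add: measurable_ident_sets)
  have meas: "(\<lambda>w. f w * (\<integral>\<omega>. bump \<sigma> (w - V \<omega>) \<partial>P)) \<in> borel_measurable lborel"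
    if P: "prob_space P" and V[measurable]: "V \<in> borel_measurable P" for P :: "'c measure" and V :: "'c \<Rightarrow> real \<times> real"
  proof -
    interpret P: prob_space P by fact
    have "(\<lambda>w. \<integral>\<omega>. bump \<sigma> (w - V \<omega>) \<partial>P) \<in> borel_measurable borel"
      by (rule P.borel_measurable_lebesgue_integral) measurable
    then show ?thesis using f(1) by measurable
  qed
  have bound: "norm (\<integral>\<omega>. bump \<sigma> (X \<omega>) \<partial>P) \<le> 1" if "prob_space P" for P :: "'c measure" and X
  proof -
    interpret P: prob_space P by fact
    have "norm (\<integral>\<omega>. bump \<sigma> (X \<omega>) \<partial>P) \<le> (\<integral>\<omega>. norm (bump \<sigma> (X \<omega>)) \<partial>P)" by (rule integral_norm_bound)
    also have "\<dots> \<le> (\<integral>\<omega>. 1 \<partial>P)"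
      by (rule integral_mono') (auto simp: bump_nonneg bump_le_1)
    finally show ?thesis by (simp add: P.prob_space)
  qed
  have "(\<lambda>n. \<integral>w. f w * (\<integral>\<omega>. bump \<sigma> (w - W n \<omega>) \<partial>M n) \<partial>lborel) \<longlonglongrightarrow> (\<integral>w. f w * (\<integral>v. bump \<sigma> (w - v) \<partial>N) \<partial>lborel)"
  proof (rule integral_dominated_convergence[where w="\<lambda>w. norm (f w)"])
    show "AE w in lborel. (\<lambda>n. f w * (\<integral>\<omega>. bump \<sigma> (w - W n \<omega>) \<partial>M n)) \<longlonglongrightarrow> f w * (\<integral>v. bump \<sigma> (w - v) \<partial>N)"
      by (intro AE_I2 tendsto_intros bump_expectation_converges[OF M W N \<sigma> char])
    show "AE w in lborel. norm (f w * (\<integral>\<omega>. bump \<sigma> (w - W n \<omega>) \<partial>M n)) \<le> norm (f w)" for n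
      using bound[OF M] by (intro AE_I2) (simp add: abs_mult mult_left_le)
  qed (use meas[OF M W] meas[OF N(1) N'] f(2) in auto)
  then show ?thesis
    unfolding smoothing_expectation[OF f \<sigma> M W] smoothing_expectation[OF f \<sigma> N(1) N']
    using \<sigma> by (intro tendsto_divide tendsto_const) auto
qed

text \<open>The denominator contains \<open>B + 1\<close> rather than \<open>B\<close> so that the
  bound also works for \<open>B = 0\<close>.\<close>

lemma mult_quarter_fraction_less:
  fixes B r :: real assumes "0 \<le> B" "0 < r" shows "B * (r / (4 * (B + 1))) < r / 4"
proof -
  have "B * (r / (4 * (B + 1))) = r / 4 * (B / (B + 1))" by simp
  also have "\<dots> < r / 4 * 1" using assms by (intro mult_strict_left_mono) auto
  finally show ?thesis by simp
qed

text \<open>Displacements shorter than the modulus of continuity change \<open>f\<close> by less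
  than \<open>e / 2\<close>; longer ones change it by at most \<open>2 * B\<close> and have small
  probability for small \<open>\<sigma>\<close>, uniformly in \<open>v\<close>.\<close>

lemma smoothing_uniformly_close:
  assumes f: "continuous_on UNIV f" and B: "\<And>v. \<bar>f v\<bar> \<le> B" and uc: "uniformly_continuous_on UNIV f" and e: "0 < e"
  obtains \<sigma> where "0 < \<sigma>" "\<And>v. \<bar>smoothing \<sigma> f v - f v\<bar> \<le> e"
proof -
  interpret G: prob_space std_normal2 by (rule prob_space_std_normal2)
  have fm[measurable]: "f \<in> borel_measurable borel" using f by (rule borel_measurable_continuous_onI)
  have idm[measurable]: "(\<lambda>z. z) \<in> borel_measurable std_normal2"
    unfolding measurable_cong_sets[OF sets_std_normal2 refl] by simp
  have one: "measure std_normal2 UNIV = 1" using G.prob_space by simp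
  obtain d where d: "0 < d" "\<And>x y. dist x y < d \<Longrightarrow> \<bar>f x - f y\<bar> < e / 2"
    using uc e unfolding uniformly_continuous_on_def by (metis UNIV_I dist_commute dist_real_def half_gt_zero)
  have B0: "0 \<le> B" using B[of 0] by linarith
  \<comment> \<open>\<open>t n\<close> dominates the indicator of a displacement of length at least
    \<open>d\<close> for \<open>\<sigma> = 1 / (n + 1)\<close>. Truncation at 1 lets its mean tend
    to 0 by bounded convergence, so that no moment of the normal law has to be computed.\<close>
  define t where "t = (\<lambda>n z::real \<times> real. min 1 (norm z / (d * real (Suc n))))"
  have tm[measurable]: "t n \<in> borel_measurable std_normal2" for n unfolding t_def by measurable
  have "(\<lambda>n. \<integral>z. t n z \<partial>std_normal2) \<longlonglongrightarrow> (\<integral>z. 0 \<partial>std_normal2)"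
  proof (rule integral_dominated_convergence[where w="\<lambda>_. 1"])
    show "AE z in std_normal2. (\<lambda>n. t n z) \<longlonglongrightarrow> 0"
    proof (intro AE_I2)
      fix z :: "real \<times> real"
      have "(\<lambda>n. norm z / d * (1 / real (Suc n))) \<longlonglongrightarrow> norm z / d * 0"
        unfolding inverse_eq_divide[symmetric] by (intro tendsto_mult tendsto_const LIMSEQ_inverse_real_of_nat)
      then have "(\<lambda>n. min 1 (norm z / d * (1 / real (Suc n)))) \<longlonglongrightarrow> min 1 (norm z / d * 0)"
        by (intro tendsto_min tendsto_const)
      then show "(\<lambda>n. t n z) \<longlonglongrightarrow> 0" by (simp add: t_def)
    qed
    show "AE z in std_normal2. norm (t n z) \<le> 1" for n
      using d(1) by (intro AE_I2) (simp add: t_def)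
  qed auto
  then have "\<forall>\<^sub>F n in sequentially. (\<integral>z. t n z \<partial>std_normal2) < e / (4 * (B + 1))"
    using e B0 by (intro order_tendstoD(2)) auto
  then obtain n where n: "(\<integral>z. t n z \<partial>std_normal2) < e / (4 * (B + 1))"
    by (auto simp: eventually_sequentially)
  define \<sigma> where "\<sigma> = 1 / real (Suc n)"
  have \<sigma>: "0 < \<sigma>" by (simp add: \<sigma>_def)
  have ti: "integrable std_normal2 (t n)"
    using d(1) by (intro G.integrable_const_bound[where B=1]) (auto simp: t_def)
  show thesis
  proof (rule that[OF \<sigma>])
    fix v
    have m: "(\<lambda>z. f (v + \<sigma> *\<^sub>R z)) \<in> borel_measurable std_normal2" by measurable
    have i: "integrable std_normal2 (\<lambda>z. f (v + \<sigma> *\<^sub>R z))"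
      using B m by (intro G.integrable_const_bound[where B=B]) auto
    have pw: "\<bar>f (v + \<sigma> *\<^sub>R z) - f v\<bar> \<le> e / 2 + 2 * B * t n z" for z
    proof (cases "norm (\<sigma> *\<^sub>R z) < d")
      case True
      then have "\<bar>f (v + \<sigma> *\<^sub>R z) - f v\<bar> < e / 2" by (intro d(2)) (simp add: dist_norm)
      moreover have "0 \<le> 2 * B * t n z" using B0 d(1) by (simp add: t_def)
      ultimately show ?thesis by linarith
    next
      case False
      then have "d * real (Suc n) \<le> norm z" by (simp add: \<sigma>_def field_simps)
      moreover have "0 < d * real (Suc n)" using d(1) by simp
      ultimately have "1 \<le> norm z / (d * real (Suc n))" by (simp only: le_divide_eq_1_pos)
      then have "t n z = 1" unfolding t_def by (rule min_absorb1)
      then show ?thesis using B[of "v + \<sigma> *\<^sub>R z"] B[of v] e by simp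
    qed
    have eq: "smoothing \<sigma> f v - f v = (\<integral>z. f (v + \<sigma> *\<^sub>R z) - f v \<partial>std_normal2)"
      unfolding smoothing_def using i by (simp add: one)
    have "\<bar>\<integral>z. f (v + \<sigma> *\<^sub>R z) - f v \<partial>std_normal2\<bar> \<le> (\<integral>z. e / 2 + 2 * B * t n z \<partial>std_normal2)"
    proof (rule order_trans[OF integral_abs_bound], rule integral_mono)
      show "integrable std_normal2 (\<lambda>z. \<bar>f (v + \<sigma> *\<^sub>R z) - f v\<bar>)"
        by (intro integrable_abs Bochner_Integration.integrable_diff i G.integrable_const)
      show "integrable std_normal2 (\<lambda>z. e / 2 + 2 * B * t n z)"
        by (intro Bochner_Integration.integrable_add G.integrable_const integrable_mult_right ti)
    qed (rule pw)
    also have "\<dots> = (\<integral>z. e / 2 \<partial>std_normal2) + (\<integral>z. 2 * B * t n z \<partial>std_normal2)"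
      by (rule Bochner_Integration.integral_add) (use G.integrable_const integrable_mult_right[OF ti] in blast)+
    also have "\<dots> = e / 2 + 2 * B * (\<integral>z. t n z \<partial>std_normal2)"
      by (simp only: integral_mult_right_zero) (simp add: one)
    also have "\<dots> \<le> e / 2 + 2 * B * (e / (4 * (B + 1)))"
      using n B0 by (intro add_left_mono mult_left_mono) auto
    also have "\<dots> \<le> e" using mult_quarter_fraction_less[OF B0 e] by linarith
    finally show "\<bar>smoothing \<sigma> f v - f v\<bar> \<le> e" unfolding eq .
  qed
qed

section \<open>Cutoff functions and the continuity theorem for characteristic functions\<close>

definition cutoff :: "real \<Rightarrow> real \<times> real \<Rightarrow> real" where
  "cutoff R v = max 0 (min 1 (R + 1 - norm v))"

lemma cutoff_range: "0 \<le> cutoff R v" "cutoff R v \<le> 1"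
  by (auto simp: cutoff_def)

lemma cutoff_outside: "R + 1 \<le> norm v \<Longrightarrow> cutoff R v = 0"
  by (simp add: cutoff_def)

lemma continuous_on_cutoff: "continuous_on A (cutoff R)"
  unfolding cutoff_def[abs_def] by (intro continuous_intros)

text \<open>On the ball of radius \<open>R + 1\<close> compactness applies. If one of two points at
  distance less than 1 lies outside this ball, both have norm at least \<open>R\<close>, where
  \<open>f\<close> vanishes.\<close>

lemma uniformly_continuous_compact_support:
  fixes f :: "real \<times> real \<Rightarrow> real"
  assumes f: "continuous_on UNIV f" and out: "\<And>v. R \<le> norm v \<Longrightarrow> f v = 0"
  shows "uniformly_continuous_on UNIV f"
  unfolding uniformly_continuous_on_def
proof (intro allI impI)
  fix e :: real assume e: "0 < e"
  have "uniformly_continuous_on (cball 0 (R + 1)) f"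
    using f by (intro compact_uniformly_continuous) (auto intro: continuous_on_subset)
  then obtain d where d: "0 < d" "\<And>x y. x \<in> cball 0 (R + 1) \<Longrightarrow> y \<in> cball 0 (R + 1) \<Longrightarrow> dist y x < d \<Longrightarrow> dist (f y) (f x) < e"
    using e unfolding uniformly_continuous_on_def by metis
  have "dist (f y) (f x) < e" if xy: "dist y x < min d 1" for x y
  proof (cases "norm x \<le> R + 1 \<and> norm y \<le> R + 1")
    case True
    then show ?thesis using d(2)[of x y] xy by simp
  next
    case False
    moreover have "\<bar>norm y - norm x\<bar> < 1" using norm_triangle_ineq3[of y x] xy by (simp add: dist_norm)
    ultimately have "R \<le> norm x" "R \<le> norm y" by linarith+
    then show ?thesis using out e by simp
  qed
  then show "\<exists>d>0. \<forall>x\<in>UNIV. \<forall>x'\<in>UNIV. dist x' x < d \<longrightarrow> dist (f x') (f x) < e"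
    using d(1) by (intro exI[of _ "min d 1"]) auto
qed

text \<open>A bounded \<open>f\<close> is replaced by its product with a cutoff \<open>ct\<close>.
  The error is at most \<open>B * (1 - E ct)\<close>, and since \<open>ct\<close> itself has compact
  support, the case of compact support shows that this bound converges to its value under
  \<open>N\<close>. That is how loss of mass at infinity is excluded.\<close>

theorem converges_in_distribution_if_char_converges:
  fixes W :: "nat \<Rightarrow> 'a \<Rightarrow> real \<times> real" and N :: "(real \<times> real) measure"
  assumes M: "\<And>n. prob_space (M n)" and W[measurable]: "\<And>n. W n \<in> borel_measurable (M n)"
    and N: "prob_space N" "sets N = sets borel"
    and char: "\<And>s t. (\<lambda>n. \<integral>\<omega>. cis (s * fst (W n \<omega>) + t * snd (W n \<omega>)) \<partial>M n)
        \<longlonglongrightarrow> (\<integral>z. cis (s * fst z + t * snd z) \<partial>N)"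
  shows "converges_in_distribution M W N"
  unfolding converges_in_distribution_def
proof (intro allI impI)
  interpret N: prob_space N by fact
  have N'[measurable]: "(\<lambda>z. z) \<in> borel_measurable N" using N(2) by (simp add: measurable_ident_sets)
  have Nm: "g \<in> borel_measurable N" if "g \<in> borel_measurable borel" for g :: "real \<times> real \<Rightarrow> real"
    using that N(2) by (simp cong: measurable_cong_sets)
  have int: "integrable P (\<lambda>\<omega>. g (V \<omega>))"
    if "prob_space P" "V \<in> borel_measurable P" "g \<in> borel_measurable borel" "\<And>v. \<bar>g v\<bar> \<le> B"
    for P :: "'c measure" and V :: "'c \<Rightarrow> real \<times> real" and g :: "real \<times> real \<Rightarrow> real" and B
  proof -
    interpret P: prob_space P by fact
    show ?thesis using that(2-4) by (intro P.integrable_const_bound[where B=B]) auto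
  qed
  have diff: "\<bar>(\<integral>\<omega>. g (V \<omega>) \<partial>P) - (\<integral>\<omega>. g' (V \<omega>) \<partial>P)\<bar> \<le> e"
    if P: "prob_space P" and V: "V \<in> borel_measurable P"
      and g: "g \<in> borel_measurable borel" "\<And>v. \<bar>g v\<bar> \<le> B" and g': "g' \<in> borel_measurable borel" "\<And>v. \<bar>g' v\<bar> \<le> B'"
      and close: "\<And>v. \<bar>g v - g' v\<bar> \<le> e"
    for P :: "'c measure" and V :: "'c \<Rightarrow> real \<times> real" and g g' :: "real \<times> real \<Rightarrow> real" and B B' e
  proof -
    interpret P: prob_space P by fact
    have i: "integrable P (\<lambda>\<omega>. g (V \<omega>))" "integrable P (\<lambda>\<omega>. g' (V \<omega>))"
      using int[OF P V g] int[OF P V g'] by auto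
    have "\<bar>(\<integral>\<omega>. g (V \<omega>) \<partial>P) - (\<integral>\<omega>. g' (V \<omega>) \<partial>P)\<bar> = \<bar>\<integral>\<omega>. g (V \<omega>) - g' (V \<omega>) \<partial>P\<bar>"
      using i by simp
    also have "\<dots> \<le> (\<integral>\<omega>. e \<partial>P)"
      by (rule order_trans[OF integral_abs_bound], rule integral_mono) (use i close in auto)
    finally show ?thesis by (simp add: P.prob_space)
  qed
  have compact: "(\<lambda>n. \<integral>\<omega>. g (W n \<omega>) \<partial>M n) \<longlonglongrightarrow> (\<integral>z. g z \<partial>N)"
    if g: "continuous_on UNIV g" "\<And>v. \<bar>g v\<bar> \<le> B" "\<And>v. R \<le> norm v \<Longrightarrow> g v = 0"
    for g :: "real \<times> real \<Rightarrow> real" and B R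
  proof (rule LIMSEQ_I)
    fix r :: real assume r: "0 < r"
    have gm[measurable]: "g \<in> borel_measurable borel" using g(1) by (rule borel_measurable_continuous_onI)
    have "integrable lborel (\<lambda>x. indicator (cball 0 R) x *\<^sub>R g x)"
      using g(1) by (intro borel_integrable_compact) (auto intro: continuous_on_subset)
    moreover have "(\<lambda>x. indicator (cball 0 R) x *\<^sub>R g x) = g"
      using g(3) by (auto simp: fun_eq_iff indicator_def)
    ultimately have gi: "integrable lborel g" by simp
    obtain \<sigma> where \<sigma>: "0 < \<sigma>" "\<And>v. \<bar>smoothing \<sigma> g v - g v\<bar> \<le> r / 4"
      using smoothing_uniformly_close[where e="r / 4", OF g(1,2) uniformly_continuous_compact_support[OF g(1,3)]] r
      by (metis divide_pos_pos zero_less_numeral)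
    have sm: "smoothing \<sigma> g \<in> borel_measurable borel"
      unfolding smoothing_eq_convolution[OF gm \<sigma>(1), abs_def]
      by (intro borel_measurable_divide lborel.borel_measurable_lebesgue_integral borel_measurable_const) measurable
    have sb: "\<bar>smoothing \<sigma> g v\<bar> \<le> B + r / 4" for v using \<sigma>(2)[of v] g(2)[of v] by linarith
    have r4: "0 < r / 4" using r by simp
    have "(\<lambda>n. \<integral>\<omega>. smoothing \<sigma> g (W n \<omega>) \<partial>M n) \<longlonglongrightarrow> (\<integral>v. smoothing \<sigma> g v \<partial>N)"
      by (rule smoothing_converges[OF M W N \<sigma>(1) char gm gi])
    from LIMSEQ_D[OF this r4] obtain n0 where
      n0: "\<And>n. n0 \<le> n \<Longrightarrow> \<bar>(\<integral>\<omega>. smoothing \<sigma> g (W n \<omega>) \<partial>M n) - (\<integral>v. smoothing \<sigma> g v \<partial>N)\<bar> < r / 4"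
      unfolding real_norm_def by blast
    have "\<bar>(\<integral>\<omega>. g (W n \<omega>) \<partial>M n) - (\<integral>z. g z \<partial>N)\<bar> < r" if "n0 \<le> n" for n
      using n0[OF that] diff[OF M W sm sb gm g(2) \<sigma>(2), of n] diff[OF N(1) N' sm sb gm g(2) \<sigma>(2)] r by linarith
    then show "\<exists>no. \<forall>n\<ge>no. norm ((\<integral>\<omega>. g (W n \<omega>) \<partial>M n) - (\<integral>z. g z \<partial>N)) < r" by auto
  qed
  fix f :: "real \<times> real \<Rightarrow> real" assume f: "continuous_on UNIV f" and bf: "bounded (range f)"
  obtain B where B: "\<And>v. \<bar>f v\<bar> \<le> B" using bf by (auto simp: bounded_iff)
  have B0: "0 \<le> B" using B[of 0] by linarith
  have fm: "f \<in> borel_measurable borel" using f by (rule borel_measurable_continuous_onI)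
  have cm: "cutoff R \<in> borel_measurable borel" for R by (rule borel_measurable_continuous_onI[OF continuous_on_cutoff])
  have cb: "\<bar>cutoff R v\<bar> \<le> 1" for R v using cutoff_range[of R v] by simp
  show "(\<lambda>n. \<integral>\<omega>. f (W n \<omega>) \<partial>M n) \<longlonglongrightarrow> (\<integral>z. f z \<partial>N)"
  proof (rule LIMSEQ_I)
    fix r :: real assume r: "0 < r"
    have "(\<lambda>k. \<integral>z. cutoff (real k) z \<partial>N) \<longlonglongrightarrow> (\<integral>z. 1 \<partial>N)"
    proof (rule integral_dominated_convergence[where w="\<lambda>_. 1"])
      show "AE z in N. (\<lambda>k. cutoff (real k) z) \<longlonglongrightarrow> 1"
      proof (intro AE_I2 tendsto_eventually)
        fix z
        show "\<forall>\<^sub>F k in sequentially. cutoff (real k) z = 1"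
          using eventually_ge_at_top[of "nat \<lceil>norm z\<rceil>"]
          by eventually_elim (simp add: cutoff_def nat_le_iff, linarith)
      qed
    qed (use Nm[OF cm] cb in auto)
    then have "(\<lambda>k. \<integral>z. cutoff (real k) z \<partial>N) \<longlonglongrightarrow> 1" by (simp add: N.prob_space)
    then have "\<forall>\<^sub>F k in sequentially. 1 - r / (4 * (B + 1)) < (\<integral>z. cutoff (real k) z \<partial>N)"
      using r B0 by (intro order_tendstoD(1)) auto
    then obtain k where k: "1 - r / (4 * (B + 1)) < (\<integral>z. cutoff (real k) z \<partial>N)"
      by (auto simp: eventually_sequentially)
    define ct where "ct = cutoff (real k)"
    have ctm: "ct \<in> borel_measurable borel" and ctb: "\<And>v. \<bar>ct v\<bar> \<le> 1" using cm cb by (auto simp: ct_def)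
    have ct: "continuous_on UNIV ct" "\<And>v. 0 \<le> ct v" "\<And>v. ct v \<le> 1" "\<And>v. real k + 1 \<le> norm v \<Longrightarrow> ct v = 0"
      using continuous_on_cutoff cutoff_range cutoff_outside by (auto simp: ct_def)
    have fct: "(\<lambda>v. f v * ct v) \<in> borel_measurable borel" "\<And>v. \<bar>f v * ct v\<bar> \<le> B"
    proof -
      show "(\<lambda>v. f v * ct v) \<in> borel_measurable borel" using fm ctm by measurable
      show "\<bar>f v * ct v\<bar> \<le> B" for v
        using mult_mono[OF B[of v] ctb[of v] B0] by (simp add: abs_mult)
    qed
    have tail: "\<bar>(\<integral>\<omega>. f (V \<omega>) \<partial>P) - (\<integral>\<omega>. f (V \<omega>) * ct (V \<omega>) \<partial>P)\<bar> \<le> B * (1 - (\<integral>\<omega>. ct (V \<omega>) \<partial>P))"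
      if P: "prob_space P" and V: "V \<in> borel_measurable P" for P :: "'c measure" and V :: "'c \<Rightarrow> real \<times> real"
    proof -
      interpret P: prob_space P by fact
      have i: "integrable P (\<lambda>\<omega>. f (V \<omega>))" "integrable P (\<lambda>\<omega>. f (V \<omega>) * ct (V \<omega>))" "integrable P (\<lambda>\<omega>. ct (V \<omega>))"
        using int[OF P V fm B] int[OF P V fct] int[OF P V ctm ctb] by auto
      have "\<bar>(\<integral>\<omega>. f (V \<omega>) \<partial>P) - (\<integral>\<omega>. f (V \<omega>) * ct (V \<omega>) \<partial>P)\<bar> = \<bar>\<integral>\<omega>. f (V \<omega>) - f (V \<omega>) * ct (V \<omega>) \<partial>P\<bar>"
        using i by simp
      also have "\<dots> \<le> (\<integral>\<omega>. B * (1 - ct (V \<omega>)) \<partial>P)"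
      proof (rule order_trans[OF integral_abs_bound], rule integral_mono)
        show "\<bar>f (V \<omega>) - f (V \<omega>) * ct (V \<omega>)\<bar> \<le> B * (1 - ct (V \<omega>))" for \<omega>
        proof -
          have "f (V \<omega>) - f (V \<omega>) * ct (V \<omega>) = f (V \<omega>) * (1 - ct (V \<omega>))" by (simp add: algebra_simps)
          then show ?thesis using mult_right_mono[OF B[of "V \<omega>"], of "1 - ct (V \<omega>)"] ct(3)[of "V \<omega>"]
            by (simp add: abs_mult)
        qed
      qed (use i in auto)
      also have "\<dots> = B * (1 - (\<integral>\<omega>. ct (V \<omega>) \<partial>P))" using i by (simp add: P.prob_space)
      finally show ?thesis .
    qed
    have l1: "(\<lambda>n. \<integral>\<omega>. f (W n \<omega>) * ct (W n \<omega>) \<partial>M n) \<longlonglongrightarrow> (\<integral>z. f z * ct z \<partial>N)"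
      by (rule compact[of "\<lambda>v. f v * ct v" B "real k + 1"])
         (use f ct fct(2) in \<open>auto intro!: continuous_intros\<close>)
    have l2: "(\<lambda>n. \<integral>\<omega>. ct (W n \<omega>) \<partial>M n) \<longlonglongrightarrow> (\<integral>z. ct z \<partial>N)"
      by (rule compact[of ct 1 "real k + 1"]) (use ct ctb in auto)
    have Bk: "B * (1 - (\<integral>z. ct z \<partial>N)) < r / 4"
    proof -
      have "B * (1 - (\<integral>z. ct z \<partial>N)) \<le> B * (r / (4 * (B + 1)))" using k B0 by (intro mult_left_mono) (auto simp: ct_def)
      also have "\<dots> < r / 4" by (rule mult_quarter_fraction_less[OF B0 r])
      finally show ?thesis .
    qed
    have "(\<lambda>n. \<bar>(\<integral>\<omega>. f (W n \<omega>) * ct (W n \<omega>) \<partial>M n) - (\<integral>z. f z * ct z \<partial>N)\<bar> + B * (1 - (\<integral>\<omega>. ct (W n \<omega>) \<partial>M n)))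
        \<longlonglongrightarrow> \<bar>(\<integral>z. f z * ct z \<partial>N) - (\<integral>z. f z * ct z \<partial>N)\<bar> + B * (1 - (\<integral>z. ct z \<partial>N))"
      by (intro tendsto_intros l1 l2)
    then have "\<forall>\<^sub>F n in sequentially. \<bar>(\<integral>\<omega>. f (W n \<omega>) * ct (W n \<omega>) \<partial>M n) - (\<integral>z. f z * ct z \<partial>N)\<bar> + B * (1 - (\<integral>\<omega>. ct (W n \<omega>) \<partial>M n)) < r / 4"
      using Bk by (intro order_tendstoD(2)) auto
    then have "\<forall>\<^sub>F n in sequentially. norm ((\<integral>\<omega>. f (W n \<omega>) \<partial>M n) - (\<integral>z. f z \<partial>N)) < r"
    proof eventually_elim
      case (elim n)
      then show ?case
        unfolding real_norm_def using tail[OF M W, of n] tail[OF N(1) N'] Bk r by linarith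
    qed
    then show "\<exists>no. \<forall>n\<ge>no. norm ((\<integral>\<omega>. f (W n \<omega>) \<partial>M n) - (\<integral>z. f z \<partial>N)) < r"
      by (simp add: eventually_sequentially)
  qed
qed

section \<open>Additive functionals of finite Markov chains\<close>

text \<open>A step draws \<open>d\<close> with probability \<open>w z d\<close> and then moves
  deterministically to \<open>nxt z d\<close>, so an increment may depend on the draw as well as on
  the state. The last assumptions form a Doeblin condition for two steps: from every state, drawing
  \<open>d0\<close> twice leads to \<open>z0\<close> with probability at least
  \<open>\<delta>^2\<close>.\<close>

locale finite_chain =
  fixes Z :: "'z set" and D :: "'d set" and w :: "'z \<Rightarrow> 'd \<Rightarrow> real" and nxt :: "'z \<Rightarrow> 'd \<Rightarrow> 'z"
    and d0 :: 'd and z0 :: 'z and \<delta> :: real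
  assumes finite_Z: "finite Z" and finite_D: "finite D"
    and w_nonneg: "\<And>z d. z \<in> Z \<Longrightarrow> d \<in> D \<Longrightarrow> 0 \<le> w z d"
    and w_sum: "\<And>z. z \<in> Z \<Longrightarrow> (\<Sum>d\<in>D. w z d) = 1"
    and nxt_closed: "\<And>z d. z \<in> Z \<Longrightarrow> d \<in> D \<Longrightarrow> w z d \<noteq> 0 \<Longrightarrow> nxt z d \<in> Z"
    and d0: "d0 \<in> D" and z0: "z0 \<in> Z" and \<delta>_pos: "0 < \<delta>"
    and \<delta>_le: "\<And>z. z \<in> Z \<Longrightarrow> \<delta> \<le> w z d0"
    and reset: "\<And>z. z \<in> Z \<Longrightarrow> nxt (nxt z d0) d0 = z0"
begin

section \<open>Contraction of oscillations and geometric convergence\<close>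

definition K :: "('z \<Rightarrow> real) \<Rightarrow> 'z \<Rightarrow> real" where
  "K f z = (\<Sum>d\<in>D. w z d * f (nxt z d))"

lemma average_le:
  assumes "z \<in> Z" "\<And>d. d \<in> D \<Longrightarrow> w z d \<noteq> 0 \<Longrightarrow> F d \<le> B"
  shows "(\<Sum>d\<in>D. w z d * F d) \<le> B"
proof -
  have "(\<Sum>d\<in>D. w z d * F d) \<le> (\<Sum>d\<in>D. w z d * B)"
    using assms w_nonneg by (intro sum_mono) (metis mult_left_mono mult_zero_left order_refl)
  also have "\<dots> = B" using w_sum[OF assms(1)] by (simp add: sum_distrib_right[symmetric])
  finally show ?thesis .
qed

lemma norm_average_le:
  fixes F :: "'d \<Rightarrow> 'b::real_normed_vector"
  assumes "z \<in> Z" "\<And>d. d \<in> D \<Longrightarrow> w z d \<noteq> 0 \<Longrightarrow> norm (F d) \<le> B"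
  shows "norm (\<Sum>d\<in>D. w z d *\<^sub>R F d) \<le> B"
proof -
  have "norm (\<Sum>d\<in>D. w z d *\<^sub>R F d) \<le> (\<Sum>d\<in>D. w z d * norm (F d))"
    using w_nonneg[OF assms(1)] by (intro order_trans[OF norm_sum] sum_mono) simp
  also have "\<dots> \<le> B" using assms by (rule average_le)
  finally show ?thesis .
qed

lemma abs_average_le:
  assumes "z \<in> Z" "\<And>d. d \<in> D \<Longrightarrow> w z d \<noteq> 0 \<Longrightarrow> \<bar>F d\<bar> \<le> B"
  shows "\<bar>\<Sum>d\<in>D. w z d * F d\<bar> \<le> B"
  using norm_average_le[of z F B] assms by simp

text \<open>Written as an average, \<open>hi - K f z\<close> has nonnegative terms only, so it is
  bounded below by the single term of \<open>d0\<close>.\<close>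

lemma K_bound_reset:
  assumes "z \<in> Z" "\<And>z. z \<in> Z \<Longrightarrow> f z \<le> hi"
  shows "K f z \<le> \<delta> * f (nxt z d0) + (1 - \<delta>) * hi"
proof -
  have nn: "0 \<le> w z d * (hi - f (nxt z d))" if "d \<in> D" for d
    using w_nonneg[OF assms(1) that] nxt_closed[OF assms(1) that] assms(2)
    by (cases "w z d = 0") auto
  have n0: "nxt z d0 \<in> Z" using nxt_closed[OF assms(1) d0] \<delta>_le[OF assms(1)] \<delta>_pos by auto
  have "\<delta> * (hi - f (nxt z d0)) \<le> w z d0 * (hi - f (nxt z d0))"
    using \<delta>_le[OF assms(1)] assms(2)[OF n0] by (intro mult_right_mono) auto
  also have "\<dots> \<le> (\<Sum>d\<in>D. w z d * (hi - f (nxt z d)))"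
    using nn by (intro member_le_sum[OF d0 _ finite_D]) simp
  also have "\<dots> = hi - K f z"
    using w_sum[OF assms(1)] by (simp add: K_def right_diff_distrib sum_subtractf sum_distrib_right[symmetric])
  finally show ?thesis by (simp add: algebra_simps)
qed

lemma \<delta>_le_1: "\<delta> \<le> 1"
proof -
  have "w z0 d0 \<le> (\<Sum>d\<in>D. w z0 d)"
    by (rule member_le_sum[OF d0 w_nonneg[OF z0] finite_D]) simp
  with \<delta>_le[OF z0] w_sum[OF z0] show ?thesis by simp
qed

lemma K_K_bound_reset:
  assumes "z \<in> Z" "\<And>z. z \<in> Z \<Longrightarrow> f z \<le> hi"
  shows "K (K f) z \<le> \<delta>^2 * f z0 + (1 - \<delta>^2) * hi"
proof -
  have Kle: "K f y \<le> hi" if "y \<in> Z" for y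
    unfolding K_def using that nxt_closed assms(2) by (intro average_le) auto
  have n0: "nxt z d0 \<in> Z" using nxt_closed[OF assms(1) d0] \<delta>_le[OF assms(1)] \<delta>_pos by auto
  have "K (K f) z \<le> \<delta> * K f (nxt z d0) + (1 - \<delta>) * hi"
    by (rule K_bound_reset[OF assms(1) Kle])
  also have "\<dots> \<le> \<delta> * (\<delta> * f (nxt (nxt z d0) d0) + (1 - \<delta>) * hi) + (1 - \<delta>) * hi"
    using K_bound_reset[OF n0 assms(2)] \<delta>_pos by simp
  also have "\<dots> = \<delta>^2 * f z0 + (1 - \<delta>^2) * hi"
    using reset[OF assms(1)] by (simp add: algebra_simps power2_eq_square)
  finally show ?thesis .
qed

lemma K_uminus: "K (\<lambda>z. - f z) = (\<lambda>z. - K f z)"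
  by (simp add: K_def sum_negf fun_eq_iff)

text \<open>Two steps pull both the largest and the smallest value towards the same number
  \<open>f z0\<close> with weight \<open>\<delta>^2\<close>. Applying the upper bound to
  \<open>f\<close> and to \<open>- f\<close>, this number cancels.\<close>

lemma K_K_contraction:
  assumes osc: "\<And>z z'. z \<in> Z \<Longrightarrow> z' \<in> Z \<Longrightarrow> f z - f z' \<le> B" and "z \<in> Z" "z' \<in> Z"
  shows "K (K f) z - K (K f) z' \<le> (1 - \<delta>^2) * B"
proof -
  define hi lo where "hi = Max (f ` Z)" and "lo = Min (f ` Z)"
  have ne: "f ` Z \<noteq> {}" "finite (f ` Z)" using z0 finite_Z by auto
  obtain z1 where z1: "z1 \<in> Z" "hi = f z1" using Max_in[OF ne(2,1)] by (auto simp: hi_def)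
  obtain z2 where z2: "z2 \<in> Z" "lo = f z2" using Min_in[OF ne(2,1)] by (auto simp: lo_def)
  have "K (K f) z \<le> \<delta>^2 * f z0 + (1 - \<delta>^2) * hi"
    using ne assms(2) by (intro K_K_bound_reset) (auto simp: hi_def)
  moreover have "K (K (\<lambda>z. - f z)) z' \<le> \<delta>^2 * (- f z0) + (1 - \<delta>^2) * (- lo)"
    using ne assms(3) by (intro K_K_bound_reset) (auto simp: lo_def)
  ultimately have "K (K f) z - K (K f) z' \<le> (1 - \<delta>^2) * (hi - lo)"
    by (simp add: K_uminus algebra_simps)
  also have "\<dots> \<le> (1 - \<delta>^2) * B"
    using osc[OF z1(1) z2(1)] z1 z2 \<delta>_le_1 \<delta>_pos
    by (intro mult_left_mono) (auto simp: power_le_one)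
  finally show ?thesis .
qed

lemma abs_K_diff_le:
  assumes "z \<in> Z" "\<And>z. z \<in> Z \<Longrightarrow> \<bar>f z - g z\<bar> \<le> B"
  shows "\<bar>K f z - K g z\<bar> \<le> B"
proof -
  have "K f z - K g z = (\<Sum>d\<in>D. w z d * (f (nxt z d) - g (nxt z d)))"
    by (simp add: K_def sum_subtractf right_diff_distrib)
  then show ?thesis using assms nxt_closed by (auto intro!: abs_average_le)
qed

lemma geometric_telescope:
  fixes v :: "nat \<Rightarrow> real"
  assumes "0 < \<kappa>" "\<kappa> < 1" "\<And>m. \<bar>v (Suc m) - v m\<bar> \<le> G * \<kappa> ^ m"
  obtains c where "\<And>m. \<bar>v m - c\<bar> \<le> G / (1 - \<kappa>) * \<kappa> ^ m"
proof -
  have "summable (\<lambda>m. G * \<kappa> ^ m)"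
    using assms(1,2) by (intro summable_mult summable_geometric) simp
  then have "summable (\<lambda>m. v (Suc m) - v m)"
    by (rule summable_comparison_test'[where N=0]) (use assms(3) in simp)
  then have "convergent (\<lambda>n. (\<Sum>m<n. v (Suc m) - v m))"
    by (simp add: summable_iff_convergent)
  then obtain l where "(\<lambda>n. v n - v 0) \<longlonglongrightarrow> l"
    by (auto simp: convergent_def sum_lessThan_telescope)
  then have lim: "v \<longlonglongrightarrow> l + v 0"
    using tendsto_add[of "\<lambda>n. v n - v 0" l sequentially "\<lambda>_. v 0" "v 0"] by simp
  have G: "0 \<le> G" using assms(3)[of 0] by simp
  have bound: "\<bar>v (m + n) - v m\<bar> \<le> G / (1 - \<kappa>) * (\<kappa> ^ m - \<kappa> ^ (m + n))" for m n
  proof (induction n)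
    case (Suc n)
    have "\<bar>v (m + Suc n) - v m\<bar> \<le> G / (1 - \<kappa>) * (\<kappa> ^ m - \<kappa> ^ (m + n)) + G * \<kappa> ^ (m + n)"
      using Suc assms(3)[of "m + n"] by simp
    also have "\<dots> = G / (1 - \<kappa>) * (\<kappa> ^ m - \<kappa> ^ (m + Suc n))"
      using assms(2) by (simp add: field_simps)
    finally show ?case .
  qed simp
  show thesis
  proof
    fix m
    have "(\<lambda>n. \<bar>v (n + m) - v m\<bar>) \<longlonglongrightarrow> \<bar>(l + v 0) - v m\<bar>"
      by (intro tendsto_intros LIMSEQ_ignore_initial_segment lim)
    moreover have "\<bar>v (n + m) - v m\<bar> \<le> G / (1 - \<kappa>) * \<kappa> ^ m" for n
    proof -
      have "\<bar>v (n + m) - v m\<bar> \<le> G / (1 - \<kappa>) * (\<kappa> ^ m - \<kappa> ^ (m + n))"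
        using bound[of m n] by (simp add: add.commute)
      also have "\<dots> \<le> G / (1 - \<kappa>) * \<kappa> ^ m"
        using G assms by (intro mult_left_mono) auto
      finally show ?thesis .
    qed
    ultimately have "\<bar>(l + v 0) - v m\<bar> \<le> G / (1 - \<kappa>) * \<kappa> ^ m"
      by (intro LIMSEQ_le_const2) auto
    then show "\<bar>v m - (l + v 0)\<bar> \<le> G / (1 - \<kappa>) * \<kappa> ^ m" by (simp add: abs_minus_commute)
  qed
qed

lemma bounded_on_Z:
  fixes f :: "'z \<Rightarrow> real"
  obtains B where "0 \<le> B" "\<And>z. z \<in> Z \<Longrightarrow> \<bar>f z\<bar> \<le> B"
proof
  show "0 \<le> (\<Sum>z\<in>Z. \<bar>f z\<bar>)" by (simp add: sum_nonneg)
  show "\<bar>f z\<bar> \<le> (\<Sum>z\<in>Z. \<bar>f z\<bar>)" if "z \<in> Z" for z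
    using that finite_Z by (intro member_le_sum) auto
qed

text \<open>The contraction is stable under exponentially small perturbations: the oscillation of
  \<open>u m\<close> over \<open>Z\<close> decays geometrically, and so do the increments at
  \<open>z0\<close>, because \<open>K\<close> moves a value by at most the oscillation. The new rate
  has to exceed both the rate \<open>\<kappa>\<close> of the errors and \<open>sqrt \<rho>\<close>,
  the contraction rate per single step.\<close>

lemma geometric_limit:
  assumes "0 \<le> \<kappa>" "\<kappa> < 1" and err: "\<And>m z. z \<in> Z \<Longrightarrow> \<bar>u (Suc m) z - K (u m) z\<bar> \<le> C * \<kappa> ^ m"
  obtains c C' \<kappa>' where "0 < \<kappa>'" "\<kappa>' < 1" "\<And>m z. z \<in> Z \<Longrightarrow> \<bar>u m z - c\<bar> \<le> C' * \<kappa>' ^ m"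
proof -
  define \<rho> where "\<rho> = 1 - \<delta>^2"
  have \<rho>: "0 \<le> \<rho>" "\<rho> < 1" using \<delta>_pos \<delta>_le_1 by (auto simp: \<rho>_def power_le_one)
  define s where "s = max \<kappa> (sqrt \<rho>)"
  \<comment> \<open>The midpoint of \<open>s\<close> and 1 makes \<open>\<rho> < k^2\<close> strict;
    the gap \<open>k^2 - \<rho>\<close> absorbs the errors of two steps.\<close>
  define k where "k = (1 + s) / 2"
  have s: "0 \<le> s" "s < 1" using assms \<rho> by (auto simp: s_def real_sqrt_lt_1_iff)
  have k: "0 < k" "k < 1" "\<kappa> \<le> k" using s by (auto simp: k_def s_def)
  have "sqrt \<rho> \<le> s" by (simp add: s_def)
  moreover have "s < k" using s by (simp add: k_def)
  ultimately have "sqrt \<rho> < k" by simp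
  then have k2: "\<rho> < k^2" using real_sqrt_less_iff[of \<rho> "k^2"] k by simp
  have C: "0 \<le> C" using err[OF z0, of 0] by simp
  have err': "\<bar>u (Suc m) z - K (u m) z\<bar> \<le> C * k ^ m" if "z \<in> Z" for m z
  proof -
    have "C * \<kappa> ^ m \<le> C * k ^ m" using C k assms(1) by (intro mult_left_mono power_mono) auto
    then show ?thesis using err[OF that, of m] by linarith
  qed
  obtain B0 where B0: "\<And>z. z \<in> Z \<Longrightarrow> \<bar>u 0 z\<bar> \<le> B0" using bounded_on_Z[of "u 0"] by metis
  obtain B1 where B1: "\<And>z. z \<in> Z \<Longrightarrow> \<bar>u 1 z\<bar> \<le> B1" using bounded_on_Z[of "u 1"] by metis
  \<comment> \<open>The three entries are what the cases 0, 1 and \<open>m + 2\<close> of the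
    induction require; the last one says \<open>\<rho> * A + 4 * C \<le> A * k^2\<close>.\<close>
  define A where "A = max (2 * B0) (max (2 * B1 / k) (4 * C / (k^2 - \<rho>)))"
  have A: "2 * B0 \<le> A" "2 * B1 \<le> A * k" "4 * C \<le> A * (k^2 - \<rho>)"
  proof -
    show "2 * B0 \<le> A" by (simp add: A_def)
    have "2 * B1 / k \<le> A" by (simp add: A_def)
    then show "2 * B1 \<le> A * k" using k by (simp add: field_simps)
    have "4 * C / (k^2 - \<rho>) \<le> A" by (simp add: A_def)
    then show "4 * C \<le> A * (k^2 - \<rho>)" using k2 by (simp add: pos_divide_le_eq)
  qed
  have osc: "\<forall>z\<in>Z. \<forall>z'\<in>Z. u m z - u m z' \<le> A * k ^ m" for m
  proof (induction m rule: induct_nat_012)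
    case 0
    show ?case
    proof (intro ballI)
      fix z z' assume "z \<in> Z" "z' \<in> Z"
      then show "u 0 z - u 0 z' \<le> A * k ^ 0" using B0[of z] B0[of z'] A(1) by simp
    qed
  next
    case 1
    show ?case
    proof (intro ballI)
      fix z z' assume "z \<in> Z" "z' \<in> Z"
      then show "u (Suc 0) z - u (Suc 0) z' \<le> A * k ^ Suc 0" using B1[of z] B1[of z'] A(2) by simp
    qed
  next
    case (ge2 m)
    have e: "\<bar>u (Suc (Suc m)) z - K (K (u m)) z\<bar> \<le> 2 * C * k ^ m" if "z \<in> Z" for z
    proof -
      have "\<bar>u (Suc (Suc m)) z - K (u (Suc m)) z\<bar> \<le> C * k ^ Suc m" by (rule err'[OF that])
      also have "\<dots> \<le> C * k ^ m" using C k by (intro mult_left_mono) (auto simp: mult_le_cancel_right1)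
      finally have 1: "\<bar>u (Suc (Suc m)) z - K (u (Suc m)) z\<bar> \<le> C * k ^ m" .
      have "\<bar>K (u (Suc m)) z - K (K (u m)) z\<bar> \<le> C * k ^ m"
        by (rule abs_K_diff_le[OF that err'])
      with 1 show ?thesis by linarith
    qed
    show ?case
    proof (intro ballI)
      fix z z' assume z: "z \<in> Z" "z' \<in> Z"
      have "u (Suc (Suc m)) z - u (Suc (Suc m)) z' \<le> K (K (u m)) z - K (K (u m)) z' + 4 * C * k ^ m"
        using e[OF z(1)] e[OF z(2)] by linarith
      also have "K (K (u m)) z - K (K (u m)) z' \<le> \<rho> * (A * k ^ m)"
        unfolding \<rho>_def using ge2 z by (intro K_K_contraction) auto
      also have "4 * C * k ^ m \<le> A * (k^2 - \<rho>) * k ^ m"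
        using A(3) k by (intro mult_right_mono) auto
      finally show "u (Suc (Suc m)) z - u (Suc (Suc m)) z' \<le> A * k ^ Suc (Suc m)"
        by (simp add: algebra_simps power2_eq_square)
    qed
  qed
  have "\<bar>u (Suc m) z0 - u m z0\<bar> \<le> (C + A) * k ^ m" for m
  proof -
    have "K (u m) z0 - u m z0 = (\<Sum>d\<in>D. w z0 d * (u m (nxt z0 d) - u m z0))"
      using w_sum[OF z0] by (simp add: K_def right_diff_distrib sum_subtractf sum_distrib_right[symmetric])
    moreover have "\<bar>\<Sum>d\<in>D. w z0 d * (u m (nxt z0 d) - u m z0)\<bar> \<le> A * k ^ m"
    proof (rule abs_average_le[OF z0])
      fix d assume "d \<in> D" "w z0 d \<noteq> 0"
      then have "nxt z0 d \<in> Z" using nxt_closed[OF z0] by simp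
      then have "u m (nxt z0 d) - u m z0 \<le> A * k ^ m" "u m z0 - u m (nxt z0 d) \<le> A * k ^ m"
        using osc[of m] z0 by blast+
      then show "\<bar>u m (nxt z0 d) - u m z0\<bar> \<le> A * k ^ m" by linarith
    qed
    ultimately show ?thesis using err'[OF z0, of m] by (simp add: distrib_right)
  qed
  then obtain c where c: "\<And>m. \<bar>u m z0 - c\<bar> \<le> (C + A) / (1 - k) * k ^ m"
    using geometric_telescope[OF k(1,2), of "\<lambda>m. u m z0" "C + A"] by metis
  show thesis
  proof (rule that[OF k(1,2)])
    fix m z assume z: "z \<in> Z"
    have "u m z - u m z0 \<le> A * k ^ m" "u m z0 - u m z \<le> A * k ^ m"
      using osc[of m] z z0 by blast+
    then have "\<bar>u m z - u m z0\<bar> \<le> A * k ^ m" by linarith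
    then show "\<bar>u m z - c\<bar> \<le> (A + (C + A) / (1 - k)) * k ^ m"
      using c[of m] by (simp add: distrib_right)
  qed
qed

end

section \<open>Weighted walks and their first two moments\<close>

context finite_chain begin

text \<open>The unnormalised expectation of \<open>G\<close> at the accumulated increments plus
  \<open>f0\<close> of the end state, weighted by \<open>w0\<close> of the end state;
  \<open>u\<close> is what has been accumulated before. \<open>G\<close> may be vector-valued:
  powers give moments, \<open>cis\<close> the characteristic function and the constant 1 the total
  mass.\<close>

primrec walk :: "('z \<Rightarrow> 'd \<Rightarrow> real) \<Rightarrow> ('z \<Rightarrow> real) \<Rightarrow> ('z \<Rightarrow> real) \<Rightarrow> (real \<Rightarrow> 'b::real_vector)
    \<Rightarrow> nat \<Rightarrow> 'z \<Rightarrow> real \<Rightarrow> 'b" where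
  "walk f f0 w0 G 0 z u = w0 z *\<^sub>R G (u + f0 z)"
| "walk f f0 w0 G (Suc m) z u = (\<Sum>d\<in>D. w z d *\<^sub>R walk f f0 w0 G m (nxt z d) (u + f z d))"

text \<open>Here and in the next three lemmas the accumulator is expanded out of
  \<open>walk\<close>, so that the quantities with accumulator 0 satisfy recursions among
  themselves.\<close>

lemma walk_one: "walk f f0 w0 (\<lambda>_. 1::real) m z u = walk f f0 w0 (\<lambda>_. 1) m z 0"
proof (induction m arbitrary: z u)
  case (Suc m)
  show ?case
    by (simp only: walk.simps Suc[of _ "u + _"] Suc[of _ "0 + _"])
qed simp

lemma walk_id: "walk f f0 w0 (\<lambda>v. v) m z u =
    walk f f0 w0 (\<lambda>v. v) m z 0 + u * walk f f0 w0 (\<lambda>_. 1::real) m z 0"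
proof (induction m arbitrary: z u)
  case (Suc m)
  show ?case
    by (simp only: walk.simps Suc[of _ "u + _"] Suc[of _ "0 + _"] walk_one[of _ _ _ _ _ "0 + _"])
       (simp add: algebra_simps sum.distrib sum_distrib_left)
qed (simp add: algebra_simps)

lemma walk_square: "walk f f0 w0 (\<lambda>v. v^2) m z u =
    walk f f0 w0 (\<lambda>v. v^2) m z 0 + 2 * u * walk f f0 w0 (\<lambda>v. v) m z 0 + u^2 * walk f f0 w0 (\<lambda>_. 1::real) m z 0"
proof (induction m arbitrary: z u)
  case (Suc m)
  show ?case
    by (simp only: walk.simps Suc[of _ "u + _"] Suc[of _ "0 + _"] walk_one[of _ _ _ _ _ "0 + _"] walk_id[of _ _ _ _ _ "0 + _"])
       (simp add: algebra_simps sum.distrib sum_distrib_left power2_eq_square)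
qed (simp add: algebra_simps power2_eq_square)

lemma walk_cis: "walk f f0 w0 (\<lambda>v. cis (\<epsilon> * v)) m z u = cis (\<epsilon> * u) * walk f f0 w0 (\<lambda>v. cis (\<epsilon> * v)) m z 0"
proof (induction m arbitrary: z u)
  case 0 show ?case by (simp add: cis_mult[symmetric] distrib_left scaleR_conv_of_real)
next
  case (Suc m)
  show ?case
    by (simp only: walk.simps Suc[of _ "u + _"] Suc[of _ "0 + _"])
       (simp add: cis_mult[symmetric] distrib_left sum_distrib_left scaleR_conv_of_real mult_ac)
qed

lemma moments_Suc:
  fixes f f0 w0
  defines "A \<equiv> \<lambda>m z. walk f f0 w0 (\<lambda>_. 1::real) m z 0" and "B \<equiv> \<lambda>m z. walk f f0 w0 (\<lambda>v. v) m z 0"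
    and "C \<equiv> \<lambda>m z. walk f f0 w0 (\<lambda>v. v^2) m z 0"
  shows "A (Suc m) z = K (A m) z"
    and "B (Suc m) z = (\<Sum>d\<in>D. w z d * (B m (nxt z d) + f z d * A m (nxt z d)))"
    and "C (Suc m) z = (\<Sum>d\<in>D. w z d * (C m (nxt z d) + 2 * f z d * B m (nxt z d) + (f z d)^2 * A m (nxt z d)))"
  unfolding A_def B_def C_def
    apply (simp only: walk.simps walk_one[of _ _ _ _ _ "0 + _"] K_def, simp)
   apply (simp only: walk.simps walk_id[of _ _ _ _ _ "0 + _"], simp)
  apply (simp only: walk.simps walk_square[of _ _ _ _ _ "0 + _"], simp)
  done

text \<open>The mass satisfies the recursion by \<open>K\<close> without error, hence converges
  geometrically to a constant. Being an average of values of \<open>w0\<close>, it never drops below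
  their minimum, which makes division by it harmless.\<close>

lemma mass_limit:
  assumes w0: "\<And>z. z \<in> Z \<Longrightarrow> 0 < w0 z"
  obtains \<omega> C \<kappa> where "0 < \<kappa>" "\<kappa> < 1" "0 < \<omega>" "0 \<le> C"
    "\<And>m z. z \<in> Z \<Longrightarrow> \<bar>walk f f0 w0 (\<lambda>_. 1::real) m z 0 - \<omega>\<bar> \<le> C * \<kappa> ^ m"
    "\<And>m z. z \<in> Z \<Longrightarrow> Min (w0 ` Z) \<le> walk f f0 w0 (\<lambda>_. 1::real) m z 0"
    "0 < Min (w0 ` Z)"
proof -
  define A where "A = (\<lambda>m z. walk f f0 w0 (\<lambda>_. 1::real) m z 0)"
  have A_Suc: "A (Suc m) z = K (A m) z" for m z unfolding A_def by (rule moments_Suc(1))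
  obtain c C \<kappa> where k: "0 < \<kappa>" "\<kappa> < 1" and c: "\<And>m z. z \<in> Z \<Longrightarrow> \<bar>A m z - c\<bar> \<le> C * \<kappa> ^ m"
    by (rule geometric_limit[of 0 A 0]) (auto simp: A_Suc)
  have fin: "finite (w0 ` Z)" "w0 ` Z \<noteq> {}" using finite_Z z0 by auto
  have min_pos: "0 < Min (w0 ` Z)" using fin w0 by auto
  have low: "Min (w0 ` Z) \<le> A m z" if "z \<in> Z" for m z
    using that
  proof (induction m arbitrary: z)
    case 0 then show ?case using fin by (simp add: A_def)
  next
    case (Suc m)
    have "(\<Sum>d\<in>D. w z d * (- A m (nxt z d))) \<le> - Min (w0 ` Z)"
      using Suc nxt_closed by (intro average_le) auto
    then show ?case unfolding A_Suc K_def by (simp add: sum_negf)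
  qed
  have C: "0 \<le> C" using c[OF z0, of 0] by simp
  have "(\<lambda>m. A m z0) \<longlonglongrightarrow> c"
  proof (rule LIM_zero_cancel, rule Lim_null_comparison)
    show "\<forall>\<^sub>F m in sequentially. norm (A m z0 - c) \<le> C * \<kappa> ^ m" using c[OF z0] by simp
    show "(\<lambda>m. C * \<kappa> ^ m) \<longlonglongrightarrow> 0" using k by (intro tendsto_mult_right_zero LIMSEQ_power_zero) simp
  qed
  then have "Min (w0 ` Z) \<le> c" using low[OF z0] by (intro LIMSEQ_le_const) auto
  then show thesis using k C c low min_pos by (intro that[of \<kappa> c C]) (auto simp: A_def)
qed

text \<open>Needed for the second moment, where the linear term \<open>\<sigma>2 * m\<close> is
  multiplied once by the mass and once by its limit.\<close>

lemma geometric_times_linear_bounded: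
  fixes \<kappa> :: real assumes "0 < \<kappa>" "\<kappa> < 1"
  obtains M where "0 \<le> M" "\<And>m. real m * \<kappa> ^ m \<le> M"
proof -
  have "(\<lambda>m. real m * \<kappa> ^ m) \<longlonglongrightarrow> 0" using assms by (intro powser_times_n_limit_0) simp
  then have "Bseq (\<lambda>m. real m * \<kappa> ^ m)" by (intro convergent_imp_Bseq) (auto simp: convergent_def)
  then obtain M where "0 < M" "\<And>m. norm (real m * \<kappa> ^ m) \<le> M" by (auto simp: Bseq_def)
  then show thesis using that[of M] by (metis abs_ge_self less_eq_real_def order_trans real_norm_def)
qed

text \<open>The solutions of the Poisson equations act as correctors: once they are subtracted, the
  moment functions satisfy the recursion by \<open>K\<close> up to geometrically decaying errors and
  therefore converge to constants. Division by the mass passes to the normalised law.\<close>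

theorem walk_moments:
  assumes w0: "\<And>z. z \<in> Z \<Longrightarrow> 0 < w0 z"
    and g: "\<And>z. z \<in> Z \<Longrightarrow> (\<Sum>d\<in>D. w z d * (f z d + g (nxt z d))) = g z"
    and h: "\<And>z. z \<in> Z \<Longrightarrow> (\<Sum>d\<in>D. w z d * ((f z d)^2 + 2 * f z d * g (nxt z d) + h (nxt z d))) = \<sigma>2 + h z"
    and z: "z \<in> Z"
  obtains M where
    "\<And>m. \<bar>walk f f0 w0 (\<lambda>v. v) m z 0 / walk f f0 w0 (\<lambda>_. 1::real) m z 0\<bar> \<le> M"
    "\<And>m. \<bar>walk f f0 w0 (\<lambda>v. v^2) m z 0 / walk f f0 w0 (\<lambda>_. 1::real) m z 0 - \<sigma>2 * real m\<bar> \<le> M"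
proof -
  define A where "A = (\<lambda>m z. walk f f0 w0 (\<lambda>_. 1::real) m z 0)"
  define B where "B = (\<lambda>m z. walk f f0 w0 (\<lambda>v. v) m z 0)"
  define C where "C = (\<lambda>m z. walk f f0 w0 (\<lambda>v. v^2) m z 0)"
  have Suc: "A (Suc m) z = K (A m) z"
    "B (Suc m) z = (\<Sum>d\<in>D. w z d * (B m (nxt z d) + f z d * A m (nxt z d)))"
    "C (Suc m) z = (\<Sum>d\<in>D. w z d * (C m (nxt z d) + 2 * f z d * B m (nxt z d) + (f z d)^2 * A m (nxt z d)))" for m z
    unfolding A_def B_def C_def by (fact moments_Suc)+
  obtain F where F: "0 \<le> F" "\<And>z. z \<in> Z \<Longrightarrow> (\<Sum>d\<in>D. \<bar>f z d\<bar>) \<le> F"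
    using bounded_on_Z[of "\<lambda>z. \<Sum>d\<in>D. \<bar>f z d\<bar>"] by (metis abs_ge_self order_trans)
  have f: "\<bar>f z d\<bar> \<le> F" if "z \<in> Z" "d \<in> D" for z d
    using F(2)[OF that(1)] member_le_sum[OF that(2), of "\<lambda>d. \<bar>f z d\<bar>"] finite_D by simp
  obtain \<omega> CA k1 where k1: "0 < k1" "k1 < 1" and "0 < \<omega>" "0 \<le> CA"
    and Alim: "\<And>m z. z \<in> Z \<Longrightarrow> \<bar>A m z - \<omega>\<bar> \<le> CA * k1 ^ m"
    and Alow: "\<And>m z. z \<in> Z \<Longrightarrow> Min (w0 ` Z) \<le> A m z" and min_pos: "0 < Min (w0 ` Z)"
    using mass_limit[of w0 f f0] w0 unfolding A_def by metis
  \<comment> \<open>By the first Poisson equation the only error left in the recursion is the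
    average of \<open>f * (A m - \<omega>)\<close>.\<close>
  define U where "U = (\<lambda>m z. B m z - \<omega> * g z)"
  have "\<bar>U (Suc m) z - K (U m) z\<bar> \<le> (F * CA) * k1 ^ m" if z: "z \<in> Z" for m z
  proof -
    have "U (Suc m) z - K (U m) z =
        (\<Sum>d\<in>D. w z d * (B m (nxt z d) + f z d * A m (nxt z d))) - \<omega> * (\<Sum>d\<in>D. w z d * (f z d + g (nxt z d)))
        - (\<Sum>d\<in>D. w z d * (B m (nxt z d) - \<omega> * g (nxt z d)))"
      unfolding U_def Suc(2) g[OF z] K_def ..
    also have "\<dots> = (\<Sum>d\<in>D. w z d * (f z d * (A m (nxt z d) - \<omega>)))"
      by (simp add: sum_distrib_left sum.distrib sum_subtractf algebra_simps)
    finally have eq: "U (Suc m) z - K (U m) z = \<dots>" .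
    show ?thesis unfolding eq
    proof (rule abs_average_le[OF z])
      fix d assume d: "d \<in> D" "w z d \<noteq> 0"
      show "\<bar>f z d * (A m (nxt z d) - \<omega>)\<bar> \<le> F * CA * k1 ^ m"
        unfolding abs_mult mult.assoc using f[OF z d(1)] Alim[OF nxt_closed[OF z d]] F(1)
        by (intro mult_mono) auto
    qed
  qed
  then obtain b CB k2 where k2: "0 < k2" "k2 < 1"
    and Blim: "\<And>m z. z \<in> Z \<Longrightarrow> \<bar>U m z - b\<bar> \<le> CB * k2 ^ m"
    using geometric_limit[of k1 U "F * CA"] k1 by (metis less_eq_real_def)
  define k where "k = max k1 k2"
  have k: "0 < k" "k < 1" "k1 \<le> k" "k2 \<le> k" using k1 k2 by (auto simp: k_def)
  have CB: "0 \<le> CB" using Blim[OF z0, of 0] by simp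
  \<comment> \<open>Since \<open>B m\<close> is close to \<open>\<omega> * g + b\<close>, the cross
    term \<open>2 * f * B m\<close> contributes \<open>2 * b * f\<close> besides the part treated by
    \<open>h\<close>; the corrector of this contribution is \<open>2 * b * g\<close>.\<close>
  define V where "V = (\<lambda>m z. C m z - \<omega> * h z - 2 * b * g z - \<omega> * \<sigma>2 * real m)"
  have "\<bar>V (Suc m) z - K (V m) z\<bar> \<le> (2 * F * CB + F^2 * CA) * k ^ m" if z: "z \<in> Z" for m z
  proof -
    have 1: "(\<Sum>d\<in>D. w z d * (\<omega> * \<sigma>2 * real m)) = \<omega> * \<sigma>2 * real m"
      using w_sum[OF z] by (simp add: sum_distrib_right[symmetric])
    have "V (Suc m) z - K (V m) z =
        (\<Sum>d\<in>D. w z d * (C m (nxt z d) + 2 * f z d * B m (nxt z d) + (f z d)^2 * A m (nxt z d)))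
        - \<omega> * (\<Sum>d\<in>D. w z d * ((f z d)^2 + 2 * f z d * g (nxt z d) + h (nxt z d)))
        - 2 * b * (\<Sum>d\<in>D. w z d * (f z d + g (nxt z d)))
        - (\<Sum>d\<in>D. w z d * (C m (nxt z d) - \<omega> * h (nxt z d) - 2 * b * g (nxt z d) - \<omega> * \<sigma>2 * real m))
        - (\<Sum>d\<in>D. w z d * (\<omega> * \<sigma>2 * real m))"
      unfolding V_def Suc(3) g[OF z] h[OF z] K_def 1 by (simp add: algebra_simps)
    also have "\<dots> = (\<Sum>d\<in>D. w z d * (2 * f z d * (U m (nxt z d) - b) + (f z d)^2 * (A m (nxt z d) - \<omega>)))"
      by (simp add: U_def sum_distrib_left sum.distrib sum_subtractf algebra_simps)
    finally have eq: "V (Suc m) z - K (V m) z = \<dots>" .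
    show ?thesis unfolding eq
    proof (rule abs_average_le[OF z])
      fix d assume d: "d \<in> D" "w z d \<noteq> 0"
      have p: "k1 ^ m \<le> k ^ m" "k2 ^ m \<le> k ^ m" using k k1 k2 by (auto intro!: power_mono)
      have "\<bar>2 * f z d * (U m (nxt z d) - b)\<bar> \<le> (2 * F) * (CB * k ^ m)"
        unfolding abs_mult using f[OF z d(1)] order_trans[OF Blim[OF nxt_closed[OF z d]] mult_left_mono[OF p(2) CB]] F(1)
        by (intro mult_mono) auto
      moreover have "\<bar>(f z d)^2 * (A m (nxt z d) - \<omega>)\<bar> \<le> F^2 * (CA * k ^ m)"
        unfolding abs_mult using power_mono[OF f[OF z d(1)], of 2]
          order_trans[OF Alim[OF nxt_closed[OF z d]] mult_left_mono[OF p(1) \<open>0 \<le> CA\<close>]] F(1)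
        by (intro mult_mono) (auto simp: power_abs[symmetric])
      ultimately show "\<bar>2 * f z d * (U m (nxt z d) - b) + (f z d)^2 * (A m (nxt z d) - \<omega>)\<bar> \<le> (2 * F * CB + F^2 * CA) * k ^ m"
        by (intro order_trans[OF abs_triangle_ineq]) (simp add: algebra_simps)
    qed
  qed
  then obtain c CC k3 where k3: "0 < k3" "k3 < 1"
    and Clim: "\<And>m z. z \<in> Z \<Longrightarrow> \<bar>V m z - c\<bar> \<le> CC * k3 ^ m"
    using geometric_limit[of k V "2 * F * CB + F^2 * CA"] k by (metis less_eq_real_def)
  have CC: "0 \<le> CC" using Clim[OF z0, of 0] by simp
  define l where "l = Min (w0 ` Z)"
  have l: "0 < l" "\<And>m. l \<le> A m z" using Alow[OF z] min_pos by (auto simp: l_def)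
  obtain MA where MA: "0 \<le> MA" "\<And>m. real m * k1 ^ m \<le> MA"
    using geometric_times_linear_bounded[OF k1] by metis
  define M1 where "M1 = \<bar>b\<bar> + CB + \<omega> * \<bar>g z\<bar>"
  define M2 where "M2 = \<bar>c\<bar> + CC + \<bar>\<omega> * h z + 2 * b * g z\<bar> + \<bar>\<sigma>2\<bar> * (CA * MA)"
  have div: "\<bar>x / A m z\<bar> \<le> M / l" if "\<bar>x\<bar> \<le> M" for x M m
    using that l(1) l(2)[of m] by (simp add: abs_divide) (intro frac_le, auto)
  have B: "\<bar>B m z\<bar> \<le> M1" for m
  proof -
    have "CB * k2 ^ m \<le> CB" using CB k2 by (simp add: mult_left_le power_le_one)
    moreover have "\<bar>\<omega> * g z\<bar> = \<omega> * \<bar>g z\<bar>" using \<open>0 < \<omega>\<close> by (simp add: abs_mult)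
    ultimately show ?thesis using Blim[OF z, of m] by (simp add: U_def M1_def)
  qed
  have C: "\<bar>C m z - \<sigma>2 * real m * A m z\<bar> \<le> M2" for m
  proof -
    have "CC * k3 ^ m \<le> CC" using CC k3 by (simp add: mult_left_le power_le_one)
    moreover have "\<bar>\<sigma>2 * (real m * (A m z - \<omega>))\<bar> \<le> \<bar>\<sigma>2\<bar> * (CA * MA)"
      unfolding abs_mult
    proof (intro mult_left_mono)
      have "\<bar>real m\<bar> * \<bar>A m z - \<omega>\<bar> \<le> real m * (CA * k1 ^ m)"
        using Alim[OF z, of m] by (simp add: mult_left_mono)
      also have "\<dots> \<le> CA * MA" using mult_left_mono[OF MA(2)[of m] \<open>0 \<le> CA\<close>] by (simp add: mult_ac)
      finally show "\<bar>real m\<bar> * \<bar>A m z - \<omega>\<bar> \<le> CA * MA" .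
    qed simp
    moreover have "C m z - \<sigma>2 * real m * A m z =
        (V m z - c) + c + (\<omega> * h z + 2 * b * g z) - \<sigma>2 * (real m * (A m z - \<omega>))"
      by (simp add: V_def algebra_simps)
    ultimately show ?thesis using Clim[OF z, of m] by (simp add: M2_def)
  qed
  show thesis
  proof (rule that[of "max (M1 / l) (M2 / l)"])
    fix m
    show "\<bar>walk f f0 w0 (\<lambda>v. v) m z 0 / walk f f0 w0 (\<lambda>_. 1::real) m z 0\<bar> \<le> max (M1 / l) (M2 / l)"
      using div[OF B, of m m] unfolding A_def B_def by simp
    have "C m z / A m z - \<sigma>2 * real m = (C m z - \<sigma>2 * real m * A m z) / A m z"
      using l(1) l(2)[of m] by (simp add: field_simps)
    then show "\<bar>walk f f0 w0 (\<lambda>v. v^2) m z 0 / walk f f0 w0 (\<lambda>_. 1::real) m z 0 - \<sigma>2 * real m\<bar> \<le> max (M1 / l) (M2 / l)"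
      using div[OF C, of m m] unfolding A_def C_def by simp
  qed
qed

end

section \<open>Central limit theorem from an approximate eigenfunction\<close>

lemma cis_taylor2: "norm (cis x - (1 + \<i> * of_real x - of_real (x^2) / 2)) \<le> \<bar>x\<bar> ^ 3"
proof -
  have "(\<Sum>k\<le>2. (\<i> * of_real x) ^ k / fact k) = 1 + \<i> * of_real x - of_real (x^2) / 2"
    by (simp add: numeral_2_eq_2 power_mult_distrib)
  then have "norm (cis x - (1 + \<i> * of_real x - of_real (x^2) / 2)) \<le> \<bar>x\<bar> ^ 3 / 6"
    using iexp_approx1[of x 2] by (simp add: cis_conv_exp fact_numeral)
  also have "\<dots> \<le> \<bar>x\<bar> ^ 3" by simp
  finally show ?thesis .
qed

lemma norm_cis_minus_one_le: "norm (cis x - 1) \<le> \<bar>x\<bar>"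
  using iexp_approx1[of x 0] by (simp add: cis_conv_exp)

text \<open>The eigenfunction property before averaging: up to third order, the product of
  \<open>cis (\<epsilon> * f)\<close> with the trial function contains just the combinations
  \<open>f + g\<close> and \<open>f^2 + 2 * f * g + h\<close> that the Poisson equations
  average.\<close>

lemma norm_cubic_remainder:
  fixes f g h :: real
  assumes "0 \<le> \<epsilon>" "\<epsilon> \<le> 1" "1 \<le> M" "\<bar>f\<bar> \<le> M" "\<bar>g\<bar> \<le> M" "\<bar>h\<bar> \<le> M"
  shows "norm (cis (\<epsilon> * f) * Complex (1 - \<epsilon>^2 * h / 2) (\<epsilon> * g)
      - Complex (1 - \<epsilon>^2 / 2 * (f^2 + 2 * f * g + h)) (\<epsilon> * (f + g))) \<le> 6 * M^4 * \<epsilon>^3"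
proof -
  define T :: complex where "T = 1 + \<i> * of_real (\<epsilon> * f) - of_real ((\<epsilon> * f)^2) / 2"
  define P where "P = Complex (1 - \<epsilon>^2 * h / 2) (\<epsilon> * g)"
  have e3: "0 \<le> \<epsilon>^3" using assms by simp
  have M: "0 \<le> M" using assms by simp
  have "norm P \<le> 1 + M / 2 + M"
  proof -
    have "norm P \<le> \<bar>1 - \<epsilon>^2 * h / 2\<bar> + \<bar>\<epsilon> * g\<bar>" unfolding P_def using cmod_le by (metis complex.sel)
    moreover have "\<bar>\<epsilon> * g\<bar> \<le> 1 * M" unfolding abs_mult using assms by (intro mult_mono) auto
    moreover have "\<bar>\<epsilon>^2 * h\<bar> \<le> 1 * M" unfolding abs_mult using assms by (intro mult_mono) (auto simp: power_le_one)
    ultimately show ?thesis by linarith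
  qed
  also have "\<dots> \<le> 3 * M" using assms by simp
  finally have P: "norm P \<le> 3 * M" .
  have "norm (cis (\<epsilon> * f) - T) \<le> \<bar>\<epsilon> * f\<bar>^3" unfolding T_def by (rule cis_taylor2)
  also have "\<dots> \<le> (\<epsilon> * M)^3" using assms by (intro power_mono) (auto simp: abs_mult mult_left_mono)
  finally have "norm ((cis (\<epsilon> * f) - T) * P) \<le> (\<epsilon> * M)^3 * (3 * M)"
    unfolding norm_mult using P assms(1) M by (intro mult_mono) auto
  then have 1: "norm ((cis (\<epsilon> * f) - T) * P) \<le> 3 * M^4 * \<epsilon>^3"
    by (simp add: power_mult_distrib eval_nat_numeral mult_ac)
  \<comment> \<open>The terms of order three and four in the product \<open>T * P\<close>, divided
    by \<open>\<epsilon>^3\<close>.\<close>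
  define Q where "Q = Complex (\<epsilon> * f^2 * h / 4) (- (f * h / 2) - f^2 * g / 2)"
  have 2: "T * P - Complex (1 - \<epsilon>^2 / 2 * (f^2 + 2 * f * g + h)) (\<epsilon> * (f + g)) = of_real (\<epsilon>^3) * Q"
    by (simp add: T_def P_def Q_def complex_eq_iff field_simps power2_eq_square power3_eq_cube)
  have ff: "\<bar>f^2\<bar> \<le> M^2" using power_mono[OF assms(4), of 2] by simp
  have "norm Q \<le> \<bar>\<epsilon> * f^2 * h / 4\<bar> + \<bar>- (f * h / 2) - f^2 * g / 2\<bar>" unfolding Q_def using cmod_le by (metis complex.sel)
  moreover have "\<bar>\<epsilon> * f^2 * h\<bar> \<le> 1 * M^2 * M" unfolding abs_mult using assms ff by (intro mult_mono) auto
  moreover have "\<bar>f * h\<bar> \<le> M * M" unfolding abs_mult using assms by (intro mult_mono) auto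
  moreover have "\<bar>f^2 * g\<bar> \<le> M^2 * M" unfolding abs_mult using assms ff by (intro mult_mono) auto
  moreover have "M * M \<le> M^4" "M^2 * M \<le> M^4" 
    using power_increasing[of 2 4 M] power_increasing[of 3 4 M] assms(3)
    by (simp_all add: power2_eq_square power3_eq_cube)
  ultimately have "norm Q \<le> 3 * M^4" by linarith
  then have "norm (of_real (\<epsilon>^3) * Q) \<le> \<epsilon>^3 * (3 * M^4)"
    using e3 by (simp add: norm_mult norm_power mult_left_mono assms(1))
  moreover have "cis (\<epsilon> * f) * P - Complex (1 - \<epsilon>^2 / 2 * (f^2 + 2 * f * g + h)) (\<epsilon> * (f + g))
      = (cis (\<epsilon> * f) - T) * P + of_real (\<epsilon>^3) * Q"
    using 2 by (simp add: algebra_simps)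
  ultimately show ?thesis
    using 1 norm_triangle_ineq[of "(cis (\<epsilon> * f) - T) * P" "of_real (\<epsilon>^3) * Q"]
    unfolding P_def by (simp add: algebra_simps)
qed

context finite_chain begin

lemma walk_cis_Suc:
  "walk f f0 w0 (\<lambda>v. cis (\<epsilon> * v)) (Suc m) z 0 =
    (\<Sum>d\<in>D. w z d *\<^sub>R (cis (\<epsilon> * f z d) * walk f f0 w0 (\<lambda>v. cis (\<epsilon> * v)) m (nxt z d) 0))"
  unfolding walk.simps by (subst walk_cis) simp

text \<open>Each step reproduces the trial function with factor
  \<open>1 - \<epsilon>^2 * \<sigma>2 / 2\<close> up to \<open>O(\<epsilon>^3)\<close>. With
  \<open>\<epsilon> = 1 / sqrt m\<close> the \<open>m\<close> errors add up to
  \<open>O(\<epsilon>)\<close>, and the factors multiply to the Gaussian limit. The recursion does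
  not start at a multiple of the trial function, so some of its steps are spent on letting the mass
  approach \<open>\<omega>\<close>.\<close>

theorem walk_central_limit:
  assumes w0: "\<And>z. z \<in> Z \<Longrightarrow> 0 < w0 z"
    and g: "\<And>z. z \<in> Z \<Longrightarrow> (\<Sum>d\<in>D. w z d * (f z d + g (nxt z d))) = g z"
    and h: "\<And>z. z \<in> Z \<Longrightarrow> (\<Sum>d\<in>D. w z d * ((f z d)^2 + 2 * f z d * g (nxt z d) + h (nxt z d))) = \<sigma>2 + h z"
    and \<sigma>2: "0 \<le> \<sigma>2" and z: "z \<in> Z"
  shows "(\<lambda>m. walk f f0 w0 (\<lambda>v. cis (1 / sqrt (real m) * v)) m z 0 /
      of_real (walk f f0 w0 (\<lambda>_. 1) m z 0)) \<longlonglongrightarrow> of_real (exp (- \<sigma>2 / 2))"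
proof -
  define A where "A = (\<lambda>m z. walk f f0 w0 (\<lambda>_. 1::real) m z 0)"
  define \<psi> where "\<psi> = (\<lambda>\<epsilon> m z. walk f f0 w0 (\<lambda>v. cis (\<epsilon> * v)) m z 0)"
  obtain \<omega> CA \<kappa> where \<kappa>: "0 < \<kappa>" "\<kappa> < 1" and \<omega>: "0 < \<omega>" and CA: "0 \<le> CA"
    and Alim: "\<And>m z. z \<in> Z \<Longrightarrow> \<bar>A m z - \<omega>\<bar> \<le> CA * \<kappa> ^ m"
    using mass_limit[of w0 f f0] w0 unfolding A_def by metis
  obtain M1 where M1: "\<And>z. z \<in> Z \<Longrightarrow> (\<Sum>d\<in>D. \<bar>f z d\<bar>) \<le> M1"
    using bounded_on_Z[of "\<lambda>z. \<Sum>d\<in>D. \<bar>f z d\<bar>"] by (metis abs_ge_self order_trans)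
  obtain M2 where M2: "\<And>z. z \<in> Z \<Longrightarrow> \<bar>\<bar>f0 z\<bar> + \<bar>w0 z\<bar> + \<bar>g z\<bar> + \<bar>h z\<bar>\<bar> \<le> M2"
    using bounded_on_Z[of "\<lambda>z. \<bar>f0 z\<bar> + \<bar>w0 z\<bar> + \<bar>g z\<bar> + \<bar>h z\<bar>"] by metis
  define M where "M = max 1 (max (M1 + M2) (max \<sigma>2 (max (CA + \<omega>) \<omega>)))"
  have M: "1 \<le> M" "\<sigma>2 \<le> M" "CA + \<omega> \<le> M" "\<omega> \<le> M" by (auto simp: M_def)
  have M1': "0 \<le> M1" using order_trans[OF sum_nonneg M1[OF z]] by simp
  have M2': "0 \<le> M2" using M2[OF z] by linarith
  have MM: "M1 \<le> M" "M2 \<le> M" using M1' M2' by (auto simp: M_def)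
  have f: "\<bar>f z d\<bar> \<le> M" if "z \<in> Z" "d \<in> D" for z d
    using M1[OF that(1)] member_le_sum[OF that(2), of "\<lambda>d. \<bar>f z d\<bar>"] finite_D MM by simp
  have bd: "\<bar>f0 z\<bar> \<le> M" "\<bar>w0 z\<bar> \<le> M" "\<bar>g z\<bar> \<le> M" "\<bar>h z\<bar> \<le> M" if "z \<in> Z" for z
    using M2[OF that] MM by linarith+
  have A_bd: "\<bar>A m z\<bar> \<le> M" if "z \<in> Z" for m z
  proof -
    have "CA * \<kappa> ^ m \<le> CA" using CA \<kappa> by (simp add: mult_left_le power_le_one)
    then show ?thesis using Alim[OF that, of m] \<omega> M by linarith
  qed
  define \<phi> where "\<phi> = (\<lambda>\<epsilon> z. Complex (1 - \<epsilon>^2 * h z / 2) (\<epsilon> * g z))"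
  define lam where "lam = (\<lambda>\<epsilon>::real. 1 - \<epsilon>^2 * \<sigma>2 / 2)"
  have eigen: "norm ((\<Sum>d\<in>D. w z d *\<^sub>R (cis (\<epsilon> * f z d) * \<phi> \<epsilon> (nxt z d))) - lam \<epsilon> *\<^sub>R \<phi> \<epsilon> z) \<le> 7 * M^4 * \<epsilon>^3"
    if z: "z \<in> Z" and \<epsilon>: "0 \<le> \<epsilon>" "\<epsilon> \<le> 1" for z \<epsilon>
  proof -
    define R where "R = (\<lambda>d. Complex (1 - \<epsilon>^2 / 2 * ((f z d)^2 + 2 * f z d * g (nxt z d) + h (nxt z d))) (\<epsilon> * (f z d + g (nxt z d))))"
    have "norm (\<Sum>d\<in>D. w z d *\<^sub>R (cis (\<epsilon> * f z d) * \<phi> \<epsilon> (nxt z d) - R d)) \<le> 6 * M^4 * \<epsilon>^3"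
      unfolding R_def \<phi>_def using f[OF z] bd nxt_closed[OF z] M \<epsilon>
      by (intro norm_average_le[OF z] norm_cubic_remainder) auto
    moreover have "(\<Sum>d\<in>D. w z d *\<^sub>R R d) = Complex (1 - \<epsilon>^2 / 2 * (\<sigma>2 + h z)) (\<epsilon> * g z)"
    proof (rule complex_eqI)
      have "Re (\<Sum>d\<in>D. w z d *\<^sub>R R d) =
          (\<Sum>d\<in>D. w z d) - \<epsilon>^2 / 2 * (\<Sum>d\<in>D. w z d * ((f z d)^2 + 2 * f z d * g (nxt z d) + h (nxt z d)))"
        by (simp add: R_def Re_sum sum_distrib_left sum_subtractf[symmetric] algebra_simps)
      then show "Re (\<Sum>d\<in>D. w z d *\<^sub>R R d) = Re (Complex (1 - \<epsilon>^2 / 2 * (\<sigma>2 + h z)) (\<epsilon> * g z))"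
        unfolding h[OF z] w_sum[OF z] by simp
      have "Im (\<Sum>d\<in>D. w z d *\<^sub>R R d) = \<epsilon> * (\<Sum>d\<in>D. w z d * (f z d + g (nxt z d)))"
        by (simp add: R_def Im_sum sum_distrib_left mult_ac)
      then show "Im (\<Sum>d\<in>D. w z d *\<^sub>R R d) = Im (Complex (1 - \<epsilon>^2 / 2 * (\<sigma>2 + h z)) (\<epsilon> * g z))"
        unfolding g[OF z] by simp
    qed
    moreover have "Complex (1 - \<epsilon>^2 / 2 * (\<sigma>2 + h z)) (\<epsilon> * g z) - lam \<epsilon> *\<^sub>R \<phi> \<epsilon> z =
        of_real (\<epsilon>^3) * Complex (- \<epsilon> * \<sigma>2 * h z / 4) (\<sigma>2 * g z / 2)"
      by (simp add: lam_def \<phi>_def complex_eq_iff field_simps power2_eq_square power3_eq_cube)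
    moreover have "norm (of_real (\<epsilon>^3) * Complex (- \<epsilon> * \<sigma>2 * h z / 4) (\<sigma>2 * g z / 2)) \<le> \<epsilon>^3 * M^4"
    proof -
      have "\<bar>\<epsilon> * \<sigma>2 * h z\<bar> \<le> 1 * M * M" unfolding abs_mult using \<epsilon> bd[OF z] \<sigma>2 M by (intro mult_mono) auto
      moreover have "\<bar>\<sigma>2 * g z\<bar> \<le> M * M" unfolding abs_mult using bd[OF z] \<sigma>2 M by (intro mult_mono) auto
      moreover have "norm (Complex (- \<epsilon> * \<sigma>2 * h z / 4) (\<sigma>2 * g z / 2)) \<le> \<bar>- \<epsilon> * \<sigma>2 * h z / 4\<bar> + \<bar>\<sigma>2 * g z / 2\<bar>"
        using cmod_le by (metis complex.sel)
      moreover have "M * M \<le> M^4" using power_increasing[of 2 4 M] M(1) by (simp add: power2_eq_square)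
      moreover have "0 \<le> M * M" by simp
      ultimately have "norm (Complex (- \<epsilon> * \<sigma>2 * h z / 4) (\<sigma>2 * g z / 2)) \<le> M^4"
        by (simp only: abs_minus_cancel abs_divide minus_mult_left[symmetric] minus_divide_left[symmetric] abs_numeral)
      then show ?thesis using \<epsilon> by (simp add: norm_mult norm_power mult_left_mono)
    qed
    ultimately show ?thesis
      using norm_triangle_ineq[of "\<Sum>d\<in>D. w z d *\<^sub>R (cis (\<epsilon> * f z d) * \<phi> \<epsilon> (nxt z d) - R d)"
          "Complex (1 - \<epsilon>^2 / 2 * (\<sigma>2 + h z)) (\<epsilon> * g z) - lam \<epsilon> *\<^sub>R \<phi> \<epsilon> z"]
      by (simp add: scaleR_diff_right sum_subtractf algebra_simps)
  qed
  \<comment> \<open>Over few steps the characteristic function is compared directly with the mass,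
    at a cost proportional to \<open>\<epsilon>\<close>.\<close>
  have start: "norm (\<psi> \<epsilon> j z - of_real (A j z)) \<le> \<epsilon> * M^2 * (real j + 1)"
    if "z \<in> Z" and \<epsilon>: "0 \<le> \<epsilon>" "\<epsilon> \<le> 1" for z \<epsilon> j
    using that(1)
  proof (induction j arbitrary: z)
    case 0
    have "\<psi> \<epsilon> 0 z - of_real (A 0 z) = w0 z *\<^sub>R (cis (\<epsilon> * f0 z) - 1)"
      by (simp add: \<psi>_def A_def scaleR_conv_of_real algebra_simps)
    also have "norm \<dots> \<le> M * (\<epsilon> * M)"
      using norm_cis_minus_one_le[of "\<epsilon> * f0 z"] bd[OF 0] \<epsilon> M(1)
      unfolding norm_scaleR by (intro mult_mono order_trans[OF norm_cis_minus_one_le]) (auto simp: abs_mult mult_left_mono)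
    finally show ?case by (simp add: power2_eq_square mult_ac)
  next
    case (Suc j)
    have "\<psi> \<epsilon> (Suc j) z - of_real (A (Suc j) z) =
        (\<Sum>d\<in>D. w z d *\<^sub>R (cis (\<epsilon> * f z d) * (\<psi> \<epsilon> j (nxt z d) - of_real (A j (nxt z d)))
          + (cis (\<epsilon> * f z d) - 1) * of_real (A j (nxt z d))))"
      unfolding \<psi>_def A_def walk_cis_Suc moments_Suc K_def
      by (simp add: sum_subtractf[symmetric] scaleR_conv_of_real algebra_simps)
    also have "norm \<dots> \<le> \<epsilon> * M^2 * (real j + 1) + \<epsilon> * M * M"
    proof (rule norm_average_le[OF Suc.prems])
      fix d assume d: "d \<in> D" "w z d \<noteq> 0"
      then have n: "nxt z d \<in> Z" using nxt_closed Suc.prems by auto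
      have "norm (cis (\<epsilon> * f z d) * (\<psi> \<epsilon> j (nxt z d) - of_real (A j (nxt z d)))) \<le> \<epsilon> * M^2 * (real j + 1)"
        using Suc.IH[OF n] by (simp add: norm_mult)
      moreover have "norm ((cis (\<epsilon> * f z d) - 1) * of_real (A j (nxt z d))) \<le> (\<epsilon> * M) * M"
        unfolding norm_mult using f[OF Suc.prems d(1)] A_bd[OF n] \<epsilon> M(1)
        by (intro mult_mono order_trans[OF norm_cis_minus_one_le]) (auto simp: abs_mult mult_left_mono)
      ultimately show "norm (cis (\<epsilon> * f z d) * (\<psi> \<epsilon> j (nxt z d) - of_real (A j (nxt z d)))
          + (cis (\<epsilon> * f z d) - 1) * of_real (A j (nxt z d))) \<le> \<epsilon> * M^2 * (real j + 1) + \<epsilon> * M * M"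
        by (intro order_trans[OF norm_triangle_ineq]) simp
    qed
    finally show ?case by (simp add: power2_eq_square algebra_simps)
  qed
  have \<phi>1: "norm (\<phi> \<epsilon> z - 1) \<le> \<epsilon> * (2 * M)" if z: "z \<in> Z" and \<epsilon>: "0 \<le> \<epsilon>" "\<epsilon> \<le> 1" for z \<epsilon>
  proof -
    have "\<phi> \<epsilon> z - 1 = of_real \<epsilon> * Complex (- \<epsilon> * h z / 2) (g z)"
      by (simp add: \<phi>_def complex_eq_iff power2_eq_square)
    moreover have "\<bar>\<epsilon> * h z\<bar> \<le> 1 * M" unfolding abs_mult using \<epsilon> bd[OF z] by (intro mult_mono) auto
    moreover have "norm (Complex (- \<epsilon> * h z / 2) (g z)) \<le> \<bar>- \<epsilon> * h z / 2\<bar> + \<bar>g z\<bar>" using cmod_le by (metis complex.sel)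
    ultimately show ?thesis using bd[OF z] \<epsilon> by (simp add: norm_mult mult_left_mono)
  qed
  have lam: "0 \<le> lam \<epsilon>" "lam \<epsilon> \<le> 1" if "0 \<le> \<epsilon>" "\<epsilon>^2 * M \<le> 1" for \<epsilon>
  proof -
    have "\<epsilon>^2 * \<sigma>2 \<le> \<epsilon>^2 * M" using M by (intro mult_left_mono) auto
    then show "0 \<le> lam \<epsilon>" "lam \<epsilon> \<le> 1" using that \<sigma>2 by (auto simp: lam_def)
  qed
  \<comment> \<open>Three sources of error: the \<open>j\<close> initial steps of the recursion, the
    distance of the mass from \<open>\<omega>\<close> after them, and \<open>O(\<epsilon>^3)\<close>
    for each of the \<open>n\<close> further steps.\<close>
  have main: "norm (\<psi> \<epsilon> (j + n) z - of_real (\<omega> * lam \<epsilon> ^ (j + n)) * \<phi> \<epsilon> z)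
      \<le> \<epsilon> * (M^2 * (4 * real j + 4)) + CA * \<kappa> ^ j + real n * (7 * M^5 * \<epsilon>^3)"
    if "z \<in> Z" and \<epsilon>: "0 \<le> \<epsilon>" "\<epsilon> \<le> 1" "\<epsilon>^2 * M \<le> 1" for z \<epsilon> j n
    using that(1)
  proof (induction n arbitrary: z)
    case 0
    have "1 + real j * (- (\<epsilon>^2 * \<sigma>2 / 2)) \<le> (1 + (- (\<epsilon>^2 * \<sigma>2 / 2))) ^ j"
      using lam(1)[OF \<epsilon>(1,3)] by (intro Bernoulli_inequality) (auto simp: lam_def)
    then have "1 - lam \<epsilon> ^ j \<le> real j * (\<epsilon>^2 * \<sigma>2 / 2)" by (simp add: lam_def)
    also have "\<dots> \<le> real j * (\<epsilon> * M)"
    proof (intro mult_left_mono)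
      have "\<epsilon>^2 \<le> \<epsilon>" using \<epsilon> by (simp add: power2_eq_square mult_left_le)
      then have "\<epsilon>^2 * \<sigma>2 \<le> \<epsilon> * M" using M \<sigma>2 \<epsilon> by (intro mult_mono) auto
      then show "\<epsilon>^2 * \<sigma>2 / 2 \<le> \<epsilon> * M" using M \<epsilon> \<sigma>2 by (smt (verit) field_sum_of_halves mult_nonneg_nonneg zero_le_power2)
    qed simp
    finally have l1: "1 - lam \<epsilon> ^ j \<le> \<epsilon> * (M * real j)" by (simp add: mult_ac)
    have l2: "lam \<epsilon> ^ j \<le> 1" "0 \<le> lam \<epsilon> ^ j" using lam[OF \<epsilon>(1,3)] by (auto simp: power_le_one)
    have "norm (1 - of_real (lam \<epsilon> ^ j) * \<phi> \<epsilon> z) \<le> norm (of_real (1 - lam \<epsilon> ^ j) :: complex) + norm (of_real (lam \<epsilon> ^ j) * (\<phi> \<epsilon> z - 1))"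
      by (rule order_trans[OF _ norm_triangle_ineq4]) (simp add: algebra_simps)
    also have "\<dots> \<le> \<epsilon> * (M * real j) + 1 * (\<epsilon> * (2 * M))"
      unfolding norm_mult norm_of_real using l1 l2 \<phi>1[OF 0 \<epsilon>(1,2)] by (intro add_mono mult_mono) auto
    finally have "norm (1 - of_real (lam \<epsilon> ^ j) * \<phi> \<epsilon> z) \<le> \<epsilon> * (M * (real j + 2))" by (simp add: algebra_simps)
    then have "norm (of_real \<omega> * (1 - of_real (lam \<epsilon> ^ j) * \<phi> \<epsilon> z)) \<le> M * (\<epsilon> * (M * (real j + 2)))"
      unfolding norm_mult using M \<omega> by (intro mult_mono) auto
    moreover have "norm (\<psi> \<epsilon> j z - of_real (A j z)) \<le> \<epsilon> * M^2 * (real j + 1)"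
      by (rule start[OF 0 \<epsilon>(1,2)])
    moreover have "norm (of_real (A j z) - of_real \<omega> :: complex) \<le> CA * \<kappa> ^ j"
      using Alim[OF 0, of j] by (metis norm_of_real of_real_diff)
    moreover have "norm (\<psi> \<epsilon> j z - of_real (\<omega> * lam \<epsilon> ^ j) * \<phi> \<epsilon> z) \<le>
        norm (\<psi> \<epsilon> j z - of_real (A j z)) + norm (of_real (A j z) - of_real \<omega> :: complex)
        + norm (of_real \<omega> * (1 - of_real (lam \<epsilon> ^ j) * \<phi> \<epsilon> z))"
      by (rule order_trans[OF _ order_trans[OF norm_triangle_ineq add_right_mono[OF norm_triangle_ineq]]])
         (simp add: algebra_simps)
    ultimately have "norm (\<psi> \<epsilon> j z - of_real (\<omega> * lam \<epsilon> ^ j) * \<phi> \<epsilon> z) \<le>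
        \<epsilon> * M^2 * (real j + 1) + CA * \<kappa> ^ j + M * (\<epsilon> * (M * (real j + 2)))" by linarith
    also have "\<dots> = \<epsilon> * (M^2 * (2 * real j + 3)) + CA * \<kappa> ^ j"
      by (simp add: algebra_simps power2_eq_square)
    also have "\<dots> \<le> \<epsilon> * (M^2 * (4 * real j + 4)) + CA * \<kappa> ^ j"
      using \<epsilon> by (intro add_right_mono mult_left_mono) auto
    finally show ?case by simp
  next
    case (Suc n)
    define B where "B = \<epsilon> * (M^2 * (4 * real j + 4)) + CA * \<kappa> ^ j + real n * (7 * M^5 * \<epsilon>^3)"
    define c where "c = \<omega> * lam \<epsilon> ^ (j + n)"
    have c: "\<bar>c\<bar> \<le> M"
    proof -
      have "lam \<epsilon> ^ (j + n) \<le> 1" "0 \<le> lam \<epsilon> ^ (j + n)" using lam[OF \<epsilon>(1,3)] by (auto intro: power_le_one)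
      then have "\<omega> * lam \<epsilon> ^ (j + n) \<le> \<omega>" "0 \<le> \<omega> * lam \<epsilon> ^ (j + n)" using \<omega> by (simp_all add: mult_left_le)
      then show ?thesis using M by (simp add: c_def)
    qed
    have "\<psi> \<epsilon> (j + Suc n) z - of_real (\<omega> * lam \<epsilon> ^ (j + Suc n)) * \<phi> \<epsilon> z =
       (\<Sum>d\<in>D. w z d *\<^sub>R (cis (\<epsilon> * f z d) * (\<psi> \<epsilon> (j + n) (nxt z d) - of_real c * \<phi> \<epsilon> (nxt z d))))
       + of_real c * ((\<Sum>d\<in>D. w z d *\<^sub>R (cis (\<epsilon> * f z d) * \<phi> \<epsilon> (nxt z d))) - lam \<epsilon> *\<^sub>R \<phi> \<epsilon> z)"
      unfolding \<psi>_def add_Suc_right walk_cis_Suc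
      by (simp add: c_def scaleR_conv_of_real algebra_simps sum_subtractf sum_distrib_left)
    also have "norm \<dots> \<le> B + M * (7 * M^4 * \<epsilon>^3)"
    proof (rule order_trans[OF norm_triangle_ineq], rule add_mono)
      show "norm (\<Sum>d\<in>D. w z d *\<^sub>R (cis (\<epsilon> * f z d) * (\<psi> \<epsilon> (j + n) (nxt z d) - of_real c * \<phi> \<epsilon> (nxt z d)))) \<le> B"
      proof (rule norm_average_le[OF Suc.prems])
        fix d assume "d \<in> D" "w z d \<noteq> 0"
        then have "nxt z d \<in> Z" using nxt_closed Suc.prems by auto
        from Suc.IH[OF this] show "norm (cis (\<epsilon> * f z d) * (\<psi> \<epsilon> (j + n) (nxt z d) - of_real c * \<phi> \<epsilon> (nxt z d))) \<le> B"
          by (simp add: norm_mult B_def c_def)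
      qed
      show "norm (of_real c * ((\<Sum>d\<in>D. w z d *\<^sub>R (cis (\<epsilon> * f z d) * \<phi> \<epsilon> (nxt z d))) - lam \<epsilon> *\<^sub>R \<phi> \<epsilon> z)) \<le> M * (7 * M^4 * \<epsilon>^3)"
        unfolding norm_mult using c eigen[OF Suc.prems \<epsilon>(1,2)] M by (intro mult_mono) auto
    qed
    finally show ?case by (simp add: B_def algebra_simps eval_nat_numeral)
  qed
  define \<epsilon> where "\<epsilon> = (\<lambda>m. 1 / sqrt (real m))"
  have \<epsilon>_lim: "\<epsilon> \<longlonglongrightarrow> 0" unfolding \<epsilon>_def
    by (intro tendsto_divide_0[OF tendsto_const] filterlim_at_top_imp_at_infinity
        filterlim_compose[OF sqrt_at_top] filterlim_real_sequentially)
  have diff0: "(\<lambda>m. \<psi> (\<epsilon> m) m z - of_real (\<omega> * lam (\<epsilon> m) ^ m) * \<phi> (\<epsilon> m) z) \<longlonglongrightarrow> 0"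
  proof (rule LIMSEQ_I)
    fix e :: real assume e: "0 < e"
    have "(\<lambda>j. CA * \<kappa> ^ j) \<longlonglongrightarrow> 0" using \<kappa> by (intro tendsto_mult_right_zero LIMSEQ_power_zero) simp
    then have "\<forall>\<^sub>F j in sequentially. CA * \<kappa> ^ j < e / 2" using e by (intro order_tendstoD) auto
    \<comment> \<open>\<open>j\<close> depends on \<open>e\<close> only and is fixed before
      \<open>m\<close> grows, so the error of the initial steps still tends to 0 with
      \<open>\<epsilon> m\<close>.\<close>
    then obtain j where j: "CA * \<kappa> ^ j < e / 2" by (auto simp: eventually_sequentially)
    have "(\<lambda>m. \<epsilon> m * (M^2 * (4 * real j + 4)) + 7 * M^5 * \<epsilon> m) \<longlonglongrightarrow> 0 * (M^2 * (4 * real j + 4)) + 7 * M^5 * 0"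
      by (intro tendsto_intros \<epsilon>_lim)
    then have "\<forall>\<^sub>F m in sequentially. \<epsilon> m * (M^2 * (4 * real j + 4)) + 7 * M^5 * \<epsilon> m < e / 2"
      using e by (intro order_tendstoD) auto
    moreover have "\<forall>\<^sub>F m in sequentially. real m \<ge> M" 
      using filterlim_real_sequentially by (auto simp: filterlim_at_top)
    moreover have "\<forall>\<^sub>F m in sequentially. j \<le> m" by (rule eventually_ge_at_top)
    ultimately have "\<forall>\<^sub>F m in sequentially. norm (\<psi> (\<epsilon> m) m z - of_real (\<omega> * lam (\<epsilon> m) ^ m) * \<phi> (\<epsilon> m) z - 0) < e"
    proof eventually_elim
      case (elim m)
      have m: "1 \<le> real m" using elim M by linarith
      have e1: "0 \<le> \<epsilon> m" "\<epsilon> m \<le> 1" using m by (auto simp: \<epsilon>_def)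
      have e2: "(\<epsilon> m)^2 = 1 / real m" using m by (simp add: \<epsilon>_def power_divide)
      have "(\<epsilon> m)^2 * M \<le> 1" unfolding e2 using elim m by simp
      note main[OF z e1 this, of j "m - j"]
      moreover have "real (m - j) * (7 * M^5 * \<epsilon> m ^ 3) \<le> 7 * M^5 * \<epsilon> m"
      proof -
        have "\<epsilon> m ^ 3 = \<epsilon> m / real m" using e2 by (simp add: power3_eq_cube power2_eq_square)
        then have "real (m - j) * (7 * M^5 * \<epsilon> m ^ 3) = (real (m - j) / real m) * (7 * M^5 * \<epsilon> m)" by simp
        also have "\<dots> \<le> 1 * (7 * M^5 * \<epsilon> m)" using m e1 M by (intro mult_right_mono) auto
        finally show ?thesis by simp
      qed
      ultimately show ?case using elim j by simp
    qed
    then show "\<exists>no. \<forall>m\<ge>no. norm (\<psi> (\<epsilon> m) m z - of_real (\<omega> * lam (\<epsilon> m) ^ m) * \<phi> (\<epsilon> m) z - 0) < e"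
      by (simp add: eventually_sequentially)
  qed
  have "(\<lambda>m. (1 + (- \<sigma>2 / 2) / real m) ^ m) \<longlonglongrightarrow> exp (- \<sigma>2 / 2)"
    by (rule tendsto_exp_limit_sequentially)
  moreover have "(1 + (- \<sigma>2 / 2) / real m) ^ m = lam (\<epsilon> m) ^ m" for m
    by (simp add: lam_def \<epsilon>_def power_divide mult.commute)
  ultimately have lam_lim: "(\<lambda>m. lam (\<epsilon> m) ^ m) \<longlonglongrightarrow> exp (- \<sigma>2 / 2)" by simp
  have phi: "(\<lambda>m. \<phi> (\<epsilon> m) z) \<longlonglongrightarrow> 1"
  proof -
    have "(\<lambda>m. Complex (1 - (\<epsilon> m)^2 * h z / 2) (\<epsilon> m * g z)) \<longlonglongrightarrow> Complex (1 - 0^2 * h z / 2) (0 * g z)"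
      by (intro tendsto_intros \<epsilon>_lim) auto
    then show ?thesis by (simp add: \<phi>_def one_complex.ctr)
  qed
  have "(\<lambda>m. of_real (\<omega> * lam (\<epsilon> m) ^ m) * \<phi> (\<epsilon> m) z) \<longlonglongrightarrow> of_real (\<omega> * exp (- \<sigma>2 / 2)) * 1"
    by (intro tendsto_intros lam_lim phi)
  from tendsto_add[OF diff0 this] have psi: "(\<lambda>m. \<psi> (\<epsilon> m) m z) \<longlonglongrightarrow> of_real (\<omega> * exp (- \<sigma>2 / 2))"
    by simp
  have "(\<lambda>m. A m z) \<longlonglongrightarrow> \<omega>"
  proof (rule LIM_zero_cancel, rule Lim_null_comparison)
    show "\<forall>\<^sub>F m in sequentially. norm (A m z - \<omega>) \<le> CA * \<kappa> ^ m" using Alim[OF z] by simp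
    show "(\<lambda>m. CA * \<kappa> ^ m) \<longlonglongrightarrow> 0" using \<kappa> by (intro tendsto_mult_right_zero LIMSEQ_power_zero) simp
  qed
  then have "(\<lambda>m. of_real (A m z) :: complex) \<longlonglongrightarrow> of_real \<omega>" by (intro tendsto_intros)
  then have "(\<lambda>m. \<psi> (\<epsilon> m) m z / of_real (A m z)) \<longlonglongrightarrow> of_real (\<omega> * exp (- \<sigma>2 / 2)) / of_real \<omega>"
    using \<omega> by (intro tendsto_divide psi) auto
  then show ?thesis using \<omega> by (simp add: \<psi>_def A_def \<epsilon>_def)
qed

end

section \<open>One step of the carry process\<close>

text \<open>The number of pairs of nonnegative integers whose sum is less than
  \<open>j\<close>.\<close>

definition triangle :: "int \<Rightarrow> real" where
  "triangle j = (if j \<le> 0 then 0 else real_of_int (j * (j + 1)) / 2)"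

text \<open>
  The number of pairs in \<open>{a..b} \<times> {c..d}\<close> with sum at least \<open>k\<close>, by inclusion and exclusion of
  triangles.
\<close>

definition rect_tail :: "int \<Rightarrow> int \<Rightarrow> int \<Rightarrow> int \<Rightarrow> int \<Rightarrow> real" where
  "rect_tail a b c d k = triangle (b + d - k + 1) - triangle (a + d - k) - triangle (b + c - k) + triangle (a + c - k - 1)"

lemma sum_of_bool_interval:
  fixes c d k :: int assumes "c \<le> d + 1"
  shows "(\<Sum>y\<in>{c..d}. of_bool (k \<le> y)) = real_of_int (max 0 (d - k + 1)) - real_of_int (max 0 (c - k))"
proof -
  have "(\<Sum>y\<in>{c..d}. of_bool (k \<le> y)) = real (card {max c k..d})"
    by (subst sum_of_bool_eq)
       (auto intro!: arg_cong[where f=card] simp del: card_atLeastAtMost_int)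
  also have "\<dots> = real_of_int (max 0 (d - k + 1)) - real_of_int (max 0 (c - k))"
    using assms by (auto simp: max_def)
  finally show ?thesis .
qed

lemma tri_max: "triangle (j + 1) = triangle j + real_of_int (max 0 (j + 1))"
proof -
  have "j = -1 \<or> j < -1 \<or> j = 0 \<or> j > 0" by linarith
  then show ?thesis by (auto simp: triangle_def field_simps)
qed

text \<open>Induction on the number of columns: a column contributes a difference of two positive
  parts, and these are increments of triangular numbers. The hypotheses admit an empty rectangle,
  from which the induction starts.\<close>

lemma sum_rect_of_bool:
  fixes a b c d k :: int assumes "a \<le> b + 1" "c \<le> d + 1"
  shows "(\<Sum>x\<in>{a..b}. \<Sum>y\<in>{c..d}. of_bool (k \<le> x + y)) = rect_tail a b c d k"
proof -
  have "\<forall>b. b = a - 1 + int n \<longrightarrow> (\<Sum>x\<in>{a..b}. \<Sum>y\<in>{c..d}. of_bool (k \<le> x + y)) = rect_tail a b c d k" for n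
  proof (induction n)
    case 0
    have "(a - 1) + d - k + 1 = a + d - k" "(a - 1) + c - k = a + c - k - 1" by auto
    then show ?case unfolding rect_tail_def by (auto simp: algebra_simps)
  next
    case (Suc n)
    show ?case
    proof (intro allI impI)
      fix b assume b: "b = a - 1 + int (Suc n)"
      have eq: "{a..b} = insert b {a..b - 1}" using b by auto
      have "(\<Sum>y\<in>{c..d}. of_bool (k \<le> b + y)) = (\<Sum>y\<in>{c..d}. of_bool (k - b \<le> y) :: real)"
        by (simp add: algebra_simps)
      also have "\<dots> = real_of_int (max 0 (d - (k - b) + 1)) - real_of_int (max 0 (c - (k - b)))"
        by (rule sum_of_bool_interval) fact
      finally have 1: "(\<Sum>y\<in>{c..d}. of_bool (k \<le> b + y)) = \<dots>" .
      have b1: "b - 1 = a - 1 + int n" using b by simp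
      have 2: "(\<Sum>x\<in>{a..b - 1}. \<Sum>y\<in>{c..d}. of_bool (k \<le> x + y)) = rect_tail a (b - 1) c d k"
        using Suc.IH b1 by blast
      show "(\<Sum>x\<in>{a..b}. \<Sum>y\<in>{c..d}. of_bool (k \<le> x + y)) = rect_tail a b c d k"
        using tri_max[of "b + d - k"] tri_max[of "b + c - k - 1"]
        unfolding eq by (simp add: 1 1[unfolded add.commute[of b]] 2 rect_tail_def algebra_simps del: sum_of_bool_eq)
    qed
  qed
  from this[of "nat (b - a + 1)"] assms show ?thesis by auto
qed

text \<open>For a fixed class of the old \<open>a\<close>, the next carry and the new class are
  jointly piecewise constant in the digit sum, with at most four thresholds; five values therefore
  describe any function of the two.\<close>

definition step_fun :: "int \<Rightarrow> int \<Rightarrow> int \<Rightarrow> int \<Rightarrow> real \<Rightarrow> real \<Rightarrow> real \<Rightarrow> real \<Rightarrow> real \<Rightarrow> int \<Rightarrow> real" where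
  "step_fun k1 k2 k3 k4 v0 v1 v2 v3 v4 s =
     (if s < k1 then v0 else if s < k2 then v1 else if s < k3 then v2 else if s < k4 then v3 else v4)"

lemma sum_rect_step:
  fixes a b c d :: int
  assumes "a \<le> b + 1" "c \<le> d + 1" "k1 \<le> k2" "k2 \<le> k3" "k3 \<le> k4"
  shows "(\<Sum>x\<in>{a..b}. \<Sum>y\<in>{c..d}. step_fun k1 k2 k3 k4 v0 v1 v2 v3 v4 (x + y)) =
    v0 * (real_of_int (b - a + 1) * real_of_int (d - c + 1)) + (v1 - v0) * rect_tail a b c d k1
    + (v2 - v1) * rect_tail a b c d k2 + (v3 - v2) * rect_tail a b c d k3 + (v4 - v3) * rect_tail a b c d k4"
proof -
  have "step_fun k1 k2 k3 k4 v0 v1 v2 v3 v4 s = v0 + (v1 - v0) * of_bool (k1 \<le> s)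
    + (v2 - v1) * of_bool (k2 \<le> s) + (v3 - v2) * of_bool (k3 \<le> s) + (v4 - v3) * of_bool (k4 \<le> s)" for s
    using assms by (auto simp: step_fun_def)
  then show ?thesis
    using assms
    by (simp add: sum.distrib sum_distrib_left[symmetric] sum_rect_of_bool mult.assoc del: sum_of_bool_eq)
qed

text \<open>
  The weights \<open>1\<close> (for \<open>\<bar>x\<bar> = q/2\<close>) and \<open>2\<close> form the Perron eigenvector, with eigenvalue \<open>q\<close>, of the
  syntactical rule. From now on \<open>h\<close> stands for \<open>q/2\<close>.
\<close>

definition digit_weight :: "int \<Rightarrow> int \<Rightarrow> real" where
  "digit_weight h x = (if \<bar>x\<bar> = h then 1 else 2)"

definition allowed :: "int \<Rightarrow> int \<Rightarrow> int \<Rightarrow> bool" where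
  "allowed h p x \<longleftrightarrow> (\<bar>p\<bar> = h \<longrightarrow> sgn p * x \<in> {0..h - 1})"

text \<open>The Doob transform of the 0/1 matrix of \<open>allowed\<close>. Along a word the weights
  telescope, so that after a given digit all admissible words of the same length with the same last
  digit are equally likely.\<close>

definition digit_prob :: "int \<Rightarrow> int \<Rightarrow> int \<Rightarrow> real" where
  "digit_prob h p x = (if allowed h p x then digit_weight h x / (2 * real_of_int h * digit_weight h p) else 0)"

lemma digits_split:
  fixes h :: int assumes "h \<ge> 1"
  shows "{- h..h} = insert h (insert (- h) {- (h - 1)..h - 1})"
  using assms by auto

text \<open>All that the syntactical rule remembers of a digit: the sign if it is
  \<open>\<plusminus>q/2\<close>, and 0 for an inner digit.\<close>

definition bsgn :: "int \<Rightarrow> int \<Rightarrow> int" where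
  "bsgn h x = (if \<bar>x\<bar> = h then sgn x else 0)"

text \<open>\<open>G\<close> receives the type of the digit as a separate argument, so that the
  inner digits form a sum over an interval with constant type. Each of the digits
  \<open>\<plusminus>q/2\<close> is half as likely as an inner one.\<close>

lemma sum_digit_prob_interior:
  fixes G :: "int \<Rightarrow> int \<Rightarrow> real"
  assumes "h \<ge> 1" "\<bar>p\<bar> < h"
  shows "(\<Sum>x\<in>{- h..h}. digit_prob h p x * G (bsgn h x) x) =
    ((G 1 h + G (-1) (- h)) / 2 + (\<Sum>x\<in>{- (h - 1)..h - 1}. G 0 x)) / (2 * real_of_int h)"
proof -
  have "(\<Sum>x\<in>{- h..h}. digit_prob h p x * G (bsgn h x) x) = G 1 h / (4 * real_of_int h) + G (-1) (- h) / (4 * real_of_int h) +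
     (\<Sum>x\<in>{- (h - 1)..h - 1}. digit_prob h p x * G (bsgn h x) x)"
    using assms unfolding digits_split[OF assms(1)]
    by (subst sum.insert) (auto simp: digit_prob_def allowed_def digit_weight_def bsgn_def)
  also have "(\<Sum>x\<in>{- (h - 1)..h - 1}. digit_prob h p x * G (bsgn h x) x) = (\<Sum>x\<in>{- (h - 1)..h - 1}. G 0 x / (2 * real_of_int h))"
    using assms by (intro sum.cong) (auto simp: digit_prob_def allowed_def digit_weight_def bsgn_def)
  finally show ?thesis by (simp add: sum_divide_distrib add_divide_distrib)
qed

lemma sum_digit_prob_pos:
  fixes G :: "int \<Rightarrow> int \<Rightarrow> real"
  assumes "h \<ge> 1"
  shows "(\<Sum>x\<in>{- h..h}. digit_prob h h x * G (bsgn h x) x) = (\<Sum>x\<in>{0..h - 1}. G 0 x) / real_of_int h"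
proof -
  have "(\<Sum>x\<in>{- h..h}. digit_prob h h x * G (bsgn h x) x) = (\<Sum>x\<in>{0..h - 1}. digit_prob h h x * G (bsgn h x) x)"
    using assms by (intro sum.mono_neutral_right) (auto simp: digit_prob_def allowed_def)
  also have "\<dots> = (\<Sum>x\<in>{0..h - 1}. G 0 x / real_of_int h)"
    using assms by (intro sum.cong) (auto simp: digit_prob_def allowed_def digit_weight_def bsgn_def)
  finally show ?thesis by (simp add: sum_divide_distrib)
qed

lemma sum_digit_prob_neg:
  fixes G :: "int \<Rightarrow> int \<Rightarrow> real"
  assumes "h \<ge> 1"
  shows "(\<Sum>x\<in>{- h..h}. digit_prob h (- h) x * G (bsgn h x) x) = (\<Sum>x\<in>{- (h - 1)..0}. G 0 x) / real_of_int h"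
proof -
  have "(\<Sum>x\<in>{- h..h}. digit_prob h (- h) x * G (bsgn h x) x) = (\<Sum>x\<in>{- (h - 1)..0}. digit_prob h (- h) x * G (bsgn h x) x)"
    using assms by (intro sum.mono_neutral_right) (auto simp: digit_prob_def allowed_def)
  also have "\<dots> = (\<Sum>x\<in>{- (h - 1)..0}. G 0 x / real_of_int h)"
    using assms by (intro sum.cong) (auto simp: digit_prob_def allowed_def digit_weight_def bsgn_def)
  finally show ?thesis by (simp add: sum_divide_distrib)
qed

section \<open>Expectations over the next pair of digits\<close>

definition rect_sum :: "int \<Rightarrow> int \<Rightarrow> int \<Rightarrow> int \<Rightarrow> (int \<Rightarrow> real) \<Rightarrow> real" where
  "rect_sum a b c d f = (\<Sum>x\<in>{a..b}. \<Sum>y\<in>{c..d}. f (x + y))"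

definition pair_sum :: "int \<Rightarrow> int \<Rightarrow> int \<Rightarrow> (int \<Rightarrow> int \<Rightarrow> int \<Rightarrow> real) \<Rightarrow> real" where
  "pair_sum h p p' F =
     (\<Sum>x\<in>{- h..h}. \<Sum>y\<in>{- h..h}. digit_prob h p x * digit_prob h p' y * F (bsgn h x) (bsgn h y) (x + y))"

lemma pair_sum_iterated:
  "pair_sum h p p' F =
     (\<Sum>x\<in>{- h..h}. digit_prob h p x * (\<lambda>e x. \<Sum>y\<in>{- h..h}. digit_prob h p' y * F e (bsgn h y) (x + y)) (bsgn h x) x)"
  by (simp add: pair_sum_def sum_distrib_left mult.assoc)

lemma pair_sum_interior_interior:
  assumes "h \<ge> 1" "\<bar>p\<bar> < h" "\<bar>p'\<bar> < h"
  shows "pair_sum h p p' F =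
      ((F 1 1 (2*h) + F 1 (-1) 0 + F (-1) 1 0 + F (-1) (-1) (-2*h)) / 4
      + (rect_sum h h (-(h-1)) (h-1) (F 1 0) + rect_sum (-h) (-h) (-(h-1)) (h-1) (F (-1) 0)
       + rect_sum (-(h-1)) (h-1) h h (F 0 1) + rect_sum (-(h-1)) (h-1) (-h) (-h) (F 0 (-1))) / 2
      + rect_sum (-(h-1)) (h-1) (-(h-1)) (h-1) (F 0 0)) / (4 * real_of_int h ^ 2)"
proof -
  have 1: "(\<Sum>y\<in>{- h..h}. digit_prob h p' y * F e (bsgn h y) (x + y)) =
    ((F e 1 (x + h) + F e (-1) (x - h)) / 2 + (\<Sum>y\<in>{- (h - 1)..h - 1}. F e 0 (x + y))) / (2 * real_of_int h)" for e x
    using sum_digit_prob_interior[OF assms(1,3), of "\<lambda>e' y. F e e' (x + y)"] by simp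
  show ?thesis unfolding pair_sum_iterated
      sum_digit_prob_interior[OF assms(1,2), of "\<lambda>e x. \<Sum>y\<in>{- h..h}. digit_prob h p' y * F e (bsgn h y) (x + y)"]
    unfolding 1
    using assms(1)
    by (simp add: rect_sum_def sum.distrib sum_divide_distrib[symmetric] sum_distrib_left[symmetric] field_simps power2_eq_square)
qed

lemma pair_sum_interior_pos:
  assumes "h \<ge> 1" "\<bar>p\<bar> < h"
  shows "pair_sum h p h F =
      ((rect_sum h h 0 (h-1) (F 1 0) + rect_sum (-h) (-h) 0 (h-1) (F (-1) 0)) / 2
      + rect_sum (-(h-1)) (h-1) 0 (h-1) (F 0 0)) / (2 * real_of_int h ^ 2)"
proof -
  have 1: "(\<Sum>y\<in>{- h..h}. digit_prob h h y * F e (bsgn h y) (x + y)) =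
    (\<Sum>y\<in>{0..h - 1}. F e 0 (x + y)) / real_of_int h" for e x
    using sum_digit_prob_pos[OF assms(1), of "\<lambda>e' y. F e e' (x + y)"] by simp
  show ?thesis unfolding pair_sum_iterated
      sum_digit_prob_interior[OF assms(1,2), of "\<lambda>e x. \<Sum>y\<in>{- h..h}. digit_prob h h y * F e (bsgn h y) (x + y)"]
    unfolding 1
    using assms(1)
    by (simp add: rect_sum_def sum.distrib sum_divide_distrib[symmetric] sum_distrib_left[symmetric] field_simps power2_eq_square)
qed

lemma pair_sum_pos_pos:
  assumes "h \<ge> 1"
  shows "pair_sum h h h F = rect_sum 0 (h-1) 0 (h-1) (F 0 0) / real_of_int h ^ 2"
proof -
  have 1: "(\<Sum>y\<in>{- h..h}. digit_prob h h y * F e (bsgn h y) (x + y)) =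
    (\<Sum>y\<in>{0..h - 1}. F e 0 (x + y)) / real_of_int h" for e x
    using sum_digit_prob_pos[OF assms(1), of "\<lambda>e' y. F e e' (x + y)"] by simp
  show ?thesis unfolding pair_sum_iterated
      sum_digit_prob_pos[OF assms(1), of "\<lambda>e x. \<Sum>y\<in>{- h..h}. digit_prob h h y * F e (bsgn h y) (x + y)"]
    unfolding 1
    using assms(1)
    by (simp add: rect_sum_def sum.distrib sum_divide_distrib[symmetric] sum_distrib_left[symmetric] field_simps power2_eq_square)
qed

lemma pair_sum_pos_neg:
  assumes "h \<ge> 1"
  shows "pair_sum h h (-h) F = rect_sum 0 (h-1) (-(h-1)) 0 (F 0 0) / real_of_int h ^ 2"
proof -
  have 1: "(\<Sum>y\<in>{- h..h}. digit_prob h (-h) y * F e (bsgn h y) (x + y)) =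
    (\<Sum>y\<in>{-(h-1)..0}. F e 0 (x + y)) / real_of_int h" for e x
    using sum_digit_prob_neg[OF assms(1), of "\<lambda>e' y. F e e' (x + y)"] by simp
  show ?thesis unfolding pair_sum_iterated
      sum_digit_prob_pos[OF assms(1), of "\<lambda>e x. \<Sum>y\<in>{- h..h}. digit_prob h (-h) y * F e (bsgn h y) (x + y)"]
    unfolding 1
    using assms(1)
    by (simp add: rect_sum_def sum.distrib sum_divide_distrib[symmetric] sum_distrib_left[symmetric] field_simps power2_eq_square)
qed

text \<open>Exchange of the summands and, below, negation reduce the nine combinations of types to
  the four computed above.\<close>

lemma pair_sum_swap:
  "pair_sum h p' p F = pair_sum h p p' (\<lambda>e e' s. F e' e s)"
  unfolding pair_sum_def by (subst sum.swap) (simp add: mult_ac add.commute)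

lemma digit_prob_uminus: "digit_prob h (- p) (- x) = digit_prob h p x"
  by (simp add: digit_prob_def allowed_def digit_weight_def sgn_if)

lemma pair_sum_uminus:
  "pair_sum h (- p) (- p') F = pair_sum h p p' (\<lambda>e e' s. F (- e) (- e') (- s))"
proof -
  have r: "(\<Sum>x\<in>{- h..h}. f x) = (\<Sum>x\<in>{- h..h}. f (- x))" for f :: "int \<Rightarrow> real"
    by (rule sum.reindex_bij_witness[of _ uminus uminus]) auto
  have "bsgn h (- x) = - bsgn h x" for x by (simp add: bsgn_def sgn_if)
  then show ?thesis unfolding pair_sum_def
    by (subst r, subst (2) r) (simp add: digit_prob_uminus)
qed

text \<open>
  The next carry depends on \<open>a\<close> only through its class; the classes \<open>1\<close> and \<open>-1\<close> are those in which
  the carry is still pending until the next digit sum is known.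
\<close>

definition carry_class :: "int \<Rightarrow> int \<Rightarrow> int" where
  "carry_class h a = (if h < a then 2 else if a = h then 1 else if - h < a then 0 else if a = - h then - 1 else - 2)"

text \<open>The transition operator at the state \<open>(x, y, a)\<close>, applied to a function of
  the carry just decided, the types of the two new digits and the class of the new
  \<open>a\<close>.\<close>

definition step_sum :: "int \<Rightarrow> int \<Rightarrow> int \<Rightarrow> int \<Rightarrow> (int \<Rightarrow> int \<Rightarrow> int \<Rightarrow> int \<Rightarrow> real) \<Rightarrow> real" where
  "step_sum h x y a \<Psi> = pair_sum h x y
     (\<lambda>e e' s. \<Psi> (next_carry (2 * h) a s) e e' (carry_class h (s + next_carry (2 * h) a s)))"

lemma next_carry_uminus: "next_carry q (- a) (- t) = - next_carry q a t" if "q \<ge> 2"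
  using that by (auto simp: next_carry_def)

lemma carry_class_uminus: "h \<ge> 1 \<Longrightarrow> carry_class h (- a) = - carry_class h a"
  by (auto simp: carry_class_def)

lemma step_sum_swap: "step_sum h y x a \<Psi> = step_sum h x y a (\<lambda>c e e' k. \<Psi> c e' e k)"
  unfolding step_sum_def by (rule pair_sum_swap)

lemma step_sum_uminus:
  assumes "h \<ge> 1"
  shows "step_sum h (- x) (- y) (- a) \<Psi> = step_sum h x y a (\<lambda>c e e' k. \<Psi> (- c) (- e) (- e') (- k))"
proof -
  have "carry_class h (- s - next_carry (2 * h) a s) = - carry_class h (s + next_carry (2 * h) a s)" for s
    using carry_class_uminus[OF assms, of "s + next_carry (2 * h) a s"] by simp
  then show ?thesis
    unfolding step_sum_def using assms by (subst pair_sum_uminus) (simp add: next_carry_uminus)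
qed

section \<open>Next carry and new class as step functions of the digit sum\<close>

lemma carry_step_mid:
  assumes "h \<ge> 1" "\<bar>a\<bar> < h"
  shows "\<Phi> (next_carry (2 * h) a s) (carry_class h (s + next_carry (2 * h) a s)) =
    step_fun (- h) (1 - h) h (h + 1) (\<Phi> 0 (-2)) (\<Phi> 0 (-1)) (\<Phi> 0 0) (\<Phi> 0 1) (\<Phi> 0 2) s"
  using assms by (auto simp: next_carry_def carry_class_def step_fun_def)

lemma carry_step_top:
  assumes "h \<ge> 1" "h < a"
  shows "\<Phi> (next_carry (2 * h) a s) (carry_class h (s + next_carry (2 * h) a s)) =
    step_fun (- h - 1) (- h) (h - 1) h (\<Phi> 1 (-2)) (\<Phi> 1 (-1)) (\<Phi> 1 0) (\<Phi> 1 1) (\<Phi> 1 2) s"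
  using assms by (auto simp: next_carry_def carry_class_def step_fun_def)

text \<open>The thresholds are those of the look-ahead rule itself. None of the five values has
  class 1 or -1: a pending carry is always resolved in such a way that the next one is not
  pending.\<close>

lemma carry_step_pending:
  assumes "h \<ge> 1"
  shows "\<Phi> (next_carry (2 * h) h s) (carry_class h (s + next_carry (2 * h) h s)) =
    step_fun (- h) 0 h (2 * h) (\<Phi> 0 (-2)) (\<Phi> 1 0) (\<Phi> 0 0) (\<Phi> 1 2) (\<Phi> 0 2) s"
  using assms by (auto simp: next_carry_def carry_class_def step_fun_def)

section \<open>Transition counts between types and classes\<close>

lemma rect_step:
  fixes a b c d :: int
  assumes "a \<le> b + 1" "c \<le> d + 1" "k1 \<le> k2" "k2 \<le> k3" "k3 \<le> k4"
  shows "rect_sum a b c d (step_fun k1 k2 k3 k4 v0 v1 v2 v3 v4) =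
    v0 * (real_of_int (b - a + 1) * real_of_int (d - c + 1)) + (v1 - v0) * rect_tail a b c d k1
    + (v2 - v1) * rect_tail a b c d k2 + (v3 - v2) * rect_tail a b c d k3 + (v4 - v3) * rect_tail a b c d k4"
  unfolding rect_sum_def using assms by (rule sum_rect_step)

text \<open>The polynomial vanishes at -1 as well as at 0; this makes arguments such as
  \<open>h - 2\<close> admissible for \<open>h = 1\<close>.\<close>

lemma triangle_poly: "- 1 \<le> j \<Longrightarrow> triangle j = real_of_int j * (real_of_int j + 1) / 2"
  by (cases "j = - 1") (auto simp: triangle_def)

lemma triangle_zero: "j \<le> 0 \<Longrightarrow> triangle j = 0"
  by (simp add: triangle_def)

text \<open>In the names of these rows, \<open>mid\<close>, \<open>top\<close> and
  \<open>bot\<close> stand for an inner digit, \<open>q/2\<close> and \<open>-q/2\<close>; the index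
  at the end, where present, is the class of \<open>a\<close>. The right-hand sides involve
  \<open>x\<close>, \<open>y\<close> and \<open>a\<close> through these data only, so the chain can
  be lumped; the coefficients over \<open>16 * H^2 = 4 * q^2\<close> are its transition
  probabilities.\<close>

lemma step_sum_mid_mid_0:
  fixes h :: int
  assumes "h \<ge> 1" "\<bar>x\<bar> < h" "\<bar>y\<bar> < h" "\<bar>a\<bar> < h"
  defines "H \<equiv> real_of_int h"
  shows "step_sum h x y a \<Psi> =
    ((1) * \<Psi> 0 (-1) (-1) (-2)
      + (2*H - 2) * \<Psi> 0 (-1) 0 (-2)
      + (2) * \<Psi> 0 (-1) 0 (-1)
      + (2*H - 2) * \<Psi> 0 (-1) 0 0
      + (1) * \<Psi> 0 (-1) 1 0
      + (2*H - 2) * \<Psi> 0 0 (-1) (-2)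
      + (2) * \<Psi> 0 0 (-1) (-1)
      + (2*H - 2) * \<Psi> 0 0 (-1) 0
      + (2*H^2 - 6*H + 4) * \<Psi> 0 0 0 (-2)
      + (4*H - 4) * \<Psi> 0 0 0 (-1)
      + (12*H^2 - 12*H + 4) * \<Psi> 0 0 0 0
      + (4*H - 4) * \<Psi> 0 0 0 1
      + (2*H^2 - 6*H + 4) * \<Psi> 0 0 0 2
      + (2*H - 2) * \<Psi> 0 0 1 0
      + (2) * \<Psi> 0 0 1 1
      + (2*H - 2) * \<Psi> 0 0 1 2
      + (1) * \<Psi> 0 1 (-1) 0
      + (2*H - 2) * \<Psi> 0 1 0 0
      + (2) * \<Psi> 0 1 0 1
      + (2*H - 2) * \<Psi> 0 1 0 2
      + (1) * \<Psi> 0 1 1 2) / (16 * H^2)"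
proof -
  have h: "h \<ge> 1" and H: "H \<ge> 1" using assms by auto
  have *: "\<Psi> (next_carry (2 * h) a s) e e' (carry_class h (s + next_carry (2 * h) a s)) = step_fun (- h) (1 - h) h (h + 1) (\<Psi> 0 e e' (-2)) (\<Psi> 0 e e' (-1)) (\<Psi> 0 e e' 0) (\<Psi> 0 e e' 1) (\<Psi> 0 e e' 2) s" for s e e'
    using carry_step_mid[of h a "\<lambda>c. \<Psi> c e e'"] assms by simp
  show ?thesis
    unfolding step_sum_def * using assms
    apply (simp add: pair_sum_interior_interior rect_step)
    apply (simp add: step_fun_def rect_tail_def triangle_poly triangle_zero H_def[symmetric])
    using H by (simp add: field_simps power2_eq_square)
qed

lemma step_sum_mid_mid_1:
  fixes h :: int
  assumes "h \<ge> 1" "\<bar>x\<bar> < h" "\<bar>y\<bar> < h"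
  defines "H \<equiv> real_of_int h"
  shows "step_sum h x y h \<Psi> =
    ((1) * \<Psi> 0 (-1) (-1) (-2)
      + (2*H - 2) * \<Psi> 0 (-1) 0 (-2)
      + (1) * \<Psi> 0 (-1) 1 0
      + (2*H - 2) * \<Psi> 0 0 (-1) (-2)
      + (2*H^2 - 6*H + 4) * \<Psi> 0 0 0 (-2)
      + (6*H^2 - 2*H) * \<Psi> 0 0 0 0
      + (2*H - 2) * \<Psi> 0 0 1 0
      + (1) * \<Psi> 0 1 (-1) 0
      + (2*H - 2) * \<Psi> 0 1 0 0
      + (1) * \<Psi> 0 1 1 2
      + (2*H) * \<Psi> 1 (-1) 0 0
      + (2*H) * \<Psi> 1 0 (-1) 0
      + (6*H^2 - 6*H) * \<Psi> 1 0 0 0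
      + (2*H^2 - 2*H) * \<Psi> 1 0 0 2
      + (2*H) * \<Psi> 1 0 1 2
      + (2*H) * \<Psi> 1 1 0 2) / (16 * H^2)"
proof -
  have h: "h \<ge> 1" and H: "H \<ge> 1" using assms by auto
  have *: "\<Psi> (next_carry (2 * h) h s) e e' (carry_class h (s + next_carry (2 * h) h s)) = step_fun (- h) 0 h (2 * h) (\<Psi> 0 e e' (-2)) (\<Psi> 1 e e' 0) (\<Psi> 0 e e' 0) (\<Psi> 1 e e' 2) (\<Psi> 0 e e' 2) s" for s e e'
    using carry_step_pending[of h "\<lambda>c. \<Psi> c e e'"] assms by simp
  show ?thesis
    unfolding step_sum_def * using assms
    apply (simp add: pair_sum_interior_interior rect_step)
    apply (simp add: step_fun_def rect_tail_def triangle_poly triangle_zero H_def[symmetric])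
    using H by (simp add: field_simps power2_eq_square)
qed

text \<open>The formula really needs \<open>h \<ge> 2\<close>: for \<open>h = 1\<close> the only
  pair of inner digits has sum 0, whereas the polynomial \<open>2*H^2 - 10*H + 12\<close> takes the
  value 4 there and some other coefficients are negative.\<close>

lemma step_sum_mid_mid_2:
  fixes h :: int
  assumes "h \<ge> 2" "\<bar>x\<bar> < h" "\<bar>y\<bar> < h" "h < a"
  defines "H \<equiv> real_of_int h"
  shows "step_sum h x y a \<Psi> =
    ((1) * \<Psi> 1 (-1) (-1) (-2)
      + (2*H - 4) * \<Psi> 1 (-1) 0 (-2)
      + (2) * \<Psi> 1 (-1) 0 (-1)
      + (2*H) * \<Psi> 1 (-1) 0 0
      + (1) * \<Psi> 1 (-1) 1 0
      + (2*H - 4) * \<Psi> 1 0 (-1) (-2)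
      + (2) * \<Psi> 1 0 (-1) (-1)
      + (2*H) * \<Psi> 1 0 (-1) 0
      + (2*H^2 - 10*H + 12) * \<Psi> 1 0 0 (-2)
      + (4*H - 8) * \<Psi> 1 0 0 (-1)
      + (12*H^2 - 12*H) * \<Psi> 1 0 0 0
      + (4*H) * \<Psi> 1 0 0 1
      + (2*H^2 - 2*H) * \<Psi> 1 0 0 2
      + (2*H - 4) * \<Psi> 1 0 1 0
      + (2) * \<Psi> 1 0 1 1
      + (2*H) * \<Psi> 1 0 1 2
      + (1) * \<Psi> 1 1 (-1) 0
      + (2*H - 4) * \<Psi> 1 1 0 0
      + (2) * \<Psi> 1 1 0 1
      + (2*H) * \<Psi> 1 1 0 2
      + (1) * \<Psi> 1 1 1 2) / (16 * H^2)"
proof -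
  have h: "h \<ge> 1" and H: "H \<ge> 1" using assms by auto
  have *: "\<Psi> (next_carry (2 * h) a s) e e' (carry_class h (s + next_carry (2 * h) a s)) = step_fun (- h - 1) (- h) (h - 1) h (\<Psi> 1 e e' (-2)) (\<Psi> 1 e e' (-1)) (\<Psi> 1 e e' 0) (\<Psi> 1 e e' 1) (\<Psi> 1 e e' 2) s" for s e e'
    using carry_step_top[of h a "\<lambda>c. \<Psi> c e e'"] assms by simp
  show ?thesis
    unfolding step_sum_def * using assms
    apply (simp add: pair_sum_interior_interior rect_step)
    apply (simp add: step_fun_def rect_tail_def triangle_poly triangle_zero H_def[symmetric])
    using H by (simp add: field_simps power2_eq_square)
qed

lemma step_sum_mid_top_0:
  fixes h :: int
  assumes "h \<ge> 1" "\<bar>x\<bar> < h" "\<bar>a\<bar> < h"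
  defines "H \<equiv> real_of_int h"
  shows "step_sum h x h a \<Psi> =
    ((4) * \<Psi> 0 (-1) 0 (-1)
      + (4*H - 4) * \<Psi> 0 (-1) 0 0
      + (12*H^2 - 4*H) * \<Psi> 0 0 0 0
      + (8*H - 8) * \<Psi> 0 0 0 1
      + (4*H^2 - 12*H + 8) * \<Psi> 0 0 0 2
      + (4) * \<Psi> 0 1 0 1
      + (4*H - 4) * \<Psi> 0 1 0 2) / (16 * H^2)"
proof -
  have h: "h \<ge> 1" and H: "H \<ge> 1" using assms by auto
  have *: "\<Psi> (next_carry (2 * h) a s) e e' (carry_class h (s + next_carry (2 * h) a s)) = step_fun (- h) (1 - h) h (h + 1) (\<Psi> 0 e e' (-2)) (\<Psi> 0 e e' (-1)) (\<Psi> 0 e e' 0) (\<Psi> 0 e e' 1) (\<Psi> 0 e e' 2) s" for s e e'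
    using carry_step_mid[of h a "\<lambda>c. \<Psi> c e e'"] assms by simp
  show ?thesis
    unfolding step_sum_def * using assms
    apply (simp add: pair_sum_interior_pos rect_step)
    apply (simp add: step_fun_def rect_tail_def triangle_poly triangle_zero H_def[symmetric])
    using H by (simp add: field_simps power2_eq_square)
qed

lemma step_sum_mid_top_1:
  fixes h :: int
  assumes "h \<ge> 1" "\<bar>x\<bar> < h"
  defines "H \<equiv> real_of_int h"
  shows "step_sum h x h h \<Psi> =
    ((8*H^2) * \<Psi> 0 0 0 0
      + (4*H) * \<Psi> 1 (-1) 0 0
      + (4*H^2 - 4*H) * \<Psi> 1 0 0 0
      + (4*H^2 - 4*H) * \<Psi> 1 0 0 2
      + (4*H) * \<Psi> 1 1 0 2) / (16 * H^2)"
proof -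
  have h: "h \<ge> 1" and H: "H \<ge> 1" using assms by auto
  have *: "\<Psi> (next_carry (2 * h) h s) e e' (carry_class h (s + next_carry (2 * h) h s)) = step_fun (- h) 0 h (2 * h) (\<Psi> 0 e e' (-2)) (\<Psi> 1 e e' 0) (\<Psi> 0 e e' 0) (\<Psi> 1 e e' 2) (\<Psi> 0 e e' 2) s" for s e e'
    using carry_step_pending[of h "\<lambda>c. \<Psi> c e e'"] assms by simp
  show ?thesis
    unfolding step_sum_def * using assms
    apply (simp add: pair_sum_interior_pos rect_step)
    apply (simp add: step_fun_def rect_tail_def triangle_poly triangle_zero H_def[symmetric])
    using H by (simp add: field_simps power2_eq_square)
qed

lemma step_sum_mid_top_2:
  fixes h :: int
  assumes "h \<ge> 1" "\<bar>x\<bar> < h" "h < a"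
  defines "H \<equiv> real_of_int h"
  shows "step_sum h x h a \<Psi> =
    ((4*H) * \<Psi> 1 (-1) 0 0
      + (12*H^2 - 12*H) * \<Psi> 1 0 0 0
      + (8*H) * \<Psi> 1 0 0 1
      + (4*H^2 - 4*H) * \<Psi> 1 0 0 2
      + (4*H) * \<Psi> 1 1 0 2) / (16 * H^2)"
proof -
  have h: "h \<ge> 1" and H: "H \<ge> 1" using assms by auto
  have *: "\<Psi> (next_carry (2 * h) a s) e e' (carry_class h (s + next_carry (2 * h) a s)) = step_fun (- h - 1) (- h) (h - 1) h (\<Psi> 1 e e' (-2)) (\<Psi> 1 e e' (-1)) (\<Psi> 1 e e' 0) (\<Psi> 1 e e' 1) (\<Psi> 1 e e' 2) s" for s e e'
    using carry_step_top[of h a "\<lambda>c. \<Psi> c e e'"] assms by simp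
  show ?thesis
    unfolding step_sum_def * using assms
    apply (simp add: pair_sum_interior_pos rect_step)
    apply (simp add: step_fun_def rect_tail_def triangle_poly triangle_zero H_def[symmetric])
    using H by (simp add: field_simps power2_eq_square)
qed

lemma step_sum_top_top:
  fixes h :: int
  assumes "h \<ge> 1" "h < a"
  defines "H \<equiv> real_of_int h"
  shows "step_sum h h h a \<Psi> =
    ((8*H^2 - 8*H) * \<Psi> 1 0 0 0
      + (16*H) * \<Psi> 1 0 0 1
      + (8*H^2 - 8*H) * \<Psi> 1 0 0 2) / (16 * H^2)"
proof -
  have h: "h \<ge> 1" and H: "H \<ge> 1" using assms by auto
  have *: "\<Psi> (next_carry (2 * h) a s) e e' (carry_class h (s + next_carry (2 * h) a s)) = step_fun (- h - 1) (- h) (h - 1) h (\<Psi> 1 e e' (-2)) (\<Psi> 1 e e' (-1)) (\<Psi> 1 e e' 0) (\<Psi> 1 e e' 1) (\<Psi> 1 e e' 2) s" for s e e'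
    using carry_step_top[of h a "\<lambda>c. \<Psi> c e e'"] assms by simp
  show ?thesis
    unfolding step_sum_def * using assms
    apply (simp add: pair_sum_pos_pos rect_step)
    apply (simp add: step_fun_def rect_tail_def triangle_poly triangle_zero H_def[symmetric])
    using H by (simp add: field_simps power2_eq_square)
qed

lemma step_sum_top_bot:
  fixes h :: int
  assumes "h \<ge> 1" "\<bar>a\<bar> < h"
  defines "H \<equiv> real_of_int h"
  shows "step_sum h h (- h) a \<Psi> =
    ((16*H^2) * \<Psi> 0 0 0 0) / (16 * H^2)"
proof -
  have h: "h \<ge> 1" and H: "H \<ge> 1" using assms by auto
  have *: "\<Psi> (next_carry (2 * h) a s) e e' (carry_class h (s + next_carry (2 * h) a s)) = step_fun (- h) (1 - h) h (h + 1) (\<Psi> 0 e e' (-2)) (\<Psi> 0 e e' (-1)) (\<Psi> 0 e e' 0) (\<Psi> 0 e e' 1) (\<Psi> 0 e e' 2) s" for s e e'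
    using carry_step_mid[of h a "\<lambda>c. \<Psi> c e e'"] assms by simp
  show ?thesis
    unfolding step_sum_def * using assms
    apply (simp add: pair_sum_pos_neg rect_step)
    apply (simp add: step_fun_def rect_tail_def triangle_poly triangle_zero H_def[symmetric])
    using H by (simp add: field_simps power2_eq_square)
qed

section \<open>Solutions of the Poisson equations\<close>

text \<open>
  The last two lines matter for \<open>h = 1\<close> only: they exclude classes that would be compatible with
  \<open>\<bar>a - (x + y)\<bar> \<le> 1\<close>. Two inner digits with \<open>\<bar>a\<bar> > h\<close> are impossible for \<open>h = 1\<close>, which is why the
  polynomial transition counts above remain valid for \<open>q = 2\<close>.
\<close>

definition reach :: "int \<Rightarrow> int \<Rightarrow> int \<Rightarrow> int \<Rightarrow> bool" where
  "reach h x y a \<longleftrightarrow> - h \<le> x \<and> x \<le> h \<and> - h \<le> y \<and> y \<le> h \<and> x + y - 1 \<le> a \<and> a \<le> x + y + 1 \<and>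
     (x = h \<and> y = h \<longrightarrow> h < a) \<and> (x = - h \<and> y = - h \<longrightarrow> a < - h) \<and>
     (x = h \<and> y = - h \<or> x = - h \<and> y = h \<longrightarrow> - h < a \<and> a < h)"

lemma next_carry_cases: "next_carry q a t = -1 \<or> next_carry q a t = 0 \<or> next_carry q a t = 1"
  by (simp add: next_carry_def)

text \<open>A carry moves \<open>a\<close> by at most 1, which settles the excluded classes for
  \<open>h \<ge> 2\<close>. For \<open>h = 1\<close> two new digits \<open>\<plusminus>1\<close>
  force both old digits to be 0, hence \<open>\<bar>a\<bar> \<le> 1\<close>, and with a new digit
  sum in \<open>{-2, 0, 2}\<close> the carry is then 0.\<close>

lemma reach_step:
  assumes "h \<ge> 1" "reach h x y a" "- h \<le> x'" "x' \<le> h" "- h \<le> y'" "y' \<le> h" "allowed h x x'" "allowed h y y'"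
  shows "reach h x' y' (x' + y' + next_carry (2 * h) a (x' + y'))"
proof -
  note c = next_carry_cases[of "2 * h" a "x' + y'"]
  have *: "next_carry (2 * h) a (x' + y') = 0" if "h = 1" "x' = 1 \<or> x' = - 1" "y' = 1 \<or> y' = - 1"
  proof -
    have "x = 0" "y = 0"
      using assms(2,7,8) that by (auto simp: reach_def allowed_def sgn_if split: if_splits)
    then have "a = -1 \<or> a = 0 \<or> a = 1" using assms(2) by (simp add: reach_def) linarith
    then show ?thesis using that by (elim disjE) (simp_all add: next_carry_def)
  qed
  show ?thesis
  proof (cases "h = 1")
    case True
    then show ?thesis using * c assms(3-6) unfolding reach_def by (smt (verit))
  next
    case False
    then show ?thesis using c assms(1,3-6) unfolding reach_def by (smt (verit))
  qed
qed

text \<open>Symmetry in the summands and parity \<open>\<sigma>\<close> under negation extend an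
  identity from eight rows to all reachable states. The value 1 of \<open>\<sigma>\<close> serves
  the even functions \<open>gU\<close>, \<open>hUU\<close> and \<open>hVV\<close>, the value -1 the
  odd ones \<open>gV\<close> and \<open>hUV\<close>.\<close>

lemma poisson_from_rows:
  fixes \<Psi> :: "int \<Rightarrow> int \<Rightarrow> int \<Rightarrow> int \<Rightarrow> real" and R :: "int \<Rightarrow> int \<Rightarrow> int \<Rightarrow> real" and \<sigma> :: real
  assumes h: "h \<ge> 1" and \<sigma>: "\<sigma>^2 = 1"
    and sym: "\<And>c e e' k. \<Psi> c e' e k = \<Psi> c e e' k" "\<And>e e' k. R e' e k = R e e' k"
    and par: "\<And>c e e' k. \<Psi> (- c) (- e) (- e') (- k) = \<sigma> * \<Psi> c e e' k" "\<And>e e' k. R (- e) (- e') (- k) = \<sigma> * R e e' k"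
    and rows: 
      "\<And>x y a. \<bar>x\<bar> < h \<Longrightarrow> \<bar>y\<bar> < h \<Longrightarrow> \<bar>a\<bar> < h \<Longrightarrow> step_sum h x y a \<Psi> = R 0 0 0"
      "\<And>x y. \<bar>x\<bar> < h \<Longrightarrow> \<bar>y\<bar> < h \<Longrightarrow> step_sum h x y h \<Psi> = R 0 0 1"
      "\<And>x y a. h \<ge> 2 \<Longrightarrow> \<bar>x\<bar> < h \<Longrightarrow> \<bar>y\<bar> < h \<Longrightarrow> h < a \<Longrightarrow> step_sum h x y a \<Psi> = R 0 0 2"
      "\<And>x a. \<bar>x\<bar> < h \<Longrightarrow> \<bar>a\<bar> < h \<Longrightarrow> step_sum h x h a \<Psi> = R 0 1 0"
      "\<And>x. \<bar>x\<bar> < h \<Longrightarrow> step_sum h x h h \<Psi> = R 0 1 1"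
      "\<And>x a. \<bar>x\<bar> < h \<Longrightarrow> h < a \<Longrightarrow> step_sum h x h a \<Psi> = R 0 1 2"
      "\<And>a. h < a \<Longrightarrow> step_sum h h h a \<Psi> = R 1 1 2"
      "\<And>a. \<bar>a\<bar> < h \<Longrightarrow> step_sum h h (- h) a \<Psi> = R 1 (-1) 0"
    and z: "reach h x y a"
  shows "step_sum h x y a \<Psi> = R (bsgn h x) (bsgn h y) (carry_class h a)"
proof -
  define P where "P x y a \<longleftrightarrow> step_sum h x y a \<Psi> = R (bsgn h x) (bsgn h y) (carry_class h a)" for x y a
  have swap: "P y x a" if "P x y a" for x y a
  proof -
    have "(\<lambda>c e e' k. \<Psi> c e' e k) = \<Psi>" by (intro ext) (rule sym(1))
    then have "step_sum h y x a \<Psi> = step_sum h x y a \<Psi>"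
      using step_sum_swap[of h y x a \<Psi>] by simp
    then show ?thesis using that sym(2)[of "bsgn h y" "bsgn h x"] by (simp add: P_def)
  qed
  have neg: "P (- x) (- y) (- a)" if "P x y a" for x y a
  proof -
    have *: "bsgn h (- x) = - bsgn h x" for x by (simp add: bsgn_def sgn_if)
    have "step_sum h (- x) (- y) (- a) \<Psi> = \<sigma> * step_sum h x y a \<Psi>"
      using h unfolding step_sum_uminus[OF h]
      by (simp add: par(1) step_sum_def pair_sum_def sum_distrib_left mult_ac)
    then show ?thesis using that unfolding P_def by (simp add: * carry_class_uminus h par)
  qed
  have neg': "P x y a" if "P (- x) (- y) (- a)" for x y a using neg[OF that] by simp
  have rneg: "reach h (- x) (- y) (- a)" if "reach h x y a" for x y a
    using that by (auto simp: reach_def)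
  have bs: "bsgn h x = 0" if "\<bar>x\<bar> < h" for x using that by (simp add: bsgn_def)
  have bh: "bsgn h h = 1" "bsgn h (-h) = -1" using h by (auto simp: bsgn_def)
  have cls: "\<And>a. \<bar>a\<bar> < h \<Longrightarrow> carry_class h a = 0" "carry_class h h = 1" "\<And>a. h < a \<Longrightarrow> carry_class h a = 2"
    by (auto simp: carry_class_def)
  have P1: "P x y a" if "\<bar>x\<bar> < h" "\<bar>y\<bar> < h" "a \<ge> 0" "reach h x y a" for x y a
  proof -
    consider "a < h" | "a = h" | "h < a" by linarith
    then show ?thesis
    proof cases
      case 3
      \<comment> \<open>Inner digits give \<open>a \<le> 2 * h - 1\<close>, so \<open>h < a\<close>
        is possible for \<open>h \<ge> 2\<close> only.\<close>
      moreover have "a \<le> x + y + 1" "x < h" "y < h" using that by (simp_all add: reach_def)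
      ultimately have "h \<ge> 2" using h by linarith
      with 3 rows(3) that(1,2) show ?thesis by (simp add: P_def bs cls)
    qed (use that(1-3) rows(1,2) in \<open>simp_all add: P_def bs cls\<close>)
  qed
  have P2: "P x y a" if "\<bar>x\<bar> < h" "\<bar>y\<bar> < h" "reach h x y a" for x y a
  proof (cases "a \<ge> 0")
    case False
    have "reach h (- x) (- y) (- a)" using that(3) by (rule rneg)
    then have "P (- x) (- y) (- a)" using that(1,2) False by (intro P1) simp_all
    then show ?thesis by (rule neg')
  qed (rule P1[OF that(1,2) _ that(3)])
  have P3: "P x h a" if "\<bar>x\<bar> < h" "reach h x h a" for x a
  proof -
    \<comment> \<open>Since \<open>x > - h\<close>, the value \<open>a\<close> is nonnegative here,
      and no negative class occurs.\<close>
    have "x + h - 1 \<le> a" "- h < x" using that by (simp_all add: reach_def)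
    then have "- h < a" using h by linarith
    then consider "\<bar>a\<bar> < h" | "a = h" | "h < a" by linarith
    then show ?thesis
      by cases (use that(1) rows(4,5,6) in \<open>simp_all add: P_def bs bh cls\<close>)
  qed
  have P4: "P x (- h) a" if "\<bar>x\<bar> < h" "reach h x (- h) a" for x a
  proof (rule neg')
    have "reach h (- x) h (- a)" using rneg[OF that(2)] by simp
    then show "P (- x) (- (- h)) (- a)" using P3[of "- x" "- a"] that(1) by simp
  qed
  have P5: "P h h a" if "reach h h h a" for a
    using that rows(7)[of a] h by (simp add: P_def bh cls reach_def)
  have P6: "P h (- h) a" if "reach h h (- h) a" for a
  proof -
    have "\<bar>a\<bar> < h" using that by (simp add: reach_def abs_less_iff)
    then show ?thesis using rows(8)[of a] by (simp add: P_def bh cls)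
  qed
  have P7: "P (- h) (- h) a" if "reach h (- h) (- h) a" for a
  proof (rule neg')
    have "reach h h h (- a)" using rneg[OF that] by simp
    then show "P (- (- h)) (- (- h)) (- a)" using P5[of "- a"] by simp
  qed
  have sw: "reach h y x a" if "reach h x y a" for x y a
    using that by (auto simp: reach_def)
  have "- h \<le> x" "x \<le> h" "- h \<le> y" "y \<le> h" using z by (simp_all add: reach_def)
  then have dig: "x = h \<or> x = - h \<or> \<bar>x\<bar> < h" "y = h \<or> y = - h \<or> \<bar>y\<bar> < h"
    by linarith+
  then consider "\<bar>x\<bar> < h" "\<bar>y\<bar> < h" | "\<bar>x\<bar> < h" "y = h" | "\<bar>x\<bar> < h" "y = - h"
    | "x = h" "\<bar>y\<bar> < h" | "x = - h" "\<bar>y\<bar> < h" | "x = h" "y = h" | "x = h" "y = - h"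
    | "x = - h" "y = h" | "x = - h" "y = - h"
    by blast
  then have "P x y a"
  proof cases
    case 1 then show ?thesis using P2 z by simp
  next
    case 2 then show ?thesis using P3[of x a] z by simp
  next
    case 3 then show ?thesis using P4[of x a] z by simp
  next
    case 4 then show ?thesis using swap[OF P3[of y a]] sw[OF z] by simp
  next
    case 5 then show ?thesis using swap[OF P4[of y a]] sw[OF z] by simp
  next
    case 6 then show ?thesis using P5[of a] z by simp
  next
    case 7 then show ?thesis using P6[of a] z by simp
  next
    case 8 then show ?thesis using swap[OF P6[of a]] sw[OF z] by simp
  next
    case 9 then show ?thesis using P7[of a] z by simp
  qed
  then show ?thesis by (simp add: P_def)
qed

text \<open>
  Numerators of the solutions, found by solving the linear systems for many values of \<open>r = q\<close> and
  interpolating. The index \<open>b\<close> is the number of digits \<open>\<plusminus>q/2\<close> in the current pair and \<open>k\<close> is the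
  absolute value of the class of \<open>a\<close>.
\<close>

definition num_gU :: "real \<Rightarrow> int \<Rightarrow> int \<Rightarrow> real" where
  "num_gU r b k =
     (if b = 0 then if k = 0 then 0 else if k = 1 then 2*r^3 + 2*r^2 - 2*r
        else 4*r^3 + 4*r^2
      else if b = 1 then if k = 0 then - 2*r^2 + 4
        else if k = 1 then 2*r^3 + 2*r^2 - 4*r else 4*r^3 + 6*r^2 - 4*r - 4
      else if k = 0 then - 1*r^3 - r^2 - 2*r + 4 else 5*r^3 + 5*r^2 - 6*r - 4)"

definition num_gV :: "real \<Rightarrow> int \<Rightarrow> int \<Rightarrow> real" where
  "num_gV r b k =
     (if b = 0 then if k = 0 then 0 else if k = 1 then 2*r
        else 4*r
      else if b = 1 then if k = 0 then r - 2
        else if k = 1 then 3*r - 2 else 5*r - 2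
      else if k = 0 then 0 else 6*r - 4)"

definition num_hUU :: "real \<Rightarrow> int \<Rightarrow> int \<Rightarrow> real" where
  "num_hUU r b k =
     (if b = 0 then if k = 0 then 0 else if k = 1 then 4*r^7 + 16*r^6 + 4*r^5 - 8*r^4 - 2*r^3 - 24*r^2 - 4*r
        else 8*r^7 + 24*r^6 + 28*r^5 + 20*r^4 - 8*r^2
      else if b = 1 then if k = 0 then - 2*r^6 - 10*r^5 + 12*r^4 + 16*r^3 - 18*r^2 + 12*r + 8
        else if k = 1 then 6*r^7 + 18*r^6 - 12*r^5 - 16*r^4 + 16*r^3 - 36*r^2 - 8*r else 8*r^7 + 34*r^6 + 18*r^5 - 28*r^4 - 20*r^3 - 30*r^2 - 20*r - 8
      else if k = 0 then - 1*r^7 - 3*r^6 - 22*r^5 + 20*r^4 + 50*r^3 - 52*r^2 + 8 else 13*r^7 + 39*r^6 - 2*r^5 - 52*r^4 - 18*r^3 - 20*r^2 - 16*r - 8)"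

definition num_hUV :: "real \<Rightarrow> int \<Rightarrow> int \<Rightarrow> real" where
  "num_hUV r b k =
     (if b = 0 then if k = 0 then 0 else if k = 1 then 10*r^6 + 16*r^5 + 8*r^4 + 28*r^3 - 18*r^2 - 36*r
        else 16*r^6 + 28*r^5 + 52*r^4 + 52*r^3 - 60*r^2 - 72*r
      else if b = 1 then if k = 0 then 3*r^6 + 4*r^5 - 6*r^4 - 48*r^3 + 27*r^2 + 36*r - 20
        else if k = 1 then 17*r^6 + 12*r^5 + 2*r^3 - 33*r^2 - 2*r + 8 else 23*r^6 + 36*r^5 + 10*r^4 + 8*r^3 - 9*r^2 - 36*r - 20
      else if k = 0 then 0 else 34*r^6 + 24*r^5 + 4*r^3 - 66*r^2 - 4*r + 16)"

definition num_hVV :: "real \<Rightarrow> int \<Rightarrow> int \<Rightarrow> real" where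
  "num_hVV r b k =
     (if b = 0 then if k = 0 then 0 else if k = 1 then 3*r^3 - r^2
        else 4*r^3 + 4*r^2
      else if b = 1 then if k = 0 then - 3*r^2 + 3*r + 2
        else if k = 1 then 4*r^3 - 4*r^2 else 6*r^3 + r^2 - 3*r - 2
      else if k = 0 then - 1*r^3 - 4*r^2 + 7*r - 2 else 9*r^3 - 4*r^2 - 7*r + 2)"

section \<open>Parity of the solutions and verification of the Poisson equations\<close>

definition even_tab :: "(int \<Rightarrow> int \<Rightarrow> real) \<Rightarrow> int \<Rightarrow> int \<Rightarrow> int \<Rightarrow> real" where
  "even_tab T e e' k = T (\<bar>e\<bar> + \<bar>e'\<bar>) \<bar>k\<bar>"

text \<open>The sign of the class alone does not suffice: with exactly one digit
  \<open>\<plusminus>q/2\<close> the solution is in general nonzero even for class 0, and its sign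
  follows that digit. For two opposite digits \<open>\<plusminus>q/2\<close> the sign is 0, as
  oddness together with symmetry in the summands requires.\<close>

definition odd_tab :: "(int \<Rightarrow> int \<Rightarrow> real) \<Rightarrow> int \<Rightarrow> int \<Rightarrow> int \<Rightarrow> real" where
  "odd_tab T e e' k = real_of_int (if e = 0 \<and> e' = 0 then sgn k else sgn (e + e')) * T (\<bar>e\<bar> + \<bar>e'\<bar>) \<bar>k\<bar>"

text \<open>The scaling factors clear the denominators of the solutions and leave polynomial
  identities in \<open>q\<close>. \<open>num_mu r / scaleU r\<close> is the asymptotic mean number
  of nonzero carries per digit; the sum of the carries has mean 0 by symmetry.\<close>

definition scaleU :: "real \<Rightarrow> real" where "scaleU r = 4 * (r + 1)^2 * (r - 1)"
definition scaleV :: "real \<Rightarrow> real" where "scaleV r = 4 * (r - 1)"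
definition num_mu :: "real \<Rightarrow> real" where "num_mu r = (r^2 + 2*r + 4) * (r - 1)"
definition num_varUU :: "real \<Rightarrow> real" where
  "num_varUU r = (3*r^6 + 12*r^5 + 63*r^4 + 24*r^3 - 84*r^2) * (r - 1)"
definition num_varVV :: "real \<Rightarrow> real" where "num_varVV r = 4 * (r - 1) * (r^2 + 5*r - 2)"

lemma even_tab_sym: "even_tab T e' e k = even_tab T e e' k" "even_tab T (- e) (- e') (- k) = even_tab T e e' k"
  by (simp_all add: even_tab_def add.commute)

lemma odd_tab_sym: "odd_tab T e' e k = odd_tab T e e' k" "odd_tab T (- e) (- e') (- k) = - odd_tab T e e' k"
  by (auto simp: odd_tab_def add.commute sgn_if)

lemmas step_sum_rows = step_sum_mid_mid_0 step_sum_mid_mid_1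
  step_sum_mid_top_0 step_sum_mid_top_1 step_sum_mid_top_2 step_sum_top_top step_sum_top_bot

text \<open>Each row, multiplied by \<open>16 * H^2\<close>, is a polynomial identity in
  \<open>H = q/2\<close> that is checked by expansion. The next four lemmas follow the same
  scheme.\<close>

lemma poisson_gU:
  assumes "h \<ge> 1" "reach h x y a"
  defines "r \<equiv> 2 * real_of_int h"
  shows "step_sum h x y a (\<lambda>c e e' k. (scaleU r * (real_of_int c)^2 - num_mu r) + even_tab (num_gU r) e e' k) =
    even_tab (num_gU r) (bsgn h x) (bsgn h y) (carry_class h a)"
proof -
  define H where "H = real_of_int h"
  have D: "H \<noteq> 0" using assms by (auto simp: H_def)
  then have cross: "A / (16 * H^2) = B \<longleftrightarrow> A = B * (16 * H^2)" for A B
    by (simp add: divide_simps)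
  have r: "r = 2 * H" by (simp add: r_def H_def)
  note S = even_tab_def odd_tab_def num_gU_def scaleU_def num_mu_def H_def[symmetric]
  show ?thesis
    apply (rule poisson_from_rows[where \<sigma> = "1" and R = "\<lambda>e e' k. even_tab (num_gU r) e e' k", OF assms(1) _ _ _ _ _ _ _ _ _ _ _ _ _ assms(2)])
    apply (simp_all add: even_tab_sym odd_tab_sym algebra_simps)[5]
    apply (simp_all only: step_sum_rows[OF assms(1)] step_sum_mid_mid_2 H_def[symmetric] cross)
    apply (simp_all add: S r)
    apply (simp_all (no_asm) add: algebra_simps eval_nat_numeral)
    done
qed

lemma poisson_gV:
  assumes "h \<ge> 1" "reach h x y a"
  defines "r \<equiv> 2 * real_of_int h"
  shows "step_sum h x y a (\<lambda>c e e' k. (scaleV r * real_of_int c) + odd_tab (num_gV r) e e' k) =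
    odd_tab (num_gV r) (bsgn h x) (bsgn h y) (carry_class h a)"
proof -
  define H where "H = real_of_int h"
  have D: "H \<noteq> 0" using assms by (auto simp: H_def)
  then have cross: "A / (16 * H^2) = B \<longleftrightarrow> A = B * (16 * H^2)" for A B
    by (simp add: divide_simps)
  have r: "r = 2 * H" by (simp add: r_def H_def)
  note S = even_tab_def odd_tab_def num_gV_def scaleV_def H_def[symmetric]
  show ?thesis
    apply (rule poisson_from_rows[where \<sigma> = "- 1" and R = "\<lambda>e e' k. odd_tab (num_gV r) e e' k", OF assms(1) _ _ _ _ _ _ _ _ _ _ _ _ _ assms(2)])
    apply (simp_all add: even_tab_sym odd_tab_sym algebra_simps)[5]
    apply (simp_all only: step_sum_rows[OF assms(1)] step_sum_mid_mid_2 H_def[symmetric] cross)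
    apply (simp_all add: S r)
    apply (simp_all (no_asm) add: algebra_simps eval_nat_numeral)
    done
qed

lemma poisson_hVV:
  assumes "h \<ge> 1" "reach h x y a"
  defines "r \<equiv> 2 * real_of_int h"
  shows "step_sum h x y a (\<lambda>c e e' k. (r + 1) * (scaleV r * real_of_int c)^2 + 2 * (r + 1) * (scaleV r * real_of_int c) * odd_tab (num_gV r) e e' k + 4 * even_tab (num_hVV r) e e' k) =
    num_varVV r + 4 * even_tab (num_hVV r) (bsgn h x) (bsgn h y) (carry_class h a)"
proof -
  define H where "H = real_of_int h"
  have D: "H \<noteq> 0" using assms by (auto simp: H_def)
  then have cross: "A / (16 * H^2) = B \<longleftrightarrow> A = B * (16 * H^2)" for A B
    by (simp add: divide_simps)
  have r: "r = 2 * H" by (simp add: r_def H_def)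
  note S = even_tab_def odd_tab_def num_gV_def scaleV_def num_varVV_def num_hVV_def H_def[symmetric]
  show ?thesis
    apply (rule poisson_from_rows[where \<sigma> = "1" and R = "\<lambda>e e' k. num_varVV r + 4 * even_tab (num_hVV r) e e' k", OF assms(1) _ _ _ _ _ _ _ _ _ _ _ _ _ assms(2)])
    apply (simp_all add: even_tab_sym odd_tab_sym algebra_simps)[5]
    apply (simp_all only: step_sum_rows[OF assms(1)] step_sum_mid_mid_2 H_def[symmetric] cross)
    apply (simp_all add: S r)
    apply (simp_all (no_asm) add: algebra_simps eval_nat_numeral)
    done
qed

text \<open>No constant appears on the right: every product on the left is odd under negation, so
  its stationary mean vanishes. This is the asymptotic uncorrelatedness of \<open>U\<close> and
  \<open>V\<close>. The factor \<open>r^2 + 1\<close> clears a denominator of the solution.\<close>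

lemma poisson_hUV:
  assumes "h \<ge> 1" "reach h x y a"
  defines "r \<equiv> 2 * real_of_int h"
  shows "step_sum h x y a (\<lambda>c e e' k. (r^2 + 1) * ((scaleU r * (real_of_int c)^2 - num_mu r) * (scaleV r * real_of_int c) + (scaleV r * real_of_int c) * even_tab (num_gU r) e e' k + (scaleU r * (real_of_int c)^2 - num_mu r) * odd_tab (num_gV r) e e' k) + odd_tab (num_hUV r) e e' k) =
    odd_tab (num_hUV r) (bsgn h x) (bsgn h y) (carry_class h a)"
proof -
  define H where "H = real_of_int h"
  have D: "H \<noteq> 0" using assms by (auto simp: H_def)
  then have cross: "A / (16 * H^2) = B \<longleftrightarrow> A = B * (16 * H^2)" for A B
    by (simp add: divide_simps)
  have r: "r = 2 * H" by (simp add: r_def H_def)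
  note S = even_tab_def odd_tab_def num_gU_def num_gV_def scaleU_def scaleV_def num_mu_def num_hUV_def H_def[symmetric]
  show ?thesis
    apply (rule poisson_from_rows[where \<sigma> = "- 1" and R = "\<lambda>e e' k. odd_tab (num_hUV r) e e' k", OF assms(1) _ _ _ _ _ _ _ _ _ _ _ _ _ assms(2)])
    apply (simp_all add: even_tab_sym odd_tab_sym algebra_simps)[5]
    apply (simp_all only: step_sum_rows[OF assms(1)] step_sum_mid_mid_2 H_def[symmetric] cross)
    apply (simp_all add: S r)
    apply (simp_all (no_asm) add: algebra_simps eval_nat_numeral)
    done
qed

lemma poisson_hUU:
  assumes "h \<ge> 1" "reach h x y a"
  defines "r \<equiv> 2 * real_of_int h"
  shows "step_sum h x y a (\<lambda>c e e' k. (r + 1) * (scaleU r * (real_of_int c)^2 - num_mu r)^2 + 2 * (r + 1) * (scaleU r * (real_of_int c)^2 - num_mu r) * even_tab (num_gU r) e e' k + 2 * even_tab (num_hUU r) e e' k) =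
    num_varUU r + 2 * even_tab (num_hUU r) (bsgn h x) (bsgn h y) (carry_class h a)"
proof -
  define H where "H = real_of_int h"
  have D: "H \<noteq> 0" using assms by (auto simp: H_def)
  then have cross: "A / (16 * H^2) = B \<longleftrightarrow> A = B * (16 * H^2)" for A B
    by (simp add: divide_simps)
  have r: "r = 2 * H" by (simp add: r_def H_def)
  note S = even_tab_def odd_tab_def num_gU_def scaleU_def num_varUU_def num_mu_def num_hUU_def H_def[symmetric]
  show ?thesis
    apply (rule poisson_from_rows[where \<sigma> = "1" and R = "\<lambda>e e' k. num_varUU r + 2 * even_tab (num_hUU r) e e' k", OF assms(1) _ _ _ _ _ _ _ _ _ _ _ _ _ assms(2)])
    apply (simp_all add: even_tab_sym odd_tab_sym algebra_simps)[5]
    apply (simp_all only: step_sum_rows[OF assms(1)] step_sum_mid_mid_2 H_def[symmetric] cross)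
    apply (simp_all add: S r)
    apply (simp_all (no_asm) add: algebra_simps eval_nat_numeral)
    done
qed

section \<open>Random SSDEs and the Markov chain\<close>

definition extensions :: "int \<Rightarrow> int \<Rightarrow> nat \<Rightarrow> int list set" where
  "extensions q p m = {xs. p # xs \<in> SSDE q (Suc m)}"

lemma finite_conts: "finite (extensions q p m)"
proof -
  have "extensions q p m = (#) p -` SSDE q (Suc m)" by (auto simp: extensions_def)
  then show ?thesis by (simp add: finite_vimageI finite_SSDE)
qed

lemma all_nat_split: "(\<forall>j. P j) \<longleftrightarrow> P 0 \<and> (\<forall>j. P (Suc j))" for P :: "nat \<Rightarrow> bool"
  by (metis not0_implies_Suc)

lemma Cons_Cons_in_SSDE:
  "p # x # xs \<in> SSDE (2 * h) (Suc (Suc m)) \<longleftrightarrow> p \<in> {- h..h} \<and> allowed h p x \<and> x # xs \<in> SSDE (2 * h) (Suc m)"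
  unfolding SSDE_def mem_Collect_eq
  by (subst all_nat_split) (auto simp: allowed_def)

text \<open>A digit 0 placed below the least significant one imposes no constraint on it and can
  therefore serve as initial state.\<close>

lemma SSDE_eq_conts:
  assumes "h \<ge> 1" shows "SSDE (2 * h) l = extensions (2 * h) 0 l"
proof -
  have "xs \<in> SSDE (2 * h) l \<longleftrightarrow> 0 # xs \<in> SSDE (2 * h) (Suc l)" for xs
    using assms unfolding SSDE_def mem_Collect_eq by (subst (2) all_nat_split) auto
  then show ?thesis by (auto simp: extensions_def)
qed

lemma extensions_0: "p \<in> {- h..h} \<Longrightarrow> extensions (2 * h) p 0 = {[]}"
  by (auto simp: extensions_def SSDE_def)

lemma sum_conts_Suc:
  fixes F :: "int list \<Rightarrow> 'b::real_vector"
  assumes p: "p \<in> {- h..h}"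
  shows "(\<Sum>xs\<in>extensions (2 * h) p (Suc m). F xs) =
    (\<Sum>x\<in>{- h..h}. of_bool (allowed h p x) *\<^sub>R (\<Sum>xs\<in>extensions (2 * h) x m. F (x # xs)))"
proof -
  define I where "I = {x \<in> {- h..h}. allowed h p x}"
  have fin: "finite I" unfolding I_def by (rule finite_subset[of _ "{- h..h}"]) auto
  have "extensions (2 * h) p (Suc m) = (\<Union>x\<in>I. (#) x ` extensions (2 * h) x m)"
  proof (intro equalityI subsetI)
    fix xs assume xs: "xs \<in> extensions (2 * h) p (Suc m)"
    then have "length xs = Suc m" by (simp add: extensions_def SSDE_def)
    then obtain x ys where [simp]: "xs = x # ys" by (cases xs) auto
    have "allowed h p x" "x # ys \<in> SSDE (2 * h) (Suc m)" using xs by (auto simp: extensions_def Cons_Cons_in_SSDE)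
    moreover from this have "x \<in> {- h..h}" by (auto simp: SSDE_def)
    ultimately show "xs \<in> (\<Union>x\<in>I. (#) x ` extensions (2 * h) x m)" by (auto simp: I_def extensions_def)
  qed (use p in \<open>auto simp: I_def extensions_def Cons_Cons_in_SSDE\<close>)
  then have "(\<Sum>xs\<in>extensions (2 * h) p (Suc m). F xs) = (\<Sum>x\<in>I. \<Sum>xs\<in>(#) x ` extensions (2 * h) x m. F xs)"
    using fin by (simp only:) (rule sum.UNION_disjoint, auto simp: finite_conts)
  also have "\<dots> = (\<Sum>x\<in>I. \<Sum>xs\<in>extensions (2 * h) x m. F (x # xs))"
    by (rule sum.cong[OF refl]) (simp add: sum.reindex)
  also have "\<dots> = (\<Sum>x\<in>{- h..h}. of_bool (allowed h p x) *\<^sub>R (\<Sum>xs\<in>extensions (2 * h) x m. F (x # xs)))"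
    unfolding I_def by (subst sum.inter_filter) (auto intro!: sum.cong)
  finally show ?thesis .
qed

text \<open>The carry decided by a digit pair is the one that enters its position; when the words
  end, the digit sum 0 decides the leading carry. Words of length \<open>l\<close> thus give
  \<open>l + 1\<close> values of \<open>F\<close>, while \<open>\<mu>\<close> is subtracted
  \<open>l\<close> times.\<close>

fun carry_total :: "(int \<Rightarrow> real) \<Rightarrow> real \<Rightarrow> int \<Rightarrow> int \<Rightarrow> int list \<Rightarrow> int list \<Rightarrow> real" where
  "carry_total F \<mu> q a (x # xs) (y # ys) = F (next_carry q a (x + y)) - \<mu> +
     carry_total F \<mu> q (x + y + next_carry q a (x + y)) xs ys"
| "carry_total F \<mu> q a _ _ = F (next_carry q a 0)"

text \<open>
  Starting from \<open>a = 0\<close> instead of from \<open>c\<^sub>0 = 0\<close> is harmless, since then \<open>next_carry q 0 t = 0\<close>.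
\<close>

primrec pending :: "int \<Rightarrow> int \<Rightarrow> int list \<Rightarrow> int list \<Rightarrow> nat \<Rightarrow> int" where
  "pending q a xs ys 0 = a"
| "pending q a xs ys (Suc j) = digit_sum xs ys j + next_carry q (pending q a xs ys j) (digit_sum xs ys j)"

lemma pending_Cons:
  "pending q a (x # xs) (y # ys) (Suc j) = pending q (x + y + next_carry q a (x + y)) xs ys j"
  by (induction j) (simp_all add: digit_sum_def)

text \<open>At index \<open>j + 1\<close>, \<open>pending\<close> is \<open>s_j + c_j\<close>, and
  together with \<open>s_{j+1}\<close> this decides \<open>c_{j+1}\<close>.\<close>

lemma carry_eq_next_carry_pending:
  assumes "q \<ge> 2"
  shows "carry q xs ys j = next_carry q (pending q 0 xs ys j) (digit_sum xs ys j)"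
proof (induction j)
  case 0
  have "q div 2 \<ge> 1" using assms by linarith
  then show ?case by (simp add: next_carry_def)
next
  case (Suc j) then show ?case by simp
qed

lemma carry_total_eq_sum:
  assumes "length xs = length ys"
  shows "carry_total F \<mu> q a xs ys =
    (\<Sum>j\<le>length xs. F (next_carry q (pending q a xs ys j) (digit_sum xs ys j))) - \<mu> * real (length xs)"
  using assms
proof (induction xs ys arbitrary: a rule: list_induct2)
  case Nil show ?case by (simp add: digit_sum_def)
next
  case (Cons x xs y ys)
  have "digit_sum (x # xs) (y # ys) (Suc j) = digit_sum xs ys j" for j by (simp add: digit_sum_def)
  moreover have "digit_sum (x # xs) (y # ys) 0 = x + y" by (simp add: digit_sum_def)
  ultimately show ?case
    unfolding length_Cons sum.atMost_Suc_shift pending_Cons using Cons by (simp add: algebra_simps)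
qed

lemma sum_of_bool_carries:
  "(\<Sum>j\<in>{1..length xs}. of_bool (carry q xs ys j = d)) = num_carries q d (xs, ys)"
  by (simp add: num_carries_def sum.If_cases Int_def)

lemma carry_total_eq_num_carries:
  assumes "q \<ge> 2" "length xs = l" "length ys = l"
  shows "carry_total (\<lambda>c. s * of_bool (c = 1) + t * of_bool (c = - 1)) \<mu> q 0 xs ys =
    s * num_carries q 1 (xs, ys) + t * num_carries q (- 1) (xs, ys) - \<mu> * real l"
proof -
  have "carry_total (\<lambda>c. s * of_bool (c = 1) + t * of_bool (c = - 1)) \<mu> q 0 xs ys =
    (\<Sum>j\<in>{0..length xs}. s * of_bool (carry q xs ys j = 1) + t * of_bool (carry q xs ys j = - 1)) - \<mu> * real l"
    using assms by (subst carry_total_eq_sum) (simp_all add: carry_eq_next_carry_pending atMost_atLeast0)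
  \<comment> \<open>The initial carry 0 is counted by neither term.\<close>
  also have "(\<Sum>j\<in>{0..length xs}. s * of_bool (carry q xs ys j = 1) + t * of_bool (carry q xs ys j = - 1)) =
    (\<Sum>j\<in>{1..length xs}. s * of_bool (carry q xs ys j = 1) + t * of_bool (carry q xs ys j = - 1))"
    by (subst sum.atLeast_Suc_atMost) auto
  also have "\<dots> = s * num_carries q 1 (xs, ys) + t * num_carries q (- 1) (xs, ys)"
    unfolding sum_of_bool_carries[symmetric] by (simp only: sum.distrib sum_distrib_left)
  finally show ?thesis .
qed

section \<open>The Markov chain of digit pairs\<close>

definition chain_states :: "int \<Rightarrow> (int \<times> int \<times> int) set" where
  "chain_states h = {(x, y, a). reach h x y a}"

definition chain_weight :: "int \<Rightarrow> int \<times> int \<times> int \<Rightarrow> int \<times> int \<Rightarrow> real" where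
  "chain_weight h = (\<lambda>(x, y, a) (x', y'). digit_prob h x x' * digit_prob h y y')"

definition chain_next :: "int \<Rightarrow> int \<times> int \<times> int \<Rightarrow> int \<times> int \<Rightarrow> int \<times> int \<times> int" where
  "chain_next h = (\<lambda>(x, y, a) (x', y'). (x', y', x' + y' + next_carry (2 * h) a (x' + y')))"

definition chain_inc :: "int \<Rightarrow> (int \<Rightarrow> real) \<Rightarrow> real \<Rightarrow> int \<times> int \<times> int \<Rightarrow> int \<times> int \<Rightarrow> real" where
  "chain_inc h F \<mu> = (\<lambda>(x, y, a) (x', y'). F (next_carry (2 * h) a (x' + y')) - \<mu>)"

definition chain_final :: "int \<Rightarrow> (int \<Rightarrow> real) \<Rightarrow> int \<times> int \<times> int \<Rightarrow> real" where
  "chain_final h F = (\<lambda>(x, y, a). F (next_carry (2 * h) a 0))"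

text \<open>This cancels the eigenvector weights of the last digits, which the telescoping product
  of transition probabilities leaves behind.\<close>

definition chain_end :: "int \<Rightarrow> int \<times> int \<times> int \<Rightarrow> real" where
  "chain_end h = (\<lambda>(x, y, a). 1 / (digit_weight h x * digit_weight h y))"

lemma digit_prob_nonneg: "h \<ge> 1 \<Longrightarrow> 0 \<le> digit_prob h p x"
  by (simp add: digit_prob_def digit_weight_def)

lemma sum_digit_prob:
  assumes "h \<ge> 1" "p \<in> {- h..h}"
  shows "(\<Sum>x\<in>{- h..h}. digit_prob h p x) = 1"
proof -
  have H: "real_of_int h > 0" using assms by simp
  consider "\<bar>p\<bar> < h" | "p = h" | "p = - h" using assms(2) by fastforce
  then show ?thesis
  proof cases
    case 1
    from sum_digit_prob_interior[OF assms(1) this, of "\<lambda>_ _. 1"] show ?thesis using assms H by simp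
  next
    case 2
    from sum_digit_prob_pos[OF assms(1), of "\<lambda>_ _. 1"] show ?thesis using 2 assms H by simp
  next
    case 3
    from sum_digit_prob_neg[OF assms(1), of "\<lambda>_ _. 1"] show ?thesis using 3 assms H by simp
  qed
qed

lemma digit_prob_zero_ge:
  assumes "h \<ge> 1" shows "1 / (2 * real_of_int h) \<le> digit_prob h p 0"
  using assms by (auto simp: digit_prob_def allowed_def digit_weight_def intro!: frac_le)

lemma chain_simps:
  "chain_weight h (x, y, a) (x', y') = digit_prob h x x' * digit_prob h y y'"
  "chain_next h (x, y, a) (x', y') = (x', y', x' + y' + next_carry (2 * h) a (x' + y'))"
  "chain_inc h F \<mu> (x, y, a) (x', y') = F (next_carry (2 * h) a (x' + y')) - \<mu>"
  "chain_final h F (x, y, a) = F (next_carry (2 * h) a 0)"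
  "chain_end h (x, y, a) = 1 / (digit_weight h x * digit_weight h y)"
  by (simp_all add: chain_weight_def chain_next_def chain_inc_def chain_final_def chain_end_def)

text \<open>The resetting draw is a pair of zeros: 0 may follow every digit and has probability at
  least \<open>1 / (2 * h)\<close> in each summand.\<close>

lemma finite_chain_carries:
  assumes h: "h \<ge> 1"
  shows "finite_chain (chain_states h) ({- h..h} \<times> {- h..h}) (chain_weight h) (chain_next h) (0, 0) (0, 0, 0)
    ((1 / (2 * real_of_int h))^2)"
proof
  have "chain_states h \<subseteq> {- h..h} \<times> {- h..h} \<times> {- 2 * h - 1..2 * h + 1}"
    by (auto simp: chain_states_def reach_def)
  then show "finite (chain_states h)" by (rule finite_subset) simp
  show "0 \<le> chain_weight h z d" for z d
    using h by (auto simp: chain_weight_def digit_prob_nonneg split: prod.split)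
  show "(\<Sum>d\<in>{- h..h} \<times> {- h..h}. chain_weight h z d) = 1" if "z \<in> chain_states h" for z
  proof -
    obtain x y a where z: "z = (x, y, a)" by (cases z) auto
    have "x \<in> {- h..h}" "y \<in> {- h..h}" using that by (auto simp: z chain_states_def reach_def)
    then show ?thesis
      by (simp add: z chain_weight_def sum.cartesian_product[symmetric] sum_distrib_left[symmetric] sum_digit_prob[OF h])
  qed
  show "chain_next h z d \<in> chain_states h"
    if "z \<in> chain_states h" "d \<in> {- h..h} \<times> {- h..h}" "chain_weight h z d \<noteq> 0" for z d
  proof -
    obtain x y a where z: "z = (x, y, a)" by (cases z) auto
    obtain x' y' where d: "d = (x', y')" by (cases d) auto
    have "allowed h x x'" "allowed h y y'" using that(3) by (auto simp: z d chain_weight_def digit_prob_def split: if_splits)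
    then show ?thesis
      using reach_step[OF h, of x y a x' y'] that by (simp add: z d chain_states_def chain_next_def)
  qed
  show "(1 / (2 * real_of_int h))^2 \<le> chain_weight h z (0, 0)" if "z \<in> chain_states h" for z
  proof -
    obtain x y a where z: "z = (x, y, a)" by (cases z) auto
    show ?thesis
      unfolding z chain_simps power2_eq_square
      using h by (intro mult_mono digit_prob_zero_ge digit_prob_nonneg) auto
  qed
  \<comment> \<open>The first pair of zeros makes \<open>a\<close> a bare carry -1, 0 or 1. With
    digit sum 0 this causes no further carry, not even for \<open>h = 1\<close>, where
    \<open>\<plusminus>1\<close> are pending values.\<close>
  show "chain_next h (chain_next h z (0, 0)) (0, 0) = (0, 0, 0)" if "z \<in> chain_states h" for z
  proof -
    obtain x y a where z: "z = (x, y, a)" by (cases z) auto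
    show ?thesis
      using h next_carry_cases[of "2 * h" a 0] by (auto simp: z chain_next_def next_carry_def)
  qed
qed (use h in \<open>auto simp: chain_states_def reach_def\<close>)

text \<open>For each summand the product of the \<open>digit_prob\<close> telescopes to the quotient
  of last and first weight over \<open>(2 * h)^m\<close>. \<open>chain_end\<close> cancels the last
  weights and the prefactor everything else, which leaves the plain sum over pairs of words.\<close>

lemma walk_eq_sum_conts:
  fixes G :: "real \<Rightarrow> 'b::real_vector"
  assumes h: "h \<ge> 1" and "reach h x y a"
  shows "(digit_weight h x * digit_weight h y * (2 * real_of_int h)^(2 * m)) *\<^sub>R
      finite_chain.walk ({- h..h} \<times> {- h..h}) (chain_weight h) (chain_next h)
        (chain_inc h F \<mu>) (chain_final h F) (chain_end h) G m (x, y, a) u =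
    (\<Sum>xs\<in>extensions (2 * h) x m. \<Sum>ys\<in>extensions (2 * h) y m. G (u + carry_total F \<mu> (2 * h) a xs ys))"
  using assms(2)
proof (induction m arbitrary: x y a u)
  interpret finite_chain "chain_states h" "{- h..h} \<times> {- h..h}" "chain_weight h" "chain_next h" "(0, 0)" "(0, 0, 0)"
    "(1 / (2 * real_of_int h))^2" by (rule finite_chain_carries[OF h])
  have digit_weight: "digit_weight h x \<noteq> 0" for x by (simp add: digit_weight_def)
  {
    case 0
    then have "x \<in> {- h..h}" "y \<in> {- h..h}" by (auto simp: reach_def)
    then show ?case
      by (simp add: extensions_0 chain_end_def chain_final_def digit_weight)
  next
    case (Suc m)
    define c where "c = (\<lambda>x' y'. next_carry (2 * h) a (x' + y'))"
    define k where "k = (2 * real_of_int h)^(2 * m)"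
    define w where "w = (\<lambda>x' y'. walk (chain_inc h F \<mu>) (chain_final h F) (chain_end h) G m
      (x', y', x' + y' + c x' y') (u + (F (c x' y') - \<mu>)))"
    have xy: "x \<in> {- h..h}" "y \<in> {- h..h}" using Suc.prems by (auto simp: reach_def)
    have tr: "digit_prob h p x' * (2 * real_of_int h * digit_weight h p) = of_bool (allowed h p x') * digit_weight h x'" for p x'
      using h digit_weight[of p] by (simp add: digit_prob_def)
    have IH: "(of_bool (allowed h x x') * of_bool (allowed h y y') * (digit_weight h x' * digit_weight h y' * k)) *\<^sub>R w x' y' =
      of_bool (allowed h x x') *\<^sub>R of_bool (allowed h y y') *\<^sub>R (\<Sum>xs\<in>extensions (2 * h) x' m. \<Sum>ys\<in>extensions (2 * h) y' m.
        G (u + carry_total F \<mu> (2 * h) a (x' # xs) (y' # ys)))"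
      if "x' \<in> {- h..h}" "y' \<in> {- h..h}" for x' y'
    proof (cases "allowed h x x' \<and> allowed h y y'")
      case True
      then have "reach h x' y' (x' + y' + c x' y')"
        using reach_step[OF h Suc.prems, of x' y'] that by (simp add: c_def)
      from Suc.IH[OF this, of "u + (F (c x' y') - \<mu>)"] show ?thesis
        using True by (simp add: w_def k_def c_def add.assoc)
    qed auto
    have sum_cart: "(\<Sum>d\<in>{- h..h} \<times> {- h..h}. E d) = (\<Sum>x'\<in>{- h..h}. \<Sum>y'\<in>{- h..h}. E (x', y'))" for E :: "int \<times> int \<Rightarrow> 'b"
      by (simp add: sum.cartesian_product)
    have "(digit_weight h x * digit_weight h y * (2 * real_of_int h)^(2 * Suc m)) *\<^sub>R walk (chain_inc h F \<mu>) (chain_final h F) (chain_end h) G (Suc m) (x, y, a) u =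
      (\<Sum>x'\<in>{- h..h}. \<Sum>y'\<in>{- h..h}.
        ((digit_prob h x x' * (2 * real_of_int h * digit_weight h x)) * (digit_prob h y y' * (2 * real_of_int h * digit_weight h y)) * k) *\<^sub>R w x' y')"
      unfolding walk.simps sum_cart scaleR_sum_right chain_simps c_def w_def k_def
      by (intro sum.cong refl) (simp add: mult_ac)
    also have "\<dots> = (\<Sum>x'\<in>{- h..h}. \<Sum>y'\<in>{- h..h}. of_bool (allowed h x x') *\<^sub>R of_bool (allowed h y y') *\<^sub>R
        (\<Sum>xs\<in>extensions (2 * h) x' m. \<Sum>ys\<in>extensions (2 * h) y' m. G (u + carry_total F \<mu> (2 * h) a (x' # xs) (y' # ys))))"
    proof (intro sum.cong refl)
      fix x' y' assume "x' \<in> {- h..h}" "y' \<in> {- h..h}"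
      from IH[OF this] show "((digit_prob h x x' * (2 * real_of_int h * digit_weight h x)) * (digit_prob h y y' * (2 * real_of_int h * digit_weight h y)) * k) *\<^sub>R w x' y' =
        of_bool (allowed h x x') *\<^sub>R of_bool (allowed h y y') *\<^sub>R
        (\<Sum>xs\<in>extensions (2 * h) x' m. \<Sum>ys\<in>extensions (2 * h) y' m. G (u + carry_total F \<mu> (2 * h) a (x' # xs) (y' # ys)))"
        unfolding tr by (simp only: mult_ac)
    qed
    also have "\<dots> = (\<Sum>xs\<in>extensions (2 * h) x (Suc m). \<Sum>ys\<in>extensions (2 * h) y (Suc m). G (u + carry_total F \<mu> (2 * h) a xs ys))"
      unfolding sum_conts_Suc[OF xy(1)] sum_conts_Suc[OF xy(2)]
      by (rule sum.cong[OF refl], subst sum.swap) (simp add: scaleR_sum_right)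
    finally show ?case .
  }
qed

lemma expectation_random_summands:
  fixes G :: "int list \<times> int list \<Rightarrow> 'b::{banach, second_countable_topology}"
  assumes "q \<ge> 2"
  shows "measure_pmf.expectation (random_summands q l) G =
    (1 / (real (card (SSDE q l)))^2) *\<^sub>R (\<Sum>xs\<in>SSDE q l. \<Sum>ys\<in>SSDE q l. G (xs, ys))"
proof -
  have S: "finite (SSDE q l)" "SSDE q l \<noteq> {}" by (rule finite_SSDE, rule SSDE_nonempty[OF assms])
  have "measure_pmf.expectation (random_summands q l) G =
      (\<Sum>p\<in>SSDE q l \<times> SSDE q l. pmf (random_summands q l) p *\<^sub>R G p)"
    using S by (intro integral_measure_pmf) (auto simp: random_summands_def)
  also have "\<dots> = (\<Sum>p\<in>SSDE q l \<times> SSDE q l. (1 / (real (card (SSDE q l)))^2) *\<^sub>R G p)"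
    using S by (intro sum.cong refl) (auto simp: random_summands_def pmf_pair power2_eq_square pmf_of_set[OF S(2,1)])
  finally show ?thesis by (simp add: sum.cartesian_product scaleR_sum_right)
qed

text \<open>The case of a constant \<open>G\<close> of the same identity evaluates the number of
  pairs of SSDEs, so the prefactors cancel in the quotient.\<close>

lemma expectation_eq_walk:
  fixes G :: "real \<Rightarrow> 'b::{banach, second_countable_topology}" and s t \<mu> :: real
  assumes h: "h \<ge> 1"
  defines "F \<equiv> (\<lambda>c::int. s * of_bool (c = 1) + t * of_bool (c = - 1))"
  shows "measure_pmf.expectation (random_summands (2 * h) l)
      (\<lambda>\<omega>. G (s * num_carries (2 * h) 1 \<omega> + t * num_carries (2 * h) (- 1) \<omega> - \<mu> * real l)) =
    (1 / finite_chain.walk ({- h..h} \<times> {- h..h}) (chain_weight h) (chain_next h)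
        (chain_inc h F \<mu>) (chain_final h F) (chain_end h) (\<lambda>_. 1) l (0, 0, 0) 0) *\<^sub>R
    finite_chain.walk ({- h..h} \<times> {- h..h}) (chain_weight h) (chain_next h)
        (chain_inc h F \<mu>) (chain_final h F) (chain_end h) G l (0, 0, 0) 0"
proof -
  define S where "S = SSDE (2 * h) l"
  define k where "k = digit_weight h 0 * digit_weight h 0 * (2 * real_of_int h)^(2 * l)"
  have q: "2 * h \<ge> 2" using h by simp
  have k: "k \<noteq> 0" using h by (simp add: k_def digit_weight_def)
  have S: "finite S" "S \<noteq> {}" "S = extensions (2 * h) 0 l"
    unfolding S_def by (rule finite_SSDE, rule SSDE_nonempty[OF q], rule SSDE_eq_conts[OF h])
  have reach0: "reach h 0 0 0" using h by (auto simp: reach_def)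
  note W = walk_eq_sum_conts[OF h reach0, where u = 0 and m = l and F = F and \<mu> = \<mu>, folded S(3) k_def]
  have "(\<Sum>xs\<in>S. \<Sum>ys\<in>S. G (s * num_carries (2 * h) 1 (xs, ys) + t * num_carries (2 * h) (- 1) (xs, ys) - \<mu> * real l))
      = (\<Sum>xs\<in>S. \<Sum>ys\<in>S. G (0 + carry_total F \<mu> (2 * h) 0 xs ys))"
    using q by (intro sum.cong refl arg_cong[where f = G])
      (auto simp: F_def S_def SSDE_def carry_total_eq_num_carries[where l = l])
  then have "measure_pmf.expectation (random_summands (2 * h) l)
      (\<lambda>\<omega>. G (s * num_carries (2 * h) 1 \<omega> + t * num_carries (2 * h) (- 1) \<omega> - \<mu> * real l)) =
     (1 / (real (card S))^2) *\<^sub>R k *\<^sub>R finite_chain.walk ({- h..h} \<times> {- h..h}) (chain_weight h) (chain_next h)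
        (chain_inc h F \<mu>) (chain_final h F) (chain_end h) G l (0, 0, 0) 0"
    unfolding expectation_random_summands[OF q] S_def[symmetric] W by simp
  moreover have "(real (card S))^2 = k * finite_chain.walk ({- h..h} \<times> {- h..h}) (chain_weight h) (chain_next h)
        (chain_inc h F \<mu>) (chain_final h F) (chain_end h) (\<lambda>_. 1) l (0, 0, 0) 0"
    using W[of "\<lambda>_. 1::real"] by (simp add: power2_eq_square)
  ultimately show ?thesis using k by simp
qed

section \<open>Number of carries\<close>

lemma step_sum_add: "step_sum h x y a (\<lambda>c e e' k. \<Psi> c e e' k + \<Psi>' c e e' k) = step_sum h x y a \<Psi> + step_sum h x y a \<Psi>'"
  by (simp add: step_sum_def pair_sum_def sum.distrib distrib_left)

lemma step_sum_cmult: "step_sum h x y a (\<lambda>c e e' k. r * \<Psi> c e e' k) = r * step_sum h x y a \<Psi>"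
  by (simp add: step_sum_def pair_sum_def sum_distrib_left mult_ac)

text \<open>The carry is no component of the new state, but it is recovered as
  \<open>a' - (x' + y')\<close>.\<close>

lemma sum_chain_eq_step_sum:
  "(\<Sum>d\<in>{- h..h} \<times> {- h..h}. chain_weight h (x, y, a) d *
      (case chain_next h (x, y, a) d of (x', y', a') \<Rightarrow> \<Psi> (a' - (x' + y')) (bsgn h x') (bsgn h y') (carry_class h a'))) =
    step_sum h x y a \<Psi>"
proof -
  have "(\<Sum>d\<in>{- h..h} \<times> {- h..h}. E d) = (\<Sum>x\<in>{- h..h}. \<Sum>y\<in>{- h..h}. E (x, y))" for E :: "int \<times> int \<Rightarrow> real"
    by (simp add: sum.cartesian_product)
  then show ?thesis by (simp add: chain_simps step_sum_def pair_sum_def)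
qed

definition varUU :: "real \<Rightarrow> real" where "varUU r = num_varUU r / ((r + 1) * (scaleU r)^2)"
definition varVV :: "real \<Rightarrow> real" where "varVV r = num_varVV r / ((r + 1) * (scaleV r)^2)"
definition muU :: "real \<Rightarrow> real" where "muU r = num_mu r / scaleU r"

definition gU :: "real \<Rightarrow> int \<Rightarrow> int \<Rightarrow> int \<Rightarrow> real" where
  "gU r e e' k = even_tab (num_gU r) e e' k / scaleU r"
definition gV :: "real \<Rightarrow> int \<Rightarrow> int \<Rightarrow> int \<Rightarrow> real" where
  "gV r e e' k = odd_tab (num_gV r) e e' k / scaleV r"
definition hUU :: "real \<Rightarrow> int \<Rightarrow> int \<Rightarrow> int \<Rightarrow> real" where
  "hUU r e e' k = 2 * even_tab (num_hUU r) e e' k / ((r + 1) * (scaleU r)^2)"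
definition hUV :: "real \<Rightarrow> int \<Rightarrow> int \<Rightarrow> int \<Rightarrow> real" where
  "hUV r e e' k = odd_tab (num_hUV r) e e' k / ((r^2 + 1) * scaleU r * scaleV r)"
definition hVV :: "real \<Rightarrow> int \<Rightarrow> int \<Rightarrow> int \<Rightarrow> real" where
  "hVV r e e' k = 4 * even_tab (num_hVV r) e e' k / ((r + 1) * (scaleV r)^2)"

section \<open>Moments and limit law of a linear combination of the two counts\<close>

context
  fixes h :: int and r :: real
  assumes h: "h \<ge> 1" and r: "r = 2 * real_of_int h"
begin

lemma r_ge: "2 \<le> r"
  using h by (simp add: r)

lemma scale_nonzero: "scaleU r \<noteq> 0" "scaleV r \<noteq> 0" "r + 1 \<noteq> 0" "r^2 + 1 \<noteq> 0"
  using r_ge sum_power2_gt_zero_iff[of r 1] by (auto simp: scaleU_def scaleV_def)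

lemma step_sum_U:
  assumes "reach h x y a"
  shows "step_sum h x y a (\<lambda>c e e' k. ((real_of_int c)^2 - muU r) + gU r e e' k) = gU r (bsgn h x) (bsgn h y) (carry_class h a)"
proof -
  have "(\<lambda>c e e' k. ((real_of_int c)^2 - muU r) + gU r e e' k) =
    (\<lambda>c e e' k. 1 / scaleU r * ((scaleU r * (real_of_int c)^2 - num_mu r) + even_tab (num_gU r) e e' k))"
    using scale_nonzero by (simp add: fun_eq_iff muU_def gU_def field_simps)
  then show ?thesis
    using poisson_gU[OF h assms, folded r] by (simp only: step_sum_cmult) (simp add: gU_def)
qed

lemma step_sum_V:
  assumes "reach h x y a"
  shows "step_sum h x y a (\<lambda>c e e' k. real_of_int c + gV r e e' k) = gV r (bsgn h x) (bsgn h y) (carry_class h a)"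
proof -
  have "(\<lambda>c e e' k. real_of_int c + gV r e e' k) =
    (\<lambda>c e e' k. 1 / scaleV r * (scaleV r * real_of_int c + odd_tab (num_gV r) e e' k))"
    using scale_nonzero by (simp add: fun_eq_iff gV_def field_simps)
  then show ?thesis
    using poisson_gV[OF h assms, folded r] by (simp only: step_sum_cmult) (simp add: gV_def)
qed

lemma step_sum_UU:
  assumes "reach h x y a"
  shows "step_sum h x y a (\<lambda>c e e' k. ((real_of_int c)^2 - muU r)^2 + 2 * ((real_of_int c)^2 - muU r) * gU r e e' k + hUU r e e' k) =
    varUU r + hUU r (bsgn h x) (bsgn h y) (carry_class h a)"
proof -
  have *: "(u / s)^2 + 2 * (u / s) * (g / s) + 2 * n / (k * s^2) = 1 / (k * s^2) * (k * u^2 + 2 * k * u * g + 2 * n)"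
    if "k \<noteq> 0" "s \<noteq> 0" for u s g n k :: real
    using that by (simp add: divide_simps power2_eq_square) (simp add: algebra_simps)
  have u: "(real_of_int c)^2 - muU r = (scaleU r * (real_of_int c)^2 - num_mu r) / scaleU r" for c
    using scale_nonzero by (simp add: muU_def field_simps)
  show ?thesis
    unfolding u gU_def hUU_def *[OF scale_nonzero(3,1)] step_sum_cmult poisson_hUU[OF h assms, folded r] varUU_def
    by (simp add: add_divide_distrib)
qed

lemma step_sum_UV:
  assumes "reach h x y a"
  shows "step_sum h x y a (\<lambda>c e e' k. ((real_of_int c)^2 - muU r) * real_of_int c + real_of_int c * gU r e e' k
      + ((real_of_int c)^2 - muU r) * gV r e e' k + hUV r e e' k) = hUV r (bsgn h x) (bsgn h y) (carry_class h a)"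
proof -
  have *: "u / s * v + v * (g / s) + u / s * (g' / s') + n / (k * s * s') =
      1 / (k * s * s') * (k * (u * (s' * v) + s' * v * g + u * g') + n)"
    if "k \<noteq> 0" "s \<noteq> 0" "s' \<noteq> 0" for u v s s' g g' n k :: real
    using that by (simp add: divide_simps) (simp add: algebra_simps)
  have u: "(real_of_int c)^2 - muU r = (scaleU r * (real_of_int c)^2 - num_mu r) / scaleU r" for c
    using scale_nonzero by (simp add: muU_def field_simps)
  show ?thesis
    unfolding u gU_def gV_def hUV_def *[OF scale_nonzero(4,1,2)] step_sum_cmult poisson_hUV[OF h assms, folded r]
    by simp
qed

lemma step_sum_VV:
  assumes "reach h x y a"
  shows "step_sum h x y a (\<lambda>c e e' k. (real_of_int c)^2 + 2 * real_of_int c * gV r e e' k + hVV r e e' k) =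
    varVV r + hVV r (bsgn h x) (bsgn h y) (carry_class h a)"
proof -
  have *: "v^2 + 2 * v * (g / s) + 4 * n / (k * s^2) = 1 / (k * s^2) * (k * (s * v)^2 + 2 * k * (s * v) * g + 4 * n)"
    if "k \<noteq> 0" "s \<noteq> 0" for v s g n k :: real
    using that by (simp add: divide_simps power2_eq_square) (simp add: algebra_simps)
  show ?thesis
    unfolding gV_def hVV_def *[OF scale_nonzero(3,2)] step_sum_cmult poisson_hVV[OF h assms, folded r] varVV_def
    by (simp add: add_divide_distrib)
qed

text \<open>With \<open>U = X + Y\<close> and \<open>V = X - Y\<close> the combination
  \<open>s * X + t * Y\<close> equals \<open>(s + t) / 2 * U + (s - t) / 2 * V\<close>, and its two
  parts are asymptotically uncorrelated.\<close>

definition asym_var :: "real \<Rightarrow> real \<Rightarrow> real" where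
  "asym_var s t = ((s + t) / 2)^2 * varUU r + ((s - t) / 2)^2 * varVV r"

lemma varUU_pos: "0 < varUU r" and varVV_pos: "0 < varVV r"
proof -
  \<comment> \<open>The numerator factors as \<open>3 * r^2 * (r - 1) * (r * p - 28)\<close>, and
    \<open>p \<ge> 21 * 2 + 8 = 50\<close>.\<close>
  define p where "p = r^3 + 4 * r^2 + 21 * r + 8"
  have "0 \<le> r^3 + 4 * r^2" using r_ge by simp
  then have p: "50 \<le> p" unfolding p_def using r_ge by linarith
  then have "2 * 50 \<le> r * p" using r_ge by (intro mult_mono) auto
  then have "0 < r * p - 28" by simp
  moreover have "num_varUU r = 3 * r^2 * (r - 1) * (r * p - 28)"
    by (simp add: num_varUU_def p_def algebra_simps eval_nat_numeral)
  ultimately have "0 < num_varUU r" using r_ge by simp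
  then show "0 < varUU r" using r_ge scale_nonzero by (simp add: varUU_def)
  have "0 < r^2 + 5 * r - 2" using r_ge by (smt (verit) zero_le_power2)
  then have "0 < num_varVV r" using r_ge by (simp add: num_varVV_def)
  then show "0 < varVV r" using r_ge scale_nonzero by (simp add: varVV_def)
qed

lemma asym_var_nonneg: "0 \<le> asym_var s t"
  using varUU_pos varVV_pos by (simp add: asym_var_def)

text \<open>The first equation is linear in the increment and the second quadratic, so the solutions
  for \<open>U\<close> and \<open>V\<close> combine with coefficients \<open>\<alpha>\<close>,
  \<open>\<beta>\<close> and \<open>\<alpha>^2\<close>, \<open>2 * \<alpha> * \<beta>\<close>,
  \<open>\<beta>^2\<close>. The mixed term adds no constant to the variance.\<close>

lemma poisson_equations:
  fixes s t :: real
  defines "F \<equiv> (\<lambda>c::int. s * of_bool (c = 1) + t * of_bool (c = - 1))"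
    and "\<alpha> \<equiv> (s + t) / 2" and "\<beta> \<equiv> (s - t) / 2" and "\<mu> \<equiv> (s + t) / 2 * muU r"
  defines "g \<equiv> (\<lambda>(x, y, a). \<alpha> * gU r (bsgn h x) (bsgn h y) (carry_class h a) + \<beta> * gV r (bsgn h x) (bsgn h y) (carry_class h a))"
    and "g2 \<equiv> (\<lambda>(x, y, a). \<alpha>^2 * hUU r (bsgn h x) (bsgn h y) (carry_class h a) + 2 * \<alpha> * \<beta> * hUV r (bsgn h x) (bsgn h y) (carry_class h a)
        + \<beta>^2 * hVV r (bsgn h x) (bsgn h y) (carry_class h a))"
  assumes z: "z \<in> chain_states h"
  shows "(\<Sum>d\<in>{- h..h} \<times> {- h..h}. chain_weight h z d * (chain_inc h F \<mu> z d + g (chain_next h z d))) = g z"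
    and "(\<Sum>d\<in>{- h..h} \<times> {- h..h}. chain_weight h z d * ((chain_inc h F \<mu> z d)^2
        + 2 * chain_inc h F \<mu> z d * g (chain_next h z d) + g2 (chain_next h z d))) = asym_var s t + g2 z"
proof -
  obtain x y a where z': "z = (x, y, a)" by (cases z) auto
  have reach: "reach h x y a" using z by (simp add: z' chain_states_def)
  \<comment> \<open>On the values -1, 0 and 1 any increment with \<open>F 0 = 0\<close> is a
    combination of \<open>c^2\<close> and \<open>c\<close>, the increments of \<open>U\<close> and
    \<open>V\<close>.\<close>
  define f where "f = (\<lambda>c::int. \<alpha> * ((real_of_int c)^2 - muU r) + \<beta> * real_of_int c)"
  have F: "F c - \<mu> = f c" if "c = - 1 \<or> c = 0 \<or> c = 1" for c
    using that by (auto simp: F_def f_def \<mu>_def \<alpha>_def \<beta>_def field_simps)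
  have inc: "chain_inc h F \<mu> (x, y, a) d = f (case chain_next h (x, y, a) d of (x', y', a') \<Rightarrow> a' - (x' + y'))" for d
    using F[OF next_carry_cases] by (cases d) (simp add: chain_simps)
  have "(\<Sum>d\<in>{- h..h} \<times> {- h..h}. chain_weight h z d * (chain_inc h F \<mu> z d + g (chain_next h z d))) =
      step_sum h x y a (\<lambda>c e e' k. f c + (\<alpha> * gU r e e' k + \<beta> * gV r e e' k))"
    unfolding sum_chain_eq_step_sum[symmetric] z' inc
    by (intro sum.cong refl) (simp add: g_def split: prod.split)
  also have "(\<lambda>c e e' k. f c + (\<alpha> * gU r e e' k + \<beta> * gV r e e' k)) =
      (\<lambda>c e e' k. \<alpha> * (((real_of_int c)^2 - muU r) + gU r e e' k) + \<beta> * (real_of_int c + gV r e e' k))"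
    by (simp add: f_def fun_eq_iff algebra_simps)
  also have "step_sum h x y a \<dots> = g z"
    by (subst step_sum_add) (simp only: step_sum_cmult step_sum_U[OF reach] step_sum_V[OF reach] g_def z' prod.case)
  finally show "(\<Sum>d\<in>{- h..h} \<times> {- h..h}. chain_weight h z d * (chain_inc h F \<mu> z d + g (chain_next h z d))) = g z" .
  have "(\<Sum>d\<in>{- h..h} \<times> {- h..h}. chain_weight h z d * ((chain_inc h F \<mu> z d)^2
        + 2 * chain_inc h F \<mu> z d * g (chain_next h z d) + g2 (chain_next h z d))) =
      step_sum h x y a (\<lambda>c e e' k. (f c)^2 + 2 * f c * (\<alpha> * gU r e e' k + \<beta> * gV r e e' k)
        + (\<alpha>^2 * hUU r e e' k + 2 * \<alpha> * \<beta> * hUV r e e' k + \<beta>^2 * hVV r e e' k))"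
    unfolding sum_chain_eq_step_sum[symmetric] z' inc
    by (intro sum.cong refl) (simp add: g_def g2_def split: prod.split)
  also have "(\<lambda>c e e' k. (f c)^2 + 2 * f c * (\<alpha> * gU r e e' k + \<beta> * gV r e e' k)
        + (\<alpha>^2 * hUU r e e' k + 2 * \<alpha> * \<beta> * hUV r e e' k + \<beta>^2 * hVV r e e' k)) =
      (\<lambda>c e e' k. (\<alpha>^2 * (((real_of_int c)^2 - muU r)^2 + 2 * ((real_of_int c)^2 - muU r) * gU r e e' k + hUU r e e' k)
        + (2 * \<alpha> * \<beta>) * (((real_of_int c)^2 - muU r) * real_of_int c + real_of_int c * gU r e e' k
            + ((real_of_int c)^2 - muU r) * gV r e e' k + hUV r e e' k))
        + \<beta>^2 * ((real_of_int c)^2 + 2 * real_of_int c * gV r e e' k + hVV r e e' k))"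
  proof (intro ext)
    fix c e e' k :: int
    define u where "u = (real_of_int c)^2 - muU r"
    define v where "v = real_of_int c"
    show "(f c)^2 + 2 * f c * (\<alpha> * gU r e e' k + \<beta> * gV r e e' k)
        + (\<alpha>^2 * hUU r e e' k + 2 * \<alpha> * \<beta> * hUV r e e' k + \<beta>^2 * hVV r e e' k) =
      (\<alpha>^2 * (((real_of_int c)^2 - muU r)^2 + 2 * ((real_of_int c)^2 - muU r) * gU r e e' k + hUU r e e' k)
        + (2 * \<alpha> * \<beta>) * (((real_of_int c)^2 - muU r) * real_of_int c + real_of_int c * gU r e e' k
            + ((real_of_int c)^2 - muU r) * gV r e e' k + hUV r e e' k))
        + \<beta>^2 * ((real_of_int c)^2 + 2 * real_of_int c * gV r e e' k + hVV r e e' k)"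
      unfolding f_def u_def[symmetric] unfolding v_def[symmetric] by (simp add: algebra_simps power2_eq_square)
  qed
  also have "step_sum h x y a \<dots> = asym_var s t + g2 z"
    by (subst step_sum_add, subst step_sum_add,
        simp only: step_sum_cmult step_sum_UU[OF reach] step_sum_UV[OF reach] step_sum_VV[OF reach])
       (simp add: g2_def z' asym_var_def \<alpha>_def \<beta>_def algebra_simps)
  finally show "(\<Sum>d\<in>{- h..h} \<times> {- h..h}. chain_weight h z d * ((chain_inc h F \<mu> z d)^2
        + 2 * chain_inc h F \<mu> z d * g (chain_next h z d) + g2 (chain_next h z d))) = asym_var s t + g2 z" .
qed

definition centered :: "real \<Rightarrow> real \<Rightarrow> nat \<Rightarrow> int list \<times> int list \<Rightarrow> real" where
  "centered s t l \<omega> = s * num_carries (2 * h) 1 \<omega> + t * num_carries (2 * h) (- 1) \<omega> - (s + t) / 2 * muU r * real l"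

lemma centered_moments:
  obtains M where
    "\<And>l. \<bar>measure_pmf.expectation (random_summands (2 * h) l) (centered s t l)\<bar> \<le> M"
    "\<And>l. \<bar>measure_pmf.expectation (random_summands (2 * h) l) (\<lambda>\<omega>. (centered s t l \<omega>)^2) - asym_var s t * real l\<bar> \<le> M"
proof -
  interpret finite_chain "chain_states h" "{- h..h} \<times> {- h..h}" "chain_weight h" "chain_next h" "(0, 0)" "(0, 0, 0)"
    "(1 / (2 * real_of_int h))^2" by (rule finite_chain_carries[OF h])
  have end_pos: "0 < chain_end h z" for z by (cases z) (simp add: chain_simps digit_weight_def)
  note eqs = poisson_equations[where s = s and t = t]
  obtain M where M:
    "\<And>m. \<bar>walk (chain_inc h (\<lambda>c. s * of_bool (c = 1) + t * of_bool (c = - 1)) ((s + t) / 2 * muU r))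
        (chain_final h (\<lambda>c. s * of_bool (c = 1) + t * of_bool (c = - 1))) (chain_end h) (\<lambda>v. v) m (0, 0, 0) 0 /
      walk (chain_inc h (\<lambda>c. s * of_bool (c = 1) + t * of_bool (c = - 1)) ((s + t) / 2 * muU r))
        (chain_final h (\<lambda>c. s * of_bool (c = 1) + t * of_bool (c = - 1))) (chain_end h) (\<lambda>_. 1) m (0, 0, 0) 0\<bar> \<le> M"
    "\<And>m. \<bar>walk (chain_inc h (\<lambda>c. s * of_bool (c = 1) + t * of_bool (c = - 1)) ((s + t) / 2 * muU r))
        (chain_final h (\<lambda>c. s * of_bool (c = 1) + t * of_bool (c = - 1))) (chain_end h) (\<lambda>v. v^2) m (0, 0, 0) 0 /
      walk (chain_inc h (\<lambda>c. s * of_bool (c = 1) + t * of_bool (c = - 1)) ((s + t) / 2 * muU r))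
        (chain_final h (\<lambda>c. s * of_bool (c = 1) + t * of_bool (c = - 1))) (chain_end h) (\<lambda>_. 1) m (0, 0, 0) 0
        - asym_var s t * real m\<bar> \<le> M"
    using walk_moments[where ?w0.0 = "chain_end h" and
        ?f0.0 = "chain_final h (\<lambda>c. s * of_bool (c = 1) + t * of_bool (c = - 1))", OF end_pos eqs z0] by blast
  show thesis
  proof (rule that)
    fix l
    show "\<bar>measure_pmf.expectation (random_summands (2 * h) l) (centered s t l)\<bar> \<le> M"
      using M(1)[of l] expectation_eq_walk[OF h, of l "\<lambda>v. v" s t "(s + t) / 2 * muU r"]
      by (simp add: centered_def[abs_def])
    show "\<bar>measure_pmf.expectation (random_summands (2 * h) l) (\<lambda>\<omega>. (centered s t l \<omega>)^2) - asym_var s t * real l\<bar> \<le> M"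
      using M(2)[of l] expectation_eq_walk[OF h, of l "\<lambda>v. v^2" s t "(s + t) / 2 * muU r"]
      by (simp add: centered_def[abs_def])
  qed
qed

lemma centered_central_limit:
  "(\<lambda>l. measure_pmf.expectation (random_summands (2 * h) l) (\<lambda>\<omega>. cis (1 / sqrt (real l) * centered s t l \<omega>)))
    \<longlonglongrightarrow> of_real (exp (- asym_var s t / 2))"
proof -
  interpret finite_chain "chain_states h" "{- h..h} \<times> {- h..h}" "chain_weight h" "chain_next h" "(0, 0)" "(0, 0, 0)"
    "(1 / (2 * real_of_int h))^2" by (rule finite_chain_carries[OF h])
  have end_pos: "0 < chain_end h z" for z by (cases z) (simp add: chain_simps digit_weight_def)
  note eqs = poisson_equations[where s = s and t = t]
  note lim = walk_central_limit[where ?w0.0 = "chain_end h" and ?f0.0 = "chain_final h (\<lambda>c. s * of_bool (c = 1) + t * of_bool (c = - 1))",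
      OF end_pos eqs asym_var_nonneg z0]
  have "measure_pmf.expectation (random_summands (2 * h) l) (\<lambda>\<omega>. cis (1 / sqrt (real l) * centered s t l \<omega>)) =
      walk (chain_inc h (\<lambda>c. s * of_bool (c = 1) + t * of_bool (c = - 1)) ((s + t) / 2 * muU r))
        (chain_final h (\<lambda>c. s * of_bool (c = 1) + t * of_bool (c = - 1))) (chain_end h)
        (\<lambda>v. cis (1 / sqrt (real l) * v)) l (0, 0, 0) 0 /
      of_real (walk (chain_inc h (\<lambda>c. s * of_bool (c = 1) + t * of_bool (c = - 1)) ((s + t) / 2 * muU r))
        (chain_final h (\<lambda>c. s * of_bool (c = 1) + t * of_bool (c = - 1))) (chain_end h) (\<lambda>_. 1) l (0, 0, 0) 0)" for l
    unfolding centered_def expectation_eq_walk[OF h, of l "\<lambda>v. cis (1 / sqrt (real l) * v)" s t "(s + t) / 2 * muU r"]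
    by (simp add: scaleR_conv_of_real)
  then show ?thesis using lim by simp
qed

end

text \<open>Moments about approximate means suffice: for \<open>c\<close> and \<open>d\<close>
  within bounded distance of the true means the correction is bounded.\<close>

lemma covariance_shift:
  fixes p :: "'a pmf" and X Y :: "'a \<Rightarrow> real"
  assumes "finite (set_pmf p)"
  shows "covariance (measure_pmf p) X Y = measure_pmf.expectation p (\<lambda>\<omega>. (X \<omega> - c) * (Y \<omega> - d))
    - (measure_pmf.expectation p X - c) * (measure_pmf.expectation p Y - d)"
proof -
  have i: "integrable (measure_pmf p) f" for f :: "'a \<Rightarrow> real" using assms by (rule integrable_measure_pmf_finite)
  define m n where "m = measure_pmf.expectation p X" and "n = measure_pmf.expectation p Y"
  have "(X \<omega> - m) * (Y \<omega> - n) = (X \<omega> - c) * (Y \<omega> - d) + ((- (m - c)) * Y \<omega> + ((- (n - d)) * X \<omega> + ((m - c) * d + (n - d) * c + (m - c) * (n - d))))" for \<omega>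
    by (simp add: algebra_simps)
  then have "covariance (measure_pmf p) X Y = measure_pmf.expectation p (\<lambda>\<omega>. (X \<omega> - c) * (Y \<omega> - d))
      + (- (m - c) * n + (- (n - d) * m + ((m - c) * d + (n - d) * c + (m - c) * (n - d))))"
    unfolding covariance_def m_def[symmetric] n_def[symmetric]
    by (simp only: Bochner_Integration.integral_add[OF i i] integral_mult_right_zero)
       (simp add: m_def[symmetric] n_def[symmetric])
  then show ?thesis by (simp add: m_def[symmetric] n_def[symmetric] algebra_simps)
qed

lemma finite_set_pmf_random_summands: "q \<ge> 2 \<Longrightarrow> finite (set_pmf (random_summands q l))"
  using finite_SSDE SSDE_nonempty by (auto simp: random_summands_def)

lemma bounded_imp_bigo_one:
  fixes f :: "nat \<Rightarrow> real"
  assumes "\<And>l. \<bar>f l\<bar> \<le> M" shows "f \<in> O(\<lambda>_. 1)"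
  using assms by (intro bigoI[where c=M]) simp

section \<open>Closed forms of the asymptotic variance and covariance\<close>

lemma varUU_eq:
  assumes "2 \<le> r"
  shows "varUU r = (3*r^6 + 12*r^5 + 63*r^4 + 24*r^3 - 84*r^2) / (16 * ((r + 1)^5 * (r - 1)))"
proof -
  have "a * d / (e * (4 * e^2 * d)^2) = a / (16 * (e^5 * d))" if "d \<noteq> 0" for a d e :: real
    using that by (simp add: eval_nat_numeral)
  from this[of "r - 1" _ "r + 1"] show ?thesis
    using assms by (simp add: varUU_def num_varUU_def scaleU_def)
qed

lemma varVV_eq:
  assumes "2 \<le> r"
  shows "varVV r = 4 * (r + 1)^4 * (r^2 + 5*r - 2) / (16 * ((r + 1)^5 * (r - 1)))"
proof -
  have "4 * d * a / (e * (4 * d)^2) = 4 * e^4 * a / (16 * (e^5 * d))" if "d \<noteq> 0" "e \<noteq> 0" for a d e :: real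
    using that by (simp add: eval_nat_numeral)
  from this[of "r - 1" "r + 1"] show ?thesis
    using assms by (simp add: varVV_def num_varVV_def scaleV_def)
qed

text \<open>As \<open>X = (U + V) / 2\<close> and \<open>Y = (U - V) / 2\<close> with
  \<open>U\<close> and \<open>V\<close> asymptotically uncorrelated, these are the asymptotic
  variance of either count and their covariance, per digit.\<close>

lemma var_carries_eq:
  assumes "2 \<le> r"
  shows "(varUU r + varVV r) / 4 =
      (7*r^6 + 48*r^5 + 159*r^4 + 128*r^3 - 48*r^2 - 12*r - 8) / (64 * (r + 1)^5 * (r - 1))"
    and "(varUU r - varVV r) / 4 =
      - ((r^6 + 24*r^5 + 33*r^4 + 80*r^3 + 120*r^2 - 12*r - 8) / (64 * (r + 1)^5 * (r - 1)))"
proof -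
  define k where "k = (r + 1)^5 * (r - 1)"
  have k: "64 * (r + 1)^5 * (r - 1) = 4 * (16 * k)" by (simp add: k_def)
  have e: "(3*r^6 + 12*r^5 + 63*r^4 + 24*r^3 - 84*r^2) + 4 * (r + 1)^4 * (r^2 + 5*r - 2) =
      7*r^6 + 48*r^5 + 159*r^4 + 128*r^3 - 48*r^2 - 12*r - 8"
    "(3*r^6 + 12*r^5 + 63*r^4 + 24*r^3 - 84*r^2) - 4 * (r + 1)^4 * (r^2 + 5*r - 2) =
      - (r^6 + 24*r^5 + 33*r^4 + 80*r^3 + 120*r^2 - 12*r - 8)"
    by (simp_all add: algebra_simps eval_nat_numeral)
  show "(varUU r + varVV r) / 4 =
      (7*r^6 + 48*r^5 + 159*r^4 + 128*r^3 - 48*r^2 - 12*r - 8) / (64 * (r + 1)^5 * (r - 1))"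
    unfolding varUU_eq[OF assms] varVV_eq[OF assms] k k_def[symmetric] add_divide_distrib[symmetric] e by simp
  show "(varUU r - varVV r) / 4 =
      - ((r^6 + 24*r^5 + 33*r^4 + 80*r^3 + 120*r^2 - 12*r - 8) / (64 * (r + 1)^5 * (r - 1)))"
    unfolding varUU_eq[OF assms] varVV_eq[OF assms] k k_def[symmetric] diff_divide_distrib[symmetric] e
    by (simp only: minus_divide_left divide_divide_eq_left mult.commute)
qed

text \<open>Polarization with errors: \<open>A1\<close>, \<open>A2\<close>, \<open>A3\<close> stand
  for the second moments of \<open>X\<close>, \<open>Y\<close> and \<open>X + Y\<close> about their
  approximate means, \<open>u\<close> and \<open>v\<close> for the linear main terms of variance and
  covariance, and \<open>p\<close> for the product of the two remaining means.\<close>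

lemma abs_polarization_le:
  fixes x p u v A1 A2 A3 M1 M2 M3 P :: real
  assumes "x = (1 / 2) * (A3 - A1 - A2)" "\<bar>p\<bar> \<le> P" "\<bar>A1 - u\<bar> \<le> M1" "\<bar>A2 - u\<bar> \<le> M2"
    "\<bar>A3 - (2 * u + 2 * v)\<bar> \<le> M3"
  shows "\<bar>x - p - v\<bar> \<le> M1 + M2 + M3 + P"
  using assms by (simp add: field_simps)

theorem theorem2:
  fixes q :: int
  assumes "even q" and "q \<ge> 2"
  shows "let r = real_of_int q in
    (\<forall>d \<in> {1, - 1}.
       (\<lambda>l. measure_pmf.expectation (random_summands q l) (num_carries q d)
            - (r^2 + 2*r + 4) / (8 * (r + 1)^2) * real l) \<in> O(\<lambda>_. 1) \<and>
       (\<lambda>l. measure_pmf.variance (random_summands q l) (num_carries q d)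
            - (7*r^6 + 48*r^5 + 159*r^4 + 128*r^3 - 48*r^2 - 12*r - 8)
              / (64 * (r + 1)^5 * (r - 1)) * real l) \<in> O(\<lambda>_. 1)) \<and>
    (\<lambda>l. covariance (random_summands q l) (num_carries q 1) (num_carries q (- 1))
         - (- ((r^6 + 24*r^5 + 33*r^4 + 80*r^3 + 120*r^2 - 12*r - 8)
              / (64 * (r + 1)^5 * (r - 1)))) * real l) \<in> O(\<lambda>_. 1) \<and>
    asymptotically_jointly_normal (\<lambda>l. measure_pmf (random_summands q l))
      (\<lambda>_. num_carries q 1) (\<lambda>_. num_carries q (- 1))"
proof -
  define h where "h = q div 2"
  define r where "r = real_of_int q"
  have q: "q = 2 * h" using assms(1) by (simp add: h_def)
  have h: "h \<ge> 1" using assms(2) q by linarith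
  have rh: "r = 2 * real_of_int h" by (simp add: r_def q)
  have r2: "2 \<le> r" using assms(2) by (simp add: r_def)
  define T where "T = centered h r"
  define E where "E = (\<lambda>l. measure_pmf.expectation (random_summands q l) :: (int list \<times> int list \<Rightarrow> real) \<Rightarrow> real)"
  define X where "X = num_carries q 1"
  define Y where "Y = num_carries q (- 1)"
  define \<mu> where "\<mu> = muU r / 2"
  have i: "integrable (measure_pmf (random_summands q l)) f" for l and f :: "int list \<times> int list \<Rightarrow> real"
    by (rule integrable_measure_pmf_finite[OF finite_set_pmf_random_summands[OF assms(2)]])
  have T: "T s t l \<omega> = s * (X \<omega> - \<mu> * real l) + t * (Y \<omega> - \<mu> * real l)" for s t l \<omega>
    by (simp add: T_def centered_def[OF h rh] X_def Y_def \<mu>_def q algebra_simps add_divide_distrib)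
  have mom: "\<exists>M. (\<forall>l. \<bar>E l (T s t l)\<bar> \<le> M) \<and> (\<forall>l. \<bar>E l (\<lambda>\<omega>. (T s t l \<omega>)^2) - asym_var r s t * real l\<bar> \<le> M)" for s t
    using centered_moments[OF h rh, of s t] unfolding E_def T_def q by metis
  obtain M1 where M1: "\<And>l. \<bar>E l (T 1 0 l)\<bar> \<le> M1" "\<And>l. \<bar>E l (\<lambda>\<omega>. (T 1 0 l \<omega>)^2) - asym_var r 1 0 * real l\<bar> \<le> M1"
    using mom[of 1 0] by auto
  obtain M2 where M2: "\<And>l. \<bar>E l (T 0 1 l)\<bar> \<le> M2" "\<And>l. \<bar>E l (\<lambda>\<omega>. (T 0 1 l \<omega>)^2) - asym_var r 0 1 * real l\<bar> \<le> M2"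
    using mom[of 0 1] by auto
  obtain M3 where M3: "\<And>l. \<bar>E l (T 1 1 l)\<bar> \<le> M3" "\<And>l. \<bar>E l (\<lambda>\<omega>. (T 1 1 l \<omega>)^2) - asym_var r 1 1 * real l\<bar> \<le> M3"
    using mom[of 1 1] by auto
  define a where "a = (varUU r + varVV r) / 4"
  define b where "b = (varUU r - varVV r) / 4"
  have av: "asym_var r s t = a * s^2 + 2 * b * s * t + a * t^2" for s t
    by (simp add: asym_var_def[OF h rh] a_def b_def field_simps power2_eq_square)
  have av10: "asym_var r 1 0 = a" and av01: "asym_var r 0 1 = a" by (simp_all add: av)
  have EX: "E l X - \<mu> * real l = E l (T 1 0 l)" and EY: "E l Y - \<mu> * real l = E l (T 0 1 l)" for l
    unfolding E_def T by (simp_all add: i)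
  have \<mu>: "(r^2 + 2*r + 4) / (8 * (r + 1)^2) = \<mu>"
    using r2 by (simp add: \<mu>_def muU_def num_mu_def scaleU_def)
  have cov: "covariance (random_summands q l) U V = E l (\<lambda>\<omega>. (U \<omega> - \<mu> * real l) * (V \<omega> - \<mu> * real l))
      - (E l U - \<mu> * real l) * (E l V - \<mu> * real l)" for l U V
    unfolding E_def by (rule covariance_shift[OF finite_set_pmf_random_summands[OF assms(2)]])
  have var: "measure_pmf.variance (random_summands q l) U = covariance (random_summands q l) U U" for l and U :: "int list \<times> int list \<Rightarrow> real"
    by (simp add: covariance_def power2_eq_square)
  have sq: "(E l (T s t l))^2 \<le> M^2" if "\<bar>E l (T s t l)\<bar> \<le> M" for s t l M
    using power_mono[OF that, of 2] by simp
  have varX: "(\<lambda>l. measure_pmf.variance (random_summands q l) X - a * real l) \<in> O(\<lambda>_. 1)"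
  proof (rule bounded_imp_bigo_one)
    fix l
    have v: "measure_pmf.variance (random_summands q l) X = E l (\<lambda>\<omega>. (T 1 0 l \<omega>)^2) - (E l (T 1 0 l))^2"
      unfolding var cov EX by (simp add: T power2_eq_square)
    show "\<bar>measure_pmf.variance (random_summands q l) X - a * real l\<bar> \<le> M1 + M1^2"
      unfolding v using M1(2)[of l, unfolded av10] sq[OF M1(1)[of l]] zero_le_power2[of "E l (T 1 0 l)"] by linarith
  qed
  have varY: "(\<lambda>l. measure_pmf.variance (random_summands q l) Y - a * real l) \<in> O(\<lambda>_. 1)"
  proof (rule bounded_imp_bigo_one)
    fix l
    have v: "measure_pmf.variance (random_summands q l) Y = E l (\<lambda>\<omega>. (T 0 1 l \<omega>)^2) - (E l (T 0 1 l))^2"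
      unfolding var cov EY by (simp add: T power2_eq_square)
    show "\<bar>measure_pmf.variance (random_summands q l) Y - a * real l\<bar> \<le> M2 + M2^2"
      unfolding v using M2(2)[of l, unfolded av01] sq[OF M2(1)[of l]] zero_le_power2[of "E l (T 0 1 l)"] by linarith
  qed
  have covXY: "(\<lambda>l. covariance (random_summands q l) X Y - b * real l) \<in> O(\<lambda>_. 1)"
  proof (rule bounded_imp_bigo_one)
    fix l
    have "(X \<omega> - \<mu> * real l) * (Y \<omega> - \<mu> * real l) =
        (1 / 2) * ((T 1 1 l \<omega>)^2 - (T 1 0 l \<omega>)^2 - (T 0 1 l \<omega>)^2)" for \<omega>
      by (simp add: T power2_eq_square algebra_simps)
    then have "E l (\<lambda>\<omega>. (X \<omega> - \<mu> * real l) * (Y \<omega> - \<mu> * real l)) =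
        (1 / 2) * (E l (\<lambda>\<omega>. (T 1 1 l \<omega>)^2) - E l (\<lambda>\<omega>. (T 1 0 l \<omega>)^2) - E l (\<lambda>\<omega>. (T 0 1 l \<omega>)^2))"
      unfolding E_def by (simp only: integral_mult_right_zero Bochner_Integration.integral_diff[OF i i])
    moreover have "\<bar>E l (T 1 0 l) * E l (T 0 1 l)\<bar> \<le> M1 * M2"
      unfolding abs_mult using M1(1)[of l] M2(1)[of l] by (intro mult_mono) auto
    moreover have "asym_var r 1 1 * real l = 2 * (a * real l) + 2 * (b * real l)"
      by (simp add: av algebra_simps)
    ultimately show "\<bar>covariance (random_summands q l) X Y - b * real l\<bar> \<le> M1 + M2 + M3 + M1 * M2"
      unfolding cov EX EY
      using M1(2)[of l] M2(2)[of l] M3(2)[of l] unfolding av10 av01 by (intro abs_polarization_le) simp_all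
  qed
  have pos: "0 < a" "b^2 < a * a"
  proof -
    have v: "0 < varUU r" "0 < varVV r" using varUU_pos[OF h rh] varVV_pos[OF h rh] by auto
    then show "0 < a" by (simp add: a_def)
    \<comment> \<open>This is the determinant of the limiting covariance matrix; the law is
      nondegenerate because \<open>U\<close> and \<open>V\<close> both have positive asymptotic
      variance.\<close>
    have "0 < varUU r * varVV r / 4" using v by simp
    also have "\<dots> = a * a - b^2" by (simp add: a_def b_def field_simps power2_eq_square)
    finally show "b^2 < a * a" by simp
  qed
  define W where "W = (\<lambda>l \<omega>. ((X \<omega> - E l X) / sqrt (real l), (Y \<omega> - E l Y) / sqrt (real l)))"
  have "converges_in_distribution (\<lambda>l. measure_pmf (random_summands q l)) W (bivariate_normal a b a)"
  proof (rule converges_in_distribution_if_char_converges)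
    fix s t
    obtain M where M: "\<And>l. \<bar>E l (T s t l)\<bar> \<le> M" using mom[of s t] by auto
    \<comment> \<open>Centering by the exact mean instead of by \<open>\<mu> * l\<close> changes the
      phase by \<open>c l\<close> only, which tends to 0 because the two centerings differ by a
      bounded amount.\<close>
    define c where "c = (\<lambda>l. 1 / sqrt (real l) * E l (T s t l))"
    have sqrt0: "(\<lambda>l. 1 / sqrt (real l)) \<longlonglongrightarrow> 0"
      by (intro tendsto_divide_0[OF tendsto_const] filterlim_at_top_imp_at_infinity
        filterlim_compose[OF sqrt_at_top] filterlim_real_sequentially)
    have "c \<longlonglongrightarrow> 0"
    proof (rule Lim_null_comparison)
      have "norm (c l) \<le> 1 / sqrt (real l) * M" for l
        unfolding c_def using M[of l] by (simp add: abs_mult divide_right_mono)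
      then show "\<forall>\<^sub>F l in sequentially. norm (c l) \<le> 1 / sqrt (real l) * M" by simp
      show "(\<lambda>l. 1 / sqrt (real l) * M) \<longlonglongrightarrow> 0" by (rule tendsto_mult_left_zero[OF sqrt0])
    qed
    then have "(\<lambda>l. cis (- c l)) \<longlonglongrightarrow> cis (- 0)" by (intro tendsto_intros)
    moreover have "(\<lambda>l. measure_pmf.expectation (random_summands q l) (\<lambda>\<omega>. cis (1 / sqrt (real l) * T s t l \<omega>)))
        \<longlonglongrightarrow> of_real (exp (- asym_var r s t / 2))"
      unfolding T_def q by (rule centered_central_limit[OF h rh])
    ultimately have "(\<lambda>l. cis (- c l) * measure_pmf.expectation (random_summands q l) (\<lambda>\<omega>. cis (1 / sqrt (real l) * T s t l \<omega>)))
        \<longlonglongrightarrow> cis (- 0) * of_real (exp (- asym_var r s t / 2))"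
      by (rule tendsto_mult)
    moreover have "cis (- c l) * measure_pmf.expectation (random_summands q l) (\<lambda>\<omega>. cis (1 / sqrt (real l) * T s t l \<omega>)) =
        (\<integral>\<omega>. cis (s * fst (W l \<omega>) + t * snd (W l \<omega>)) \<partial>measure_pmf (random_summands q l))" for l
    proof -
      have "E l (T s t l) = s * (E l X - \<mu> * real l) + t * (E l Y - \<mu> * real l)"
        unfolding E_def T by (simp add: i)
      then have "s * fst (W l \<omega>) + t * snd (W l \<omega>) = - c l + 1 / sqrt (real l) * T s t l \<omega>" for \<omega>
        unfolding c_def W_def T by (simp add: diff_divide_distrib add_divide_distrib right_diff_distrib)
      then show ?thesis by (simp only: cis_mult[symmetric] integral_mult_right_zero)
    qed
    moreover have "(\<integral>z. cis (s * fst z + t * snd z) \<partial>bivariate_normal a b a) = cis (- 0) * of_real (exp (- asym_var r s t / 2))"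
      unfolding char_bivariate_normal[OF pos] av by simp
    ultimately show "(\<lambda>l. \<integral>\<omega>. cis (s * fst (W l \<omega>) + t * snd (W l \<omega>)) \<partial>measure_pmf (random_summands q l))
        \<longlonglongrightarrow> (\<integral>z. cis (s * fst z + t * snd z) \<partial>bivariate_normal a b a)"
      by simp
  qed (simp_all add: measure_pmf.prob_space_axioms prob_space_bivariate_normal[OF pos])
  then have "asymptotically_jointly_normal (\<lambda>l. measure_pmf (random_summands q l)) (\<lambda>_. X) (\<lambda>_. Y)"
    unfolding asymptotically_jointly_normal_def W_def E_def using pos by blast
  moreover have "(\<lambda>l. E l X - \<mu> * real l) \<in> O(\<lambda>_. 1)" "(\<lambda>l. E l Y - \<mu> * real l) \<in> O(\<lambda>_. 1)"
    unfolding EX EY using M1(1) M2(1) by (auto intro: bounded_imp_bigo_one)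
  ultimately show ?thesis
    using varX varY covXY
    unfolding Let_def r_def[symmetric] \<mu> var_carries_eq[OF r2, symmetric] a_def[symmetric] b_def[symmetric]
    by (simp add: X_def Y_def E_def)
qed

end
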